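(* Let $\Omega\subset\mathbb{R}^N$ be a smooth, bounded domain with a $C^3$-boundary, $g\in C(\partial\Omega)$, and let $F:\mathcal{S}^N\times\mathbb{R}^N\times\mathbb{R}\times\overline\Omega\to\mathbb{R}$ be a continuous function satisfying the ellipticity condition and assumptions (H4'), (H5), (H6) stated in the context. Let $u$ and $v$ be respectively a bounded upper semicontinuous viscosity subsolution and a bounded lower semicontinuous viscosity supersolution on $\overline\Omega$ of the generalized Dirichlet problem $$F(D^2u,Du,u,x)=0\ \text{ in }\Omega,\qquad u=g\ \text{ on }\partial\Omega,$$ where $u$ satisfies $u(x)=\limsup_{y\to x,\,y\in\Omega}u(y)$ for any $x\in\partial\Omega$. Then $$u\le v\quad\text{on }\overline\Omega.$$
   Context: $\mathcal{S}^N$ is the space of symmetric $N\times N$ real matrices. Ellipticity condition: $F(X,p,s,x)\le F(Y,p,s,x)$ whenever $X\ge Y$; similarly $\tilde G_R(X)\le\tilde G_R(Y)$ whenever $X\ge Y$. (H4') There is $m>2$ such that for any $R>0$: $F(M,p,s,x)\le0\Rightarrow\tilde G_R(M)+K_1^R|p|^m-K_2^R\le0$, for any $M\in\mathcal{S}^N$, $p\in\mathbb{R}^N$, $|s|\le R$, $x\in\overline\Omega$, where $K_1^R,K_2^R$ are positive constants and $\tilde G_R:\mathcal{S}^N\to\mathbb{R}$ is Lipschitz continuous, satisfies the ellipticity condition and is homogeneous of degree $1$. Set $\alpha=\frac{m-2}{m-1}$. (H5) For all $R$ there exists $\gamma_R>0$ such that, for all $x\in\overline\Omega$, $-R\le s'\le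 s\le R$, $p\in\mathbb{R}^N$, $M\in\mathcal{S}^N$: $F(M,p,s,x)-F(M,p,s',x)\ge\gamma_R(s-s')$. (H6) There exists $0<\beta<\alpha$ and, for all $0<\mu<1$ and $R,K>0$, there exist a function $m_{R,K}:\mathbb{R}^+\to\mathbb{R}$ with $m_{R,K}(t)\to0$ as $t\to0$ and a constant $C(\mu)$ (as the notation indicates, $m_{R,K}$ does not depend on $\mu$) such that, for all $\varepsilon>0$, $$F(Y,q,s,y)-\mu F(\mu^{-1}X,\mu^{-1}p,\mu^{-1}s,x)\le m_{R,K}\big((1-\mu)+C(\mu)\varepsilon\big)$$ for all $x,y\in\overline\Omega$, $|s|\le R$, $p,q\in\mathbb{R}^N$ and $X,Y\in\mathcal{S}^N$ satisfying $$-K\varepsilon^{-2+\alpha-2\beta}Id\le\begin{pmatrix}X&0\\0&-Y\end{pmatrix}\le K\varepsilon^{-2+\alpha-2\beta}\begin{pmatrix}Id&-Id\\-Id&Id\end{pmatrix}+K\varepsilon^{\alpha-2\beta}Id,$$ $$|p-q|\le K\varepsilon(1+|p|+|q|),\qquad|p|+|q|\le K\varepsilon^{\alpha-1-\beta},\qquad|x-y|\le K\varepsilon.$$ Generalized Dirichlet problem (viscosity sense): $u$ is a subsolution if, for every smooth $\phi$ and every local maximum point $x_0\in\overline\Omega$ of $u-\phi$ relative to $\overline\Omega$, $F(D^2\phi(x_0),D\phi(x_0),u(x_0),x_0)\le0$ if $x_0\in\Omega$, and $\min\big(F(D^2\phi(x_0),D\phi(x_0),u(x_0),x_0),u(x_0)-g(x_0)\big)\le0$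 if $x_0\in\partial\Omega$. $v$ is a supersolution if, for every smooth $\phi$ and every local minimum point $x_0\in\overline\Omega$ of $v-\phi$ relative to $\overline\Omega$, $F(D^2\phi(x_0),D\phi(x_0),v(x_0),x_0)\ge0$ if $x_0\in\Omega$, and $\max\big(F(D^2\phi(x_0),D\phi(x_0),v(x_0),x_0),v(x_0)-g(x_0)\big)\ge0$ if $x_0\in\partial\Omega$. *)

theory Defs
  imports "HOL-Analysis.Analysis"
begin

section \<open>Symmetric matrices and the Loewner order\<close>

definition sym_mats :: "(real^'n^'n) set" where
  "sym_mats = {A. transpose A = A}"

definition loewner_le :: "real^'n^'n \<Rightarrow> real^'n^'n \<Rightarrow> bool"  (infix \<open>\<preceq>\<close> 50) where
  "A \<preceq> B \<longleftrightarrow> (\<forall>\<xi>. \<xi> \<bullet> (A *v \<xi>) \<le> \<xi> \<bullet> (B *v \<xi>))"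

definition block_mat ::
  "real^'n^'n \<Rightarrow> real^'n^'n \<Rightarrow> real^'n^'n \<Rightarrow> real^'n^'n \<Rightarrow> real^('n + 'n)^('n + 'n)" where
  "block_mat A B C D = (\<chi> i j.
     case i of
       Inl k \<Rightarrow> (case j of Inl l \<Rightarrow> A $ k $ l | Inr l \<Rightarrow> B $ k $ l)
     | Inr k \<Rightarrow> (case j of Inl l \<Rightarrow> C $ k $ l | Inr l \<Rightarrow> D $ k $ l))"

section \<open>Differentiability classes, gradient and Hessian\<close>

text \<open>\<open>Ck k f\<close>: all iterated directional derivatives of order less than \<open>k\<close> are
  differentiable everywhere and those of order \<open>k\<close> are continuous.\<close>

primrec Ck :: "nat \<Rightarrow> ('a::euclidean_space \<Rightarrow> real) \<Rightarrow> bool" where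
  "Ck 0 f \<longleftrightarrow> continuous_on UNIV f"
| "Ck (Suc k) f \<longleftrightarrow>
     (\<forall>x. f differentiable (at x)) \<and> (\<forall>v. Ck k (\<lambda>x. frechet_derivative f (at x) v))"

definition smooth :: "('a::euclidean_space \<Rightarrow> real) \<Rightarrow> bool" where
  "smooth f \<longleftrightarrow> (\<forall>k. Ck k f)"

definition grad :: "(real^'n \<Rightarrow> real) \<Rightarrow> real^'n \<Rightarrow> real^'n" where
  "grad \<phi> x = (\<chi> i. frechet_derivative \<phi> (at x) (axis i 1))"

definition hessian :: "(real^'n \<Rightarrow> real) \<Rightarrow> real^'n \<Rightarrow> real^'n^'n" where
  "hessian \<phi> x = matrix (frechet_derivative (grad \<phi>) (at x))"

section \<open>Domains with boundary of class C3\<close>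

text \<open>Near each boundary point the set is, after a rotation of the coordinate axes, the strict
  epigraph of a C3 function of the remaining \<open>N - 1\<close> coordinates. Here \<open>e\<close> is the distinguished
  axis, and the remaining coordinates are represented by the orthogonal projection of \<open>x\<close>
  onto the hyperplane orthogonal to \<open>e\<close>; only the values of \<open>\<gamma>\<close> on that hyperplane matter.\<close>

definition C3_boundary :: "(real^'n) set \<Rightarrow> bool" where
  "C3_boundary \<Omega> \<longleftrightarrow>
     (\<forall>x0\<in>frontier \<Omega>. \<exists>r>0. \<exists>e. \<exists>\<gamma>. norm e = 1 \<and> Ck 3 \<gamma> \<and>
        \<Omega> \<inter> ball x0 r = {x \<in> ball x0 r. x \<bullet> e > \<gamma> (x - (x \<bullet> e) *\<^sub>R e)})"

section \<open>Semicontinuity relative to a set\<close>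

definition usc_on :: "'a::topological_space set \<Rightarrow> ('a \<Rightarrow> real) \<Rightarrow> bool" where
  "usc_on S u \<longleftrightarrow> (\<forall>x\<in>S. \<forall>a. u x < a \<longrightarrow> (\<forall>\<^sub>F y in at x within S. u y < a))"

definition lsc_on :: "'a::topological_space set \<Rightarrow> ('a \<Rightarrow> real) \<Rightarrow> bool" where
  "lsc_on S v \<longleftrightarrow> (\<forall>x\<in>S. \<forall>a. a < v x \<longrightarrow> (\<forall>\<^sub>F y in at x within S. a < v y))"

section \<open>Structure conditions on the nonlinearity\<close>

text \<open>The nonlinearity \<open>F M p s x\<close> is only meaningful for symmetric \<open>M\<close> and for \<open>x\<close> in the
  closure of the domain; every condition below is restricted accordingly.\<close>

type_synonym 'n nonlinearity = "real^'n^'n \<Rightarrow> real^'n \<Rightarrow> real \<Rightarrow> real^'n \<Rightarrow> real"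

definition continuous_nonlinearity :: "(real^'n) set \<Rightarrow> 'n nonlinearity \<Rightarrow> bool" where
  "continuous_nonlinearity \<Omega> F \<longleftrightarrow>
     continuous_on (sym_mats \<times> UNIV \<times> UNIV \<times> closure \<Omega>) (\<lambda>(M, p, s, x). F M p s x)"

definition elliptic :: "(real^'n) set \<Rightarrow> 'n nonlinearity \<Rightarrow> bool" where
  "elliptic \<Omega> F \<longleftrightarrow>
     (\<forall>X\<in>sym_mats. \<forall>Y\<in>sym_mats. \<forall>p s. \<forall>x\<in>closure \<Omega>. Y \<preceq> X \<longrightarrow> F X p s x \<le> F Y p s x)"

definition elliptic_op :: "(real^'n^'n \<Rightarrow> real) \<Rightarrow> bool" where
  "elliptic_op G \<longleftrightarrow> (\<forall>X\<in>sym_mats. \<forall>Y\<in>sym_mats. Y \<preceq> X \<longrightarrow> G X \<le> G Y)"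

text \<open>Homogeneity is positive homogeneity, so that extremal (Pucci or Bellman type) operators
  are included.\<close>

definition homogeneous1 :: "(real^'n^'n \<Rightarrow> real) \<Rightarrow> bool" where
  "homogeneous1 G \<longleftrightarrow> (\<forall>t>0. \<forall>M\<in>sym_mats. G (t *\<^sub>R M) = t * G M)"

definition H4' :: "real \<Rightarrow> (real^'n) set \<Rightarrow> 'n nonlinearity \<Rightarrow> bool" where
  "H4' m \<Omega> F \<longleftrightarrow> m > 2 \<and>
     (\<forall>R>0. \<exists>K1>0. \<exists>K2>0. \<exists>G.
        (\<exists>L. L-lipschitz_on sym_mats G) \<and> elliptic_op G \<and> homogeneous1 G \<and>
        (\<forall>M\<in>sym_mats. \<forall>p s. \<forall>x\<in>closure \<Omega>. \<bar>s\<bar> \<le> R \<longrightarrow> F M p s x \<le> 0 \<longrightarrow>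
           G M + K1 * norm p powr m - K2 \<le> 0))"

definition H5 :: "(real^'n) set \<Rightarrow> 'n nonlinearity \<Rightarrow> bool" where
  "H5 \<Omega> F \<longleftrightarrow>
     (\<forall>R. \<exists>\<gamma>>0. \<forall>x\<in>closure \<Omega>. \<forall>s s' p. \<forall>M\<in>sym_mats.
        - R \<le> s' \<and> s' \<le> s \<and> s \<le> R \<longrightarrow> F M p s x - F M p s' x \<ge> \<gamma> * (s - s'))"

text \<open>The constant \<open>C \<mu>\<close> depends on \<open>\<mu>\<close> only and the modulus \<open>\<omega>\<close> on \<open>R\<close> and \<open>K\<close> only. The
  modulus is a function on the positive half-line, so its argument \<open>(1 - \<mu>) + C \<mu> * \<epsilon>\<close> has to
  be positive for every \<open>\<epsilon> > 0\<close>, which amounts to \<open>C \<mu> \<ge> 0\<close>.\<close>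

definition H6 :: "real \<Rightarrow> (real^'n) set \<Rightarrow> 'n nonlinearity \<Rightarrow> bool" where
  "H6 \<alpha> \<Omega> F \<longleftrightarrow>
     (\<exists>\<beta> C. 0 < \<beta> \<and> \<beta> < \<alpha> \<and> (\<forall>\<mu>. 0 < \<mu> \<and> \<mu> < 1 \<longrightarrow> 0 \<le> C \<mu>) \<and>
        (\<forall>R>0. \<forall>K>0. \<exists>\<omega> :: real \<Rightarrow> real. (\<omega> \<longlongrightarrow> 0) (at_right 0) \<and>
           (\<forall>\<mu>. 0 < \<mu> \<and> \<mu> < 1 \<longrightarrow>
             (\<forall>\<epsilon>>0. \<forall>x\<in>closure \<Omega>. \<forall>y\<in>closure \<Omega>. \<forall>s p q. \<forall>X\<in>sym_mats. \<forall>Y\<in>sym_mats.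
                \<bar>s\<bar> \<le> R \<and>
                (- (K * \<epsilon> powr (- 2 + \<alpha> - 2 * \<beta>))) *\<^sub>R mat 1 \<preceq> block_mat X 0 0 (- Y) \<and>
                block_mat X 0 0 (- Y) \<preceq>
                  (K * \<epsilon> powr (- 2 + \<alpha> - 2 * \<beta>)) *\<^sub>R
                     block_mat (mat 1) (- mat 1) (- mat 1) (mat 1)
                  + (K * \<epsilon> powr (\<alpha> - 2 * \<beta>)) *\<^sub>R mat 1 \<and>
                norm (p - q) \<le> K * \<epsilon> * (1 + norm p + norm q) \<and>
                norm p + norm q \<le> K * \<epsilon> powr (\<alpha> - 1 - \<beta>) \<and>
                norm (x - y) \<le> K * \<epsilon>
                \<longrightarrow>
                F Y q s y - \<mu> * F (inverse \<mu> *\<^sub>R X) (inverse \<mu> *\<^sub>R p) (inverse \<mu> * s) x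
                  \<le> \<omega> ((1 - \<mu>) + C \<mu> * \<epsilon>)))))"

section \<open>Viscosity solutions of the generalized Dirichlet problem\<close>

definition local_max_on :: "'a::metric_space set \<Rightarrow> ('a \<Rightarrow> real) \<Rightarrow> 'a \<Rightarrow> bool" where
  "local_max_on S f x0 \<longleftrightarrow> x0 \<in> S \<and> (\<exists>r>0. \<forall>x\<in>S \<inter> ball x0 r. f x \<le> f x0)"

definition local_min_on :: "'a::metric_space set \<Rightarrow> ('a \<Rightarrow> real) \<Rightarrow> 'a \<Rightarrow> bool" where
  "local_min_on S f x0 \<longleftrightarrow> x0 \<in> S \<and> (\<exists>r>0. \<forall>x\<in>S \<inter> ball x0 r. f x0 \<le> f x)"

definition dirichlet_subsolution ::
  "(real^'n) set \<Rightarrow> 'n nonlinearity \<Rightarrow> (real^'n \<Rightarrow> real) \<Rightarrow> (real^'n \<Rightarrow> real) \<Rightarrow> bool" where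
  "dirichlet_subsolution \<Omega> F g u \<longleftrightarrow>
     (\<forall>\<phi> x0. smooth \<phi> \<and> local_max_on (closure \<Omega>) (\<lambda>x. u x - \<phi> x) x0 \<longrightarrow>
        (x0 \<in> \<Omega> \<longrightarrow> F (hessian \<phi> x0) (grad \<phi> x0) (u x0) x0 \<le> 0) \<and>
        (x0 \<in> frontier \<Omega> \<longrightarrow>
           min (F (hessian \<phi> x0) (grad \<phi> x0) (u x0) x0) (u x0 - g x0) \<le> 0))"

definition dirichlet_supersolution ::
  "(real^'n) set \<Rightarrow> 'n nonlinearity \<Rightarrow> (real^'n \<Rightarrow> real) \<Rightarrow> (real^'n \<Rightarrow> real) \<Rightarrow> bool" where
  "dirichlet_supersolution \<Omega> F g v \<longleftrightarrow>
     (\<forall>\<phi> x0. smooth \<phi> \<and> local_min_on (closure \<Omega>) (\<lambda>x. v x - \<phi> x) x0 \<longrightarrow>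
        (x0 \<in> \<Omega> \<longrightarrow> F (hessian \<phi> x0) (grad \<phi> x0) (v x0) x0 \<ge> 0) \<and>
        (x0 \<in> frontier \<Omega> \<longrightarrow>
           max (F (hessian \<phi> x0) (grad \<phi> x0) (v x0) x0) (v x0 - g x0) \<ge> 0))"

end

theory Submission
  imports Defs "HOL-Complex_Analysis.Great_Picard"
begin

text \<open>Superquadratic growth makes the gradient term dominate the Hessian of a suitable radial barrier
  that blows up on a sphere. This gives a one-sided interior Hoelder estimate of exponent
  \<open>\<alpha> = (m - 2) / (m - 1)\<close> with a constant independent of the size of \<open>u\<close> and of the ball; chaining it along
  a vector field \<open>n\<close> that points into \<open>\<Omega>\<close>, and using the upper limit condition, \<open>u\<close> is \<open>\<alpha>\<close>-Hoelder on
  the closure. The same domination yields \<open>u \<le> g\<close> on the boundary.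

  If \<open>u - v\<close> is somewhere positive, maximise
  \<open>\<mu> u(x) - v(y) - \<epsilon>\<^sup>\<alpha>\<^sup>-\<^sup>2\<^sup>\<beta> |z|\<^sup>2\<close> with \<open>z = (x - y) / \<epsilon> - n(y)\<close>. Comparing with the pair
  \<open>(y + \<epsilon> n(y), y)\<close> and using Hoelder continuity gives \<open>|z| \<le> \<surd>L \<epsilon>\<^sup>\<beta>\<close>. Hence \<open>x\<close> lies in \<open>\<Omega>\<close>, and \<open>v(y) < g(y)\<close>
  if \<open>y\<close> is on the boundary, so that both equations hold; moreover the slopes have size
  \<open>\<epsilon>\<^sup>\<alpha>\<^sup>-\<^sup>1\<^sup>-\<^sup>\<beta>\<close>, as H6 requires, and H5 gives a contradiction as \<open>\<epsilon>\<close> and then \<open>1 - \<mu>\<close> tend to \<open>0\<close>.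

  The theorem on sums behind the doubling of variables is proved without Alexandrov's theorem. After a
  Lasry-Lions regularisation one only needs a point of a contact set of positive measure at which
  the Lipschitz gradient is, on some small scale, uniformly close to a linear map.\<close>

section \<open>Approximate differentiability of Lipschitz maps\<close>

text \<open>The factor \<mu> is dictated by H6: for superquadratic growth the difference of two
  gradient terms is not small when only the relative error of the slopes is small, but scaling by
  \<mu> leaves a surplus of gradient term that absorbs it. At a boundary point where
  \<open>u \<le> g\<close> the subsolution condition is void, so \<open>x\<close> must be kept
  inside \<Omega>; this is the purpose of the shift \<open>n\<close>. The weight of the penalty must
  be large against \<open>\<epsilon> powr \<alpha>\<close> to force \<open>z\<close> to zero, yet
  small enough for the slopes allowed by H6, and the exponent \<open>\<alpha> - 2 * \<beta>\<close>
  meets both demands.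

  For the theorem on sums the obstacle is that the linear map found belongs to one scale and to a
  base point that varies with the scale, so it gives no second-order expansion in the usual sense. A
  small multiple of the identity is therefore added: the expansion becomes strict on a sphere, and a
  quadratic with that matrix touches exactly at some point inside. The regularisation has to be
  \<open>C1,1\<close>, and not only semiconvex, so that its gradient is a Lipschitz map defined
  everywhere.\<close>

lemma lborel_translate:
  fixes h :: "'a::euclidean_space \<Rightarrow> real"
  assumes "integrable lborel h"
  shows "integrable lborel (\<lambda>x. h (x + c))" "(\<integral>x. h (x + c) \<partial>lborel) = (\<integral>x. h x \<partial>lborel)"
proof -
  have eq: "(\<lambda>x. x + c) = (+) c" by (simp add: fun_eq_iff add.commute)
  have D: "distr lborel borel (\<lambda>x. x + c) = lborel"
    unfolding eq by (rule lborel_distr_plus)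
  have hb: "h \<in> borel_measurable borel" using borel_measurable_integrable[OF assms] by simp
  show "integrable lborel (\<lambda>x. h (x + c))"
    using assms integrable_distr_eq[of "\<lambda>x. x + c" lborel borel h] hb D by simp
  show "(\<integral>x. h (x + c) \<partial>lborel) = (\<integral>x. h x \<partial>lborel)"
    using integral_distr[of "\<lambda>x. x + c" lborel borel h] hb D by simp
qed

lemma integrable_continuous_bounded_support:
  fixes h :: "'a::euclidean_space \<Rightarrow> real"
  assumes "continuous_on UNIV h" "\<And>x. norm x > R \<Longrightarrow> h x = 0"
  shows "integrable lborel h"
proof -
  have "integrable lborel (\<lambda>x. indicator (cball 0 R) x *\<^sub>R h x)"
    by (rule borel_integrable_compact) (auto intro: continuous_on_subset[OF assms(1)])
  moreover have "(\<lambda>x. indicator (cball 0 R) x *\<^sub>R h x) = h"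
    using assms(2) by (force simp: indicator_def fun_eq_iff)
  ultimately show ?thesis by simp
qed

lemma lipschitz_imp_continuous:
  fixes f :: "'a::real_normed_vector \<Rightarrow> 'b::real_normed_vector"
  assumes "\<And>x y. norm (f x - f y) \<le> L * norm (x - y)"
  shows "continuous_on S f"
proof -
  have "norm (f x - f y) \<le> \<bar>L\<bar> * norm (x - y)" for x y
    using assms[of x y] by (smt (verit) mult_right_mono norm_ge_zero)
  then have "\<bar>L\<bar>-lipschitz_on S f" by (auto simp: lipschitz_on_def dist_norm)
  then show ?thesis by (rule lipschitz_on_continuous_on)
qed

definition second_diff :: "('a::real_vector \<Rightarrow> 'b::real_vector) \<Rightarrow> real \<Rightarrow> 'a \<Rightarrow> 'a \<Rightarrow> 'b" where
  "second_diff f s e x = f (x + (2 * s) *\<^sub>R e) - 2 *\<^sub>R f (x + s *\<^sub>R e) + f x"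

text \<open>Passing from step \<open>2s\<close> to step \<open>s\<close> replaces a difference quotient by one of which it is an
  average, so by the parallelogram law the second differences measure the growth of the bounded
  dyadic energies.\<close>

lemma second_difference_tendsto_zero:
  fixes f :: "'a::euclidean_space \<Rightarrow> 'b::euclidean_space"
  assumes lip: "\<And>x y. norm (f x - f y) \<le> L * norm (x - y)"
    and supp: "\<And>x. norm x > R \<Longrightarrow> f x = 0"
  shows "\<And>s e. integrable lborel (\<lambda>x. (norm (second_diff f s e x))\<^sup>2)"
    and "(\<lambda>i. (\<integral>x. (norm (second_diff f ((1/2)^i) e x))\<^sup>2 \<partial>lborel) * 4 ^ i) \<longlonglongrightarrow> 0"
proof -
  let ?D = "second_diff f"
  note D_def = second_diff_def[of f]
  have L: "norm (f x - f y) \<le> \<bar>L\<bar> * norm (x - y)" for x y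
    using lip[of x y] by (smt (verit) mult_right_mono norm_ge_zero)
  have cont: "continuous_on UNIV (\<lambda>x. f (x + c))" for c
    by (rule lipschitz_imp_continuous[of _ L]) (use lip[of "_ + c" "_ + c"] in simp)
  have supp': "f (x + c) = 0" if "norm x > R + norm c" for x c
    using that norm_triangle_ineq2[of x "- c"] by (intro supp) simp
  define d where "d \<equiv> \<lambda>s e x. f (x + s *\<^sub>R e) - f x"
  have d_supp: "d s e x = 0" if "norm x > \<bar>R\<bar> + norm (s *\<^sub>R e)" for s e x
    using that supp'[of "s *\<^sub>R e" x] supp[of x] unfolding d_def by (smt (verit) norm_ge_zero diff_0_right)
  have d_int: "integrable lborel (\<lambda>x. (norm (d s e x))\<^sup>2)" for s e
    unfolding d_def using cont[of 0] cont
    by (intro integrable_continuous_bounded_support[of _ "\<bar>R\<bar> + norm (s *\<^sub>R e)"])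
      (auto intro!: continuous_intros simp: d_supp[unfolded d_def])
  have D_supp: "?D s e x = 0" if "norm x > \<bar>R\<bar> + 2 * norm (s *\<^sub>R e)" for s e x
  proof -
    have "f (x + (2 * s) *\<^sub>R e) = 0" by (rule supp') (use that in auto)
    moreover have "f (x + s *\<^sub>R e) = 0" by (rule supp') (use that norm_ge_zero[of "s *\<^sub>R e"] in linarith)
    moreover have "f x = 0" by (rule supp) (use that norm_ge_zero[of "s *\<^sub>R e"] in linarith)
    ultimately show ?thesis by (simp add: D_def)
  qed
  show D_int: "integrable lborel (\<lambda>x. (norm (?D s e x))\<^sup>2)" for s e
    using D_supp unfolding D_def using cont[of 0] cont
    by (intro integrable_continuous_bounded_support[of _ "\<bar>R\<bar> + 2 * norm (s *\<^sub>R e)"])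
      (auto intro!: continuous_intros)
  define A where "A s = (\<integral>x. (norm (d s e x))\<^sup>2 \<partial>lborel)" for s
  have A_rec: "A (2 * s) = 4 * A s - (\<integral>x. (norm (?D s e x))\<^sup>2 \<partial>lborel)" for s
  proof -
    have "(norm (d (2 * s) e x))\<^sup>2 =
        2 * (norm (d s e (x + s *\<^sub>R e)))\<^sup>2 + 2 * (norm (d s e x))\<^sup>2 - (norm (?D s e x))\<^sup>2" for x
    proof -
      have 1: "d (2 * s) e x = d s e (x + s *\<^sub>R e) + d s e x"
        by (simp add: d_def add.assoc flip: scaleR_left_distrib)
      have 2: "?D s e x = d s e (x + s *\<^sub>R e) - d s e x"
        by (simp add: d_def D_def add.assoc scaleR_2 flip: scaleR_left_distrib)
      show ?thesis unfolding 1 2 power2_norm_eq_inner by (simp add: inner_simps inner_commute)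
    qed
    then have "A (2 * s) = (\<integral>x. (2 * (norm (d s e (x + s *\<^sub>R e)))\<^sup>2 + 2 * (norm (d s e x))\<^sup>2 - (norm (?D s e x))\<^sup>2) \<partial>lborel)"
      by (simp add: A_def)
    also have "\<dots> = 4 * A s - (\<integral>x. (norm (?D s e x))\<^sup>2 \<partial>lborel)"
      using lborel_translate[OF d_int[of s e], of "s *\<^sub>R e"] d_int[of s e] D_int[of s e]
      by (simp add: A_def)
    finally show ?thesis .
  qed
  \<comment> \<open>\<open>E i\<close> is the squared \<open>L2\<close> norm of the difference
    quotient with step \<open>(1/2)^i\<close>. Its increments are, up to a constant factor, the
    scaled integrals of the second differences, so an upper bound for \<open>E\<close> forces these
    to vanish in the limit.\<close>
  define E where "E i = A ((1/2)^i) * 4 ^ i" for i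
  have E_diff: "(\<integral>x. (norm (?D ((1/2)^Suc i) e x))\<^sup>2 \<partial>lborel) * 4 ^ Suc i = 4 * (E (Suc i) - E i)" for i
    proof -
    have "A ((1/2)^i) = 4 * A ((1/2)^Suc i) - (\<integral>x. (norm (?D ((1/2)^Suc i) e x))\<^sup>2 \<partial>lborel)"
      using A_rec[of "(1/2)^Suc i"] by simp
    then show ?thesis unfolding E_def by (simp add: left_diff_distrib)
  qed
  have inc: "E i \<le> E (Suc i)" for i
  proof -
    have "0 \<le> (\<integral>x. (norm (?D ((1/2)^Suc i) e x))\<^sup>2 \<partial>lborel) * 4 ^ Suc i"
      by (intro mult_nonneg_nonneg integral_nonneg) auto
    then have "0 \<le> 4 * (E (Suc i) - E i)" unfolding E_diff .
    then have "0 \<le> E (Suc i) - E i" by (simp only: zero_le_mult_iff) auto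
    then show ?thesis by (simp only: diff_ge_0_iff_ge)
  qed
  \<comment> \<open>The difference quotient is at most \<open>\<bar>L\<bar> * norm e\<close> and,
    for steps at most 1, vanishes outside this ball; hence a bound independent of
    \<open>i\<close>.\<close>
  define B where "B = (L * norm e)\<^sup>2 * measure lborel (cball (0::'a) (\<bar>R\<bar> + norm e))"
  have bound: "E i \<le> B" for i
  proof -
    let ?s = "(1/2::real)^i" and ?C = "cball (0::'a) (\<bar>R\<bar> + norm e)"
    have s: "0 < ?s" "?s \<le> 1" by (auto simp: power_le_one)
    have le: "(norm (d ?s e x))\<^sup>2 \<le> (L * norm e * ?s)\<^sup>2 * indicator ?C x" for x
    proof (cases "x \<in> ?C")
      case True
      have "norm (d ?s e x) \<le> \<bar>L\<bar> * norm e * ?s" using L[of "x + ?s *\<^sub>R e" x] by (simp add: d_def ac_simps)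
      then have "(norm (d ?s e x))\<^sup>2 \<le> (\<bar>L\<bar> * norm e * ?s)\<^sup>2" by (rule power_mono) simp
      then show ?thesis using True by (simp add: power_mult_distrib)
    next
      case False
      have "norm (?s *\<^sub>R e) \<le> norm e" using s mult_right_mono[of ?s 1 "norm e"] by simp
      then have "d ?s e x = 0" using False by (intro d_supp) simp
      then show ?thesis using False by simp
    qed
    have "A ?s \<le> (\<integral>x. (L * norm e * ?s)\<^sup>2 * indicator ?C x \<partial>lborel)"
      unfolding A_def
      by (intro integral_mono d_int le integrable_mult_right integrable_real_indicator)
        (auto intro: emeasure_lborel_cball_finite[simplified])
    also have "\<dots> = (L * norm e * ?s)\<^sup>2 * measure lborel ?C" by simp
    finally have "E i \<le> (L * norm e * ?s)\<^sup>2 * measure lborel ?C * 4 ^ i" by (simp add: E_def)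
    also have "\<dots> = B * (?s\<^sup>2 * 4^i)" by (simp add: B_def power_mult_distrib algebra_simps)
    also have "?s\<^sup>2 * 4^i = 1"
    proof -
      have "?s\<^sup>2 = (1/4)^i" by (simp add: power2_eq_square flip: power_mult_distrib)
      then show ?thesis by (simp flip: power_mult_distrib)
    qed
    finally show ?thesis by simp
  qed
  obtain l where l: "E \<longlonglongrightarrow> l"
    using incseq_convergent[OF incseq_SucI[of E, OF inc], of B] bound by blast
  have "(\<lambda>i. 4 * (E (Suc i) - E i)) \<longlonglongrightarrow> 4 * (l - l)"
    by (intro tendsto_intros l LIMSEQ_Suc[OF l])
  then have "(\<lambda>i. (\<integral>x. (norm (?D ((1/2)^Suc i) e x))\<^sup>2 \<partial>lborel) * 4 ^ Suc i) \<longlonglongrightarrow> 0"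
    using E_diff by simp
  then show "(\<lambda>i. (\<integral>x. (norm (?D ((1/2)^i) e x))\<^sup>2 \<partial>lborel) * 4 ^ i) \<longlonglongrightarrow> 0"
    by (rule LIMSEQ_imp_Suc)
qed

text \<open>Chebyshev's inequality: the scaled integrals of finitely many second differences tend to
  zero, so at a fine scale they cannot leave an excess at every point of a set of positive measure.
  One point and one scale serve all pairs in \<open>J\<close>, but the point depends on the
  scale.\<close>

lemma exists_small_second_differences:
  fixes f :: "'a::euclidean_space \<Rightarrow> 'b::euclidean_space"
  assumes lip: "\<And>x y. norm (f x - f y) \<le> L * norm (x - y)"
    and supp: "\<And>x. norm x > R \<Longrightarrow> f x = 0"
    and S: "compact S" "\<not> negligible S"
    and J: "finite J" and "\<epsilon> > 0"
  shows "\<exists>i\<ge>n. \<exists>z\<in>S. \<forall>(\<zeta>,e)\<in>J.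
    norm (f (z + (1/2)^i *\<^sub>R (\<zeta> + 2 *\<^sub>R e)) - 2 *\<^sub>R f (z + (1/2)^i *\<^sub>R (\<zeta> + e)) + f (z + (1/2)^i *\<^sub>R \<zeta>)) \<le> \<epsilon> * (1/2)^i"
proof -
  let ?D = "second_diff f"
  note D_def = second_diff_def[of f]
  note D0 = second_difference_tendsto_zero[OF lip supp]
  have int0: "integrable lborel (\<lambda>x. (norm (?D s e x))\<^sup>2)" for s e by (rule D0(1))
  define T where "T i = (\<Sum>(\<zeta>,e)\<in>J. \<integral>x. (norm (?D ((1/2)^i) e (x + (1/2)^i *\<^sub>R \<zeta>)))\<^sup>2 \<partial>lborel)" for i
  \<comment> \<open>Translation invariance of the integral removes the base point \<zeta>; only the
    direction matters.\<close>
  have T_eq: "T i * 4^i = (\<Sum>j\<in>J. (\<integral>x. (norm (?D ((1/2)^i) (snd j) x))\<^sup>2 \<partial>lborel) * 4^i)" for i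
    unfolding T_def sum_distrib_right
  proof (intro sum.cong refl)
    fix j
    show "(case j of (\<zeta>, e) \<Rightarrow> \<integral>x. (norm (?D ((1/2)^i) e (x + (1/2)^i *\<^sub>R \<zeta>)))\<^sup>2 \<partial>lborel) * 4^i =
        (\<integral>x. (norm (?D ((1/2)^i) (snd j) x))\<^sup>2 \<partial>lborel) * 4^i"
      using lborel_translate(2)[OF int0[of "(1/2)^i" "snd j"], of "(1/2)^i *\<^sub>R fst j"]
      by (simp add: case_prod_unfold)
  qed
  have "(\<lambda>i. T i * 4^i) \<longlonglongrightarrow> (\<Sum>j\<in>J. 0)"
    unfolding T_eq by (intro tendsto_sum D0(2))
  then have lim: "(\<lambda>i. T i * 4^i) \<longlonglongrightarrow> 0" by simp
  define \<nu> where "\<nu> = measure lborel S"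
  have Sf: "emeasure lborel S < \<infinity>" using S(1) by (rule emeasure_compact_finite)
  have Sm: "S \<in> sets lborel" using S(1) by (simp add: borel_compact)
  have "\<nu> \<noteq> 0"
  proof
    assume "\<nu> = 0"
    then have "emeasure lborel S = 0" using Sf unfolding \<nu>_def
      by (simp add: emeasure_eq_ennreal_measure)
    then have "negligible S" using Sm by (simp add: negligible_iff_null_sets null_sets_def)
    then show False using S(2) by simp
  qed
  then have \<nu>: "\<nu> > 0" unfolding \<nu>_def by (simp add: zero_less_measure_iff)
  then have "\<forall>\<^sub>F i in sequentially. T i * 4^i < \<epsilon>\<^sup>2 * \<nu>"
    using order_tendstoD(2)[OF lim, of "\<epsilon>\<^sup>2 * \<nu>"] \<open>\<epsilon> > 0\<close> by simp
  then obtain N where N: "\<And>i. i \<ge> N \<Longrightarrow> T i * 4^i < \<epsilon>\<^sup>2 * \<nu>"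
    unfolding eventually_sequentially by blast
  define i where "i = max n N"
  have i: "i \<ge> n" "T i * 4^i < \<epsilon>\<^sup>2 * \<nu>" using N[of i] by (auto simp: i_def)
  let ?s = "(1/2::real)^i"
  have s2: "?s\<^sup>2 * 4^i = 1"
  proof -
    have "?s\<^sup>2 = (1/4)^i" by (simp add: power2_eq_square flip: power_mult_distrib)
    then show ?thesis by (simp flip: power_mult_distrib)
  qed
  have "\<exists>z\<in>S. \<forall>j\<in>J. norm (?D ?s (snd j) (z + ?s *\<^sub>R fst j)) \<le> \<epsilon> * ?s"
  proof (rule ccontr)
    assume neg: "\<not> ?thesis"
    have le: "(\<epsilon> * ?s)\<^sup>2 * indicator S x \<le> (\<Sum>j\<in>J. (norm (?D ?s (snd j) (x + ?s *\<^sub>R fst j)))\<^sup>2)" for x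
    proof (cases "x \<in> S")
      case True
      then obtain j where j: "j \<in> J" "norm (?D ?s (snd j) (x + ?s *\<^sub>R fst j)) > \<epsilon> * ?s"
        using neg by force
      then have "(\<epsilon> * ?s)\<^sup>2 \<le> (norm (?D ?s (snd j) (x + ?s *\<^sub>R fst j)))\<^sup>2"
        using \<open>\<epsilon> > 0\<close> by (intro power_mono) auto
      also have "\<dots> \<le> (\<Sum>j\<in>J. (norm (?D ?s (snd j) (x + ?s *\<^sub>R fst j)))\<^sup>2)"
        using J j(1) by (intro member_le_sum) auto
      finally show ?thesis using True by simp
    qed (simp add: sum_nonneg)
    have int: "integrable lborel (\<lambda>x. (norm (?D ?s (snd j) (x + ?s *\<^sub>R fst j)))\<^sup>2)" for j
      by (rule lborel_translate(1)[OF D0(1)])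
    have "(\<epsilon> * ?s)\<^sup>2 * \<nu> = (\<integral>x. (\<epsilon> * ?s)\<^sup>2 * indicator S x \<partial>lborel)"
      by (simp add: \<nu>_def)
    also have "\<dots> \<le> (\<integral>x. (\<Sum>j\<in>J. (norm (?D ?s (snd j) (x + ?s *\<^sub>R fst j)))\<^sup>2) \<partial>lborel)"
      using Sm Sf by (intro integral_mono le Bochner_Integration.integrable_sum int integrable_mult_right integrable_real_indicator) auto
    also have "\<dots> = T i"
      unfolding T_def by (subst Bochner_Integration.integral_sum) (auto simp: int intro!: sum.cong)
    finally have "(\<epsilon> * ?s)\<^sup>2 * \<nu> * 4^i \<le> T i * 4^i" by (intro mult_right_mono) auto
    moreover have "(\<epsilon> * ?s)\<^sup>2 * \<nu> * 4^i = \<epsilon>\<^sup>2 * \<nu> * (?s\<^sup>2 * 4^i)" by (simp add: power_mult_distrib)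
    ultimately show False using i(2) unfolding s2 by simp
  qed
  then show ?thesis
    using i(1) unfolding D_def
    by (force intro!: exI[of _ i] simp: algebra_simps scaleR_add_right)
qed

text \<open>Jensen's functional equation. The second difference at base \<open>2 *\<^sub>R x\<close>
  with step \<open>y - x\<close> yields additivity, additivity yields homogeneity over the
  rationals, and continuity extends it to the reals.\<close>

lemma midpoint_affine_imp_linear:
  fixes f :: "'a::real_normed_vector \<Rightarrow> 'b::real_normed_vector"
  assumes "continuous_on UNIV f" "f 0 = 0" and mid: "\<And>x e. f (x + 2 *\<^sub>R e) - 2 *\<^sub>R f (x + e) + f x = 0"
  shows "linear f"
proof -
  have dbl: "f (2 *\<^sub>R e) = 2 *\<^sub>R f e" for e using mid[of 0 e] assms(2) by simp
  have add: "f (x + y) = f x + f y" for x y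
  proof -
    have "f (2 *\<^sub>R x + 2 *\<^sub>R (y - x)) - 2 *\<^sub>R f (2 *\<^sub>R x + (y - x)) + f (2 *\<^sub>R x) = 0" by (rule mid)
    moreover have "2 *\<^sub>R x + 2 *\<^sub>R (y - x) = 2 *\<^sub>R y" "2 *\<^sub>R x + (y - x) = x + y"
      by (simp_all add: algebra_simps scaleR_2)
    ultimately have "2 *\<^sub>R f (x + y) = 2 *\<^sub>R (f x + f y)" by (simp add: dbl algebra_simps)
    then show ?thesis by simp
  qed
  have nat: "f (real n *\<^sub>R x) = real n *\<^sub>R f x" for n x
    by (induction n) (auto simp: assms(2) add algebra_simps)
  have neg: "f (- x) = - f x" for x using add[of x "- x"] assms(2) by (simp add: eq_neg_iff_add_eq_0 add.commute)
  have int: "f (of_int n *\<^sub>R x) = of_int n *\<^sub>R f x" for n x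
    by (cases n) (auto simp: nat neg simp del: of_nat_Suc)
  have rat: "f (t *\<^sub>R x) = t *\<^sub>R f x" if t: "t \<in> \<rat>" for t x
  proof -
    obtain p q where pq: "q > 0" "t = of_int p / of_int q" using t by (elim Rats_cases') blast
    have "of_int q *\<^sub>R f (t *\<^sub>R x) = f (of_int q *\<^sub>R (t *\<^sub>R x))" by (rule int[symmetric])
    also have "of_int q *\<^sub>R (t *\<^sub>R x) = of_int p *\<^sub>R x"
    proof -
      have "of_int q * t = of_int p" using pq(1) unfolding pq(2) by simp
      then show ?thesis by simp
    qed
    also have "f (of_int p *\<^sub>R x) = of_int p *\<^sub>R f x" by (rule int)
    also have "\<dots> = of_int q *\<^sub>R (t *\<^sub>R f x)"
    proof -
      have "of_int q * t = of_int p" using pq(1) unfolding pq(2) by simp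
      then show ?thesis by simp
    qed
    finally have "of_int q *\<^sub>R f (t *\<^sub>R x) = of_int q *\<^sub>R (t *\<^sub>R f x)" .
    moreover have "of_int q \<noteq> (0::real)" using pq(1) by simp
    ultimately show ?thesis by (simp only: scaleR_cancel_left) simp
  qed
  have "f (t *\<^sub>R x) = t *\<^sub>R f x" for t x
  proof -
    have "closed {t. f (t *\<^sub>R x) = t *\<^sub>R f x}"
      by (intro closed_Collect_eq continuous_intros continuous_on_compose2[OF assms(1)]) auto
    moreover have "\<rat> \<subseteq> {t. f (t *\<^sub>R x) = t *\<^sub>R f x}" using rat by auto
    ultimately have "closure \<rat> \<subseteq> {t. f (t *\<^sub>R x) = t *\<^sub>R f x}" by (intro closure_minimal)
    moreover have "t \<in> closure \<rat>" by (simp add: Rats_closure_real)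
    ultimately show ?thesis by auto
  qed
  then show ?thesis using add by (intro linearI) auto
qed

lemma pointwise_imp_uniform_lipschitz:
  fixes g :: "nat \<Rightarrow> 'a::euclidean_space \<Rightarrow> 'b::real_normed_vector"
  assumes lip: "\<And>k x y. norm (g k x - g k y) \<le> L * norm (x - y)"
    and lim: "\<And>x. (\<lambda>k. g k x) \<longlonglongrightarrow> l x"
    and "compact K" "\<eta> > 0"
  shows "\<forall>\<^sub>F k in sequentially. \<forall>x\<in>K. norm (g k x - l x) \<le> \<eta>"
proof -
  have lip_l: "norm (l x - l y) \<le> L * norm (x - y)" for x y
    by (rule tendsto_upperbound[OF tendsto_norm[OF tendsto_diff[OF lim lim]]]) (auto simp: lip)
  define \<delta> where "\<delta> = \<eta> / 3 / (\<bar>L\<bar> + 1)"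
  have \<delta>: "\<delta> > 0" using \<open>\<eta> > 0\<close> by (simp add: \<delta>_def)
  have L\<delta>: "(\<bar>L\<bar> + 1) * \<delta> = \<eta> / 3"
  proof -
    have "\<bar>L\<bar> + 1 \<noteq> 0" by linarith
    then show ?thesis by (metis \<delta>_def nonzero_mult_div_cancel_left times_divide_eq_right)
  qed
  obtain C where C: "finite C" "K \<subseteq> (\<Union>x\<in>C. ball x \<delta>)"
    using compact_eq_totally_bounded[of K] \<open>compact K\<close> \<delta> by meson
  have "\<forall>\<^sub>F k in sequentially. \<forall>c\<in>C. norm (g k c - l c) < \<eta> / 3"
    unfolding eventually_ball_finite_distrib[OF C(1)]
    using tendstoD[OF lim, of "\<eta> / 3"] \<open>\<eta> > 0\<close> by (auto simp: dist_norm)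
  then show ?thesis
  proof eventually_elim
    case (elim k)
    show ?case
    proof
      fix x assume "x \<in> K"
      then obtain c where c: "c \<in> C" "norm (x - c) < \<delta>"
        using C(2) by (force simp: dist_norm norm_minus_commute)
      have 0: "\<bar>L\<bar> * norm (x - c) \<le> \<eta> / 3"
      proof -
        have "\<bar>L\<bar> * norm (x - c) \<le> (\<bar>L\<bar> + 1) * \<delta>" using c(2) by (intro mult_mono) auto
        then show ?thesis by (simp only: L\<delta>)
      qed
      have 1: "norm (g k x - g k c) \<le> \<eta> / 3"
        using lip[of k x c] 0 mult_right_mono[OF abs_ge_self norm_ge_zero, of L "(x - c)"] by simp
      have 2: "norm (l c - l x) \<le> \<eta> / 3"
        using lip_l[of c x] 0 mult_right_mono[OF abs_ge_self norm_ge_zero, of L "(x - c)"] by (simp add: norm_minus_commute)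
      have "norm (g k x - l x) \<le> norm (g k x - g k c) + norm (g k c - l c) + norm (l c - l x)"
        by (smt (verit, ccfv_threshold) add_diff_cancel diff_add_cancel diff_diff_eq2 norm_triangle_ineq)
      then show "norm (g k x - l x) \<le> \<eta>" using 1 2 elim c(1) by force
    qed
  qed
qed

text \<open>A blow-up argument in the place of Rademacher's theorem. The rescaled maps share a
  Lipschitz constant, and their second differences vanish in the limit on a countable dense set of
  pairs; the limit of a subsequence is therefore midpoint affine, hence linear. The base points
  \<open>z k\<close> need not converge to a point of differentiability.\<close>

lemma approx_differentiable_compact_support:
  fixes f :: "'a::euclidean_space \<Rightarrow> 'b::euclidean_space"
  assumes lip: "\<And>x y. norm (f x - f y) \<le> L * norm (x - y)"
    and supp: "\<And>x. norm x > R \<Longrightarrow> f x = 0"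
    and S: "compact S" "\<not> negligible S"
  obtains z r \<Lambda> where "\<And>k. z k \<in> S" "\<And>k. r k > 0" "r \<longlonglongrightarrow> 0" "linear \<Lambda>"
    "\<And>\<eta>. \<eta> > 0 \<Longrightarrow> \<forall>\<^sub>F k in sequentially. \<forall>h\<in>cball 0 1.
      norm (f (z k + r k *\<^sub>R h) - f (z k) - r k *\<^sub>R \<Lambda> h) \<le> \<eta> * r k"
proof -
  obtain D :: "'a set" where D: "countable D" "\<And>X. open X \<Longrightarrow> X \<noteq> {} \<Longrightarrow> \<exists>d\<in>D. d \<in> X"
    using countable_dense_setE by blast
  have cD: "countable (D \<times> D)" "D \<times> D \<noteq> {}" using D(1) D(2)[of UNIV] by auto
  \<comment> \<open>Stage \<open>k\<close> treats the first \<open>k + 1\<close> pairs of this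
    enumeration with tolerance \<open>1 / (k + 1)\<close>, so that every fixed pair is treated from
    some stage on.\<close>
  define j where "j = from_nat_into (D \<times> D)"
  have "\<forall>k. \<exists>i z. i \<ge> k \<and> z \<in> S \<and> (\<forall>(\<zeta>,e)\<in>j ` {..k}. norm (f (z + (1/2)^i *\<^sub>R (\<zeta> + 2 *\<^sub>R e))
      - 2 *\<^sub>R f (z + (1/2)^i *\<^sub>R (\<zeta> + e)) + f (z + (1/2)^i *\<^sub>R \<zeta>)) \<le> inverse (real (Suc k)) * (1/2)^i)"
  proof
    fix k
    show "\<exists>i z. i \<ge> k \<and> z \<in> S \<and> (\<forall>(\<zeta>,e)\<in>j ` {..k}. norm (f (z + (1/2)^i *\<^sub>R (\<zeta> + 2 *\<^sub>R e))
      - 2 *\<^sub>R f (z + (1/2)^i *\<^sub>R (\<zeta> + e)) + f (z + (1/2)^i *\<^sub>R \<zeta>)) \<le> inverse (real (Suc k)) * (1/2)^i)"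
      using exists_small_second_differences[OF lip supp S, where R=R and J="j ` {..k}" and \<epsilon>="inverse (real (Suc k))" and n=k]
      by auto
  qed
  then obtain i z where iz: "\<And>k. i k \<ge> k" "\<And>k. z k \<in> S" and
    small: "\<And>k \<zeta> e. (\<zeta>,e)\<in>j ` {..k} \<Longrightarrow> norm (f (z k + (1/2)^i k *\<^sub>R (\<zeta> + 2 *\<^sub>R e))
      - 2 *\<^sub>R f (z k + (1/2)^i k *\<^sub>R (\<zeta> + e)) + f (z k + (1/2)^i k *\<^sub>R \<zeta>)) \<le> inverse (real (Suc k)) * (1/2)^i k"
    by (metis (mono_tags, lifting) case_prodD)
  define r where "r k = (1/2::real)^i k" for k
  have r: "r k > 0" for k by (simp add: r_def)
  have r0: "r \<longlonglongrightarrow> 0"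
  proof (rule tendsto_sandwich[of "\<lambda>_. 0" _ _ "\<lambda>k. (1/2::real)^k"])
    show "\<forall>\<^sub>F k in sequentially. r k \<le> (1/2)^k"
      using iz(1) by (auto simp: r_def intro!: always_eventually power_decreasing)
  qed (auto simp: r_def intro!: always_eventually LIMSEQ_power_zero)
  define g where "g k \<xi> = (f (z k + r k *\<^sub>R \<xi>) - f (z k)) /\<^sub>R r k" for k \<xi>
  have g_lip: "norm (g k x - g k y) \<le> L * norm (x - y)" for k x y
  proof -
    have "norm (f (z k + r k *\<^sub>R x) - f (z k + r k *\<^sub>R y)) \<le> L * (r k * norm (x - y))"
      using lip[of "z k + r k *\<^sub>R x" "z k + r k *\<^sub>R y"] r[of k]
      by (simp flip: scaleR_diff_right)
    moreover have "g k x - g k y = (f (z k + r k *\<^sub>R x) - f (z k + r k *\<^sub>R y)) /\<^sub>R r k"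
      by (simp add: g_def algebra_simps)
    ultimately show ?thesis using r[of k] by (simp add: divide_simps mult.commute mult.left_commute)
  qed
  have g0: "g k 0 = 0" for k by (simp add: g_def)
  have g_bd: "norm (g k x /\<^sub>R (1 + norm x)) \<le> \<bar>L\<bar>" for k x
  proof -
    have "norm (g k x) \<le> \<bar>L\<bar> * (1 + norm x)"
      using g_lip[of k x 0] mult_right_mono[OF abs_ge_self norm_ge_zero, of L "x"] by (simp add: g0 algebra_simps)
    moreover have "1 + norm x > 0" by (simp add: add_pos_nonneg)
    ultimately show ?thesis by (simp add: pos_divide_le_eq divide_inverse_commute[symmetric])
  qed
  \<comment> \<open>The values \<open>g k x\<close> are bounded only in terms of
    \<open>norm x\<close>. The division makes the bound uniform in \<open>x\<close> too, as the
    diagonal extraction requires.\<close>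
  obtain \<sigma> where \<sigma>: "strict_mono (\<sigma>::nat\<Rightarrow>nat)" "\<And>x. x \<in> D \<Longrightarrow> \<exists>l. (\<lambda>n. g (\<sigma> n) x /\<^sub>R (1 + norm x)) \<longlonglongrightarrow> l"
    using function_convergent_subsequence[OF D(1), of "\<lambda>k x. g k x /\<^sub>R (1 + norm x)" "\<bar>L\<bar>"] g_bd by blast
  have convD: "convergent (\<lambda>n. g (\<sigma> n) x)" if x: "x \<in> D" for x
  proof -
    obtain l where "(\<lambda>n. g (\<sigma> n) x /\<^sub>R (1 + norm x)) \<longlonglongrightarrow> l" using \<sigma>(2)[OF x] by blast
    then have "(\<lambda>n. (1 + norm x) *\<^sub>R (g (\<sigma> n) x /\<^sub>R (1 + norm x))) \<longlonglongrightarrow> (1 + norm x) *\<^sub>R l"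
      by (intro tendsto_intros)
    moreover have "1 + norm x \<noteq> 0" using norm_ge_zero[of x] by linarith
    ultimately show ?thesis by (auto simp: convergent_def)
  qed
  have "convergent (\<lambda>n. g (\<sigma> n) x)" for x
  proof (rule Cauchy_convergent, rule metric_CauchyI)
    fix \<eta> :: real assume "\<eta> > 0"
    define \<delta> where "\<delta> = \<eta> / 3 / (\<bar>L\<bar> + 1)"
    have "\<delta> > 0" using \<open>\<eta> > 0\<close> by (simp add: \<delta>_def)
    then obtain d where d: "d \<in> D" "norm (x - d) < \<delta>" using D(2)[of "ball x \<delta>"] by (auto simp: dist_norm)
    have L\<delta>: "(\<bar>L\<bar> + 1) * \<delta> = \<eta> / 3"
    proof -
      have "\<bar>L\<bar> + 1 \<noteq> 0" by linarith
      then show ?thesis by (metis \<delta>_def nonzero_mult_div_cancel_left times_divide_eq_right)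
    qed
    have 0: "norm (g k x - g k d) \<le> \<eta> / 3" for k
    proof -
      have "norm (g k x - g k d) \<le> \<bar>L\<bar> * norm (x - d)"
        using g_lip[of k x d] mult_right_mono[OF abs_ge_self norm_ge_zero, of L "(x - d)"] by simp
      also have "\<dots> \<le> (\<bar>L\<bar> + 1) * \<delta>" using d(2) by (intro mult_mono) auto
      finally show ?thesis by (simp only: L\<delta>)
    qed
    obtain N where N: "\<And>m n. m \<ge> N \<Longrightarrow> n \<ge> N \<Longrightarrow> dist (g (\<sigma> m) d) (g (\<sigma> n) d) < \<eta> / 3"
      using metric_CauchyD[OF convergent_Cauchy[OF convD[OF d(1)]], of "\<eta> / 3"] \<open>\<eta> > 0\<close> by auto
    show "\<exists>M. \<forall>m\<ge>M. \<forall>n\<ge>M. dist (g (\<sigma> m) x) (g (\<sigma> n) x) < \<eta>"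
    proof (intro exI allI impI)
      fix m n assume mn: "m \<ge> N" "n \<ge> N"
      have "dist (g (\<sigma> m) x) (g (\<sigma> n) x) \<le> dist (g (\<sigma> m) x) (g (\<sigma> m) d) + dist (g (\<sigma> m) d) (g (\<sigma> n) d) + dist (g (\<sigma> n) x) (g (\<sigma> n) d)"
        by metric
      then show "dist (g (\<sigma> m) x) (g (\<sigma> n) x) < \<eta>"
        using N[OF mn] 0[of "\<sigma> m"] 0[of "\<sigma> n"] by (simp add: dist_norm)
    qed
  qed
  then obtain \<Lambda> where \<Lambda>: "\<And>x. (\<lambda>n. g (\<sigma> n) x) \<longlonglongrightarrow> \<Lambda> x"
    unfolding convergent_def by metis
  have \<Lambda>_lip: "norm (\<Lambda> x - \<Lambda> y) \<le> L * norm (x - y)" for x y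
    by (rule tendsto_upperbound[OF tendsto_norm[OF tendsto_diff[OF \<Lambda> \<Lambda>]]]) (auto simp: g_lip)
  have \<Lambda>_cont: "continuous_on A \<Lambda>" for A by (rule lipschitz_imp_continuous[OF \<Lambda>_lip])
  have midD: "\<Lambda> (\<zeta> + 2 *\<^sub>R e) - 2 *\<^sub>R \<Lambda> (\<zeta> + e) + \<Lambda> \<zeta> = 0" if "\<zeta> \<in> D" "e \<in> D" for \<zeta> e
  proof -
    obtain n0 where n0: "(\<zeta>, e) = j n0"
      using from_nat_into_surj[OF cD(1), of "(\<zeta>,e)"] \<open>\<zeta> \<in> D\<close> \<open>e \<in> D\<close> unfolding j_def by (metis SigmaI)
    define G where "G k = g k (\<zeta> + 2 *\<^sub>R e) - 2 *\<^sub>R g k (\<zeta> + e) + g k \<zeta>" for k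
    have G: "norm (G k) \<le> inverse (real (Suc k))" if "k \<ge> n0" for k
    proof -
      have "(\<zeta>, e) \<in> j ` {..k}" using n0 that by auto
      note sm = small[OF this]
      define X where "X = f (z k + r k *\<^sub>R (\<zeta> + 2 *\<^sub>R e)) - 2 *\<^sub>R f (z k + r k *\<^sub>R (\<zeta> + e)) + f (z k + r k *\<^sub>R \<zeta>)"
      have "G k = X /\<^sub>R r k"
        unfolding G_def g_def X_def scaleR_2 by (simp add: scaleR_add_right scaleR_diff_right)
      then have "norm (G k) = inverse (r k) * norm X" using r[of k] by simp
      also have "\<dots> \<le> inverse (r k) * (inverse (real (Suc k)) * r k)"
        using sm r[of k] unfolding X_def r_def by (intro mult_left_mono) auto
      also have "\<dots> = inverse (real (Suc k))" using r[of k] by simp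
      finally show ?thesis .
    qed
    have "(\<lambda>n. G (\<sigma> n)) \<longlonglongrightarrow> 0"
    proof (rule tendsto_norm_zero_cancel, rule tendsto_sandwich[of "\<lambda>_. 0"])
      show "\<forall>\<^sub>F n in sequentially. norm (G (\<sigma> n)) \<le> inverse (real (Suc n))"
      proof (rule eventually_sequentiallyI[of n0])
        fix n assume "n \<ge> n0"
        moreover have "\<sigma> n \<ge> n" using \<sigma>(1) by (rule seq_suble)
        ultimately show "norm (G (\<sigma> n)) \<le> inverse (real (Suc n))"
          using order_trans[OF G[of "\<sigma> n"] le_imp_inverse_le[of "real (Suc n)" "real (Suc (\<sigma> n))"]] \<open>n \<ge> n0\<close>
          by simp
      qed
    qed (use LIMSEQ_inverse_real_of_nat in auto)
    moreover have "(\<lambda>n. G (\<sigma> n)) \<longlonglongrightarrow> \<Lambda> (\<zeta> + 2 *\<^sub>R e) - 2 *\<^sub>R \<Lambda> (\<zeta> + e) + \<Lambda> \<zeta>"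
      unfolding G_def by (intro tendsto_intros \<Lambda>)
    ultimately show ?thesis using LIMSEQ_unique by blast
  qed
  have mid: "\<Lambda> (x + 2 *\<^sub>R e) - 2 *\<^sub>R \<Lambda> (x + e) + \<Lambda> x = 0" for x e
  proof (rule ccontr)
    assume neg: "\<not> ?thesis"
    define C where "C = {w. \<Lambda> (fst w + 2 *\<^sub>R snd w) - 2 *\<^sub>R \<Lambda> (fst w + snd w) + \<Lambda> (fst w) \<noteq> 0}"
    have "open C" unfolding C_def
      by (intro open_Collect_neq continuous_intros continuous_on_compose2[OF \<Lambda>_cont[of UNIV]]) auto
    moreover have "(x, e) \<in> C" using neg by (simp add: C_def)
    ultimately obtain A B where AB: "open A" "open B" "x \<in> A" "e \<in> B" "A \<times> B \<subseteq> C"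
      by (metis open_prod_elim mem_Sigma_iff)
    then obtain a b where "a \<in> D" "a \<in> A" "b \<in> D" "b \<in> B" using D(2)[of A] D(2)[of B] by blast
    then show False using midD[of a b] AB(5) by (auto simp: C_def)
  qed
  have lin_D: "linear \<Lambda>"
    using midpoint_affine_imp_linear[OF \<Lambda>_cont _ mid] LIMSEQ_unique[OF \<Lambda>[of 0]] by (simp add: g0)
  show ?thesis
  proof (rule that[of "\<lambda>n. z (\<sigma> n)" "\<lambda>n. r (\<sigma> n)" \<Lambda>])
    show "(\<lambda>n. r (\<sigma> n)) \<longlonglongrightarrow> 0" using LIMSEQ_subseq_LIMSEQ[OF r0 \<sigma>(1)] by (simp add: o_def)
  next
    fix \<eta> :: real assume "\<eta> > 0"
    have "\<forall>\<^sub>F n in sequentially. \<forall>h\<in>cball 0 1. norm (g (\<sigma> n) h - \<Lambda> h) \<le> \<eta>"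
      by (rule pointwise_imp_uniform_lipschitz[OF g_lip \<Lambda>]) (auto simp: \<open>\<eta> > 0\<close>)
    then show "\<forall>\<^sub>F n in sequentially. \<forall>h\<in>cball 0 1. norm (f (z (\<sigma> n) + r (\<sigma> n) *\<^sub>R h) - f (z (\<sigma> n)) - r (\<sigma> n) *\<^sub>R \<Lambda> h) \<le> \<eta> * r (\<sigma> n)"
    proof eventually_elim
      case (elim n)
      have "f (z (\<sigma> n) + r (\<sigma> n) *\<^sub>R h) - f (z (\<sigma> n)) - r (\<sigma> n) *\<^sub>R \<Lambda> h = r (\<sigma> n) *\<^sub>R (g (\<sigma> n) h - \<Lambda> h)" for h
        using r[of "\<sigma> n"] by (simp add: g_def algebra_simps)
      then show ?case using elim r[of "\<sigma> n"] by (simp add: mult.commute)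
    qed
  qed (auto simp: iz r lin_D)
qed

text \<open>A cutoff that equals 1 within distance 1 of \<open>S\<close> changes nothing at scales
  below 1, and the product stays Lipschitz because \<open>f\<close> is bounded where the cutoff
  lives.\<close>

lemma approx_differentiable:
  fixes f :: "'a::euclidean_space \<Rightarrow> 'b::euclidean_space"
  assumes lip: "\<And>x y. norm (f x - f y) \<le> L * norm (x - y)"
    and S: "compact S" "\<not> negligible S"
  obtains z r \<Lambda> where "\<And>k. z k \<in> S" "\<And>k. r k > 0" "r \<longlonglongrightarrow> 0" "linear \<Lambda>"
    "\<And>\<eta>. \<eta> > 0 \<Longrightarrow> \<forall>\<^sub>F k in sequentially. \<forall>h\<in>cball 0 1.
      norm (f (z k + r k *\<^sub>R h) - f (z k) - r k *\<^sub>R \<Lambda> h) \<le> \<eta> * r k"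
proof -
  obtain R0 where R0: "R0 > 0" "\<And>x. x \<in> S \<Longrightarrow> norm x \<le> R0"
    using compact_imp_bounded[OF S(1)] bounded_pos by blast
  define \<psi> where "\<psi> x = max 0 (min 1 (R0 + 2 - norm x))" for x :: 'a
  have \<psi>: "0 \<le> \<psi> x" "\<psi> x \<le> 1" "norm x \<ge> R0 + 2 \<Longrightarrow> \<psi> x = 0" "norm x \<le> R0 + 1 \<Longrightarrow> \<psi> x = 1"
    "\<bar>\<psi> x - \<psi> y\<bar> \<le> norm (x - y)" for x y
    using norm_triangle_ineq2[of x y] norm_triangle_ineq2[of y x] by (auto simp: \<psi>_def norm_minus_commute)
  define M where "M = norm (f 0) + \<bar>L\<bar> * (R0 + 2)"
  have M: "norm (f x) \<le> M" if "norm x \<le> R0 + 2" for x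
  proof -
    have "norm (f x - f 0) \<le> \<bar>L\<bar> * norm x"
      using lip[of x 0] mult_right_mono[OF abs_ge_self norm_ge_zero, of L "x"] by simp
    also have "\<dots> \<le> \<bar>L\<bar> * (R0 + 2)" using that by (intro mult_left_mono) auto
    finally show ?thesis using norm_triangle_ineq2[of "f x" "f 0"] by (simp add: M_def)
  qed
  define F where "F x = \<psi> x *\<^sub>R f x" for x
  have F_lip': "norm (F x - F y) \<le> (\<bar>L\<bar> + M) * norm (x - y)" if "norm y \<le> R0 + 2" for x y
  proof -
    have eq: "F x - F y = \<psi> x *\<^sub>R (f x - f y) + (\<psi> x - \<psi> y) *\<^sub>R f y" by (simp add: F_def algebra_simps)
    have "\<bar>\<psi> x\<bar> * norm (f x - f y) \<le> 1 * (\<bar>L\<bar> * norm (x - y))"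
      using \<psi>(1,2)[of x] lip[of x y] mult_right_mono[OF abs_ge_self norm_ge_zero, of L "(x - y)"] by (intro mult_mono) auto
    moreover have "\<bar>\<psi> x - \<psi> y\<bar> * norm (f y) \<le> norm (x - y) * M"
      using M[OF that] \<psi>(5) by (intro mult_mono) auto
    moreover have "norm (F x - F y) \<le> \<bar>\<psi> x\<bar> * norm (f x - f y) + \<bar>\<psi> x - \<psi> y\<bar> * norm (f y)"
      unfolding eq using norm_triangle_ineq[of "\<psi> x *\<^sub>R (f x - f y)" "(\<psi> x - \<psi> y) *\<^sub>R f y"] by simp
    ultimately show ?thesis by (simp add: algebra_simps)
  qed
  have M0: "0 \<le> M" using R0(1) by (simp add: M_def)
  have F_lip: "norm (F x - F y) \<le> (\<bar>L\<bar> + M) * norm (x - y)" for x y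
  proof -
    consider "norm y \<le> R0 + 2" | "norm x \<le> R0 + 2" | "norm x > R0 + 2" "norm y > R0 + 2" by linarith
    then show ?thesis
      using F_lip'[of y x] F_lip'[of x y] \<psi>(3)[of x] \<psi>(3)[of y] M0
      by cases (auto simp: norm_minus_commute F_def)
  qed
  have F_eq: "F x = f x" if "norm x \<le> R0 + 1" for x using \<psi>(4)[OF that] by (simp add: F_def)
  have "F x = 0" if "norm x > R0 + 2" for x using \<psi>(3)[of x] that by (simp add: F_def)
  then obtain z r \<Lambda> where zr: "\<And>k. z k \<in> S" "\<And>k. r k > 0" "r \<longlonglongrightarrow> 0" "linear \<Lambda>"
    and ap: "\<And>\<eta>. \<eta> > 0 \<Longrightarrow> \<forall>\<^sub>F k in sequentially. \<forall>h\<in>cball 0 1.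
      norm (F (z k + r k *\<^sub>R h) - F (z k) - r k *\<^sub>R \<Lambda> h) \<le> \<eta> * r k"
    using approx_differentiable_compact_support[OF F_lip _ S, of "R0 + 2"] by blast
  show ?thesis
  proof (rule that[OF zr])
    fix \<eta> :: real assume "\<eta> > 0"
    have "\<forall>\<^sub>F k in sequentially. r k < 1" using order_tendstoD(2)[OF zr(3), of 1] by simp
    then show "\<forall>\<^sub>F k in sequentially. \<forall>h\<in>cball 0 1.
      norm (f (z k + r k *\<^sub>R h) - f (z k) - r k *\<^sub>R \<Lambda> h) \<le> \<eta> * r k"
      using ap[OF \<open>\<eta> > 0\<close>]
    proof eventually_elim
      case (elim k)
      show ?case
      proof
        fix h :: 'a assume h: "h \<in> cball 0 1"
        have "norm (r k *\<^sub>R h) \<le> 1" using elim(1) zr(2)[of k] h mult_mono[of "r k" 1 "norm h" 1] by simp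
        then have "F (z k + r k *\<^sub>R h) = f (z k + r k *\<^sub>R h)"
          using R0(2)[OF zr(1)] norm_triangle_ineq[of "z k" "r k *\<^sub>R h"] by (intro F_eq) (smt (verit))
        moreover have "F (z k) = f (z k)" using R0(2)[OF zr(1)] by (intro F_eq) (smt (verit))
        ultimately show "norm (f (z k + r k *\<^sub>R h) - f (z k) - r k *\<^sub>R \<Lambda> h) \<le> \<eta> * r k"
          using elim(2) h by force
      qed
    qed
  qed
qed

section \<open>Regularisation of semicontinuous functions\<close>

lemma usc_on_subset: "usc_on S u \<Longrightarrow> T \<subseteq> S \<Longrightarrow> usc_on T u"
  unfolding usc_on_def by (meson filter_leD at_le subsetD)

lemma usc_on_minus: "usc_on S (\<lambda>x. - v x) \<longleftrightarrow> lsc_on S v"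
proof
  assume *: "usc_on S (\<lambda>x. - v x)"
  show "lsc_on S v" unfolding lsc_on_def
  proof (intro ballI allI impI)
    fix x a assume "x \<in> S" "a < v x"
    then have "\<forall>\<^sub>F y in at x within S. - v y < - a"
      using *[unfolded usc_on_def, rule_format, of x "- a"] by simp
    then show "\<forall>\<^sub>F y in at x within S. a < v y" by simp
  qed
next
  assume *: "lsc_on S v"
  show "usc_on S (\<lambda>x. - v x)" unfolding usc_on_def
  proof (intro ballI allI impI)
    fix x a assume "x \<in> S" "- v x < a"
    then have "\<forall>\<^sub>F y in at x within S. - a < v y"
      using *[unfolded lsc_on_def, rule_format, of x "- a"] by simp
    then show "\<forall>\<^sub>F y in at x within S. - v y < a" by (simp add: minus_less_iff)
  qed
qed

lemma usc_on_add_continuous: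
  fixes u f :: "'a::topological_space \<Rightarrow> real"
  assumes "usc_on S u" "continuous_on S f"
  shows "usc_on S (\<lambda>x. u x + f x)"
  unfolding usc_on_def
proof (intro ballI allI impI)
  fix x a assume x: "x \<in> S" "u x + f x < a"
  define d where "d = (a - (u x + f x)) / 2"
  have d: "d > 0" using x(2) by (simp add: d_def)
  have 1: "\<forall>\<^sub>F y in at x within S. u y < u x + d"
    using assms(1) x(1) d unfolding usc_on_def by auto
  have "(f \<longlongrightarrow> f x) (at x within S)" using assms(2) x(1) by (simp add: continuous_on_def)
  then have 2: "\<forall>\<^sub>F y in at x within S. f y < f x + d" using d by (intro order_tendstoD) auto
  show "\<forall>\<^sub>F y in at x within S. u y + f y < a"
    using 1 2 by eventually_elim (use x(2) in \<open>simp add: d_def field_simps\<close>)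
qed

lemma usc_on_cmult:
  fixes u :: "'a::topological_space \<Rightarrow> real"
  assumes "usc_on S u" "c > 0"
  shows "usc_on S (\<lambda>x. c * u x)"
  unfolding usc_on_def
proof (intro ballI allI impI)
  fix x a assume x: "x \<in> S" "c * u x < a"
  then have "u x < a / c" using assms(2) by (simp add: pos_less_divide_eq mult.commute)
  then have "\<forall>\<^sub>F y in at x within S. u y < a / c" using assms(1) x(1) by (simp add: usc_on_def)
  then show "\<forall>\<^sub>F y in at x within S. c * u y < a"
    using assms(2) by (simp add: pos_less_divide_eq mult.commute)
qed

lemma usc_on_attains_max:
  fixes u :: "'a::topological_space \<Rightarrow> real"
  assumes "compact K" "K \<noteq> {}" "usc_on K u"
  shows "\<exists>x\<in>K. \<forall>y\<in>K. u y \<le> u x"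
proof (rule ccontr)
  assume "\<not> ?thesis"
  then have "\<forall>x\<in>K. \<exists>y\<in>K. u x < u y" by (meson linorder_not_le)
  then obtain Y where Y: "\<And>x. x \<in> K \<Longrightarrow> Y x \<in> K \<and> u x < u (Y x)" by metis
  have "\<forall>x\<in>K. \<exists>V. open V \<and> x \<in> V \<and> (\<forall>z\<in>V \<inter> K. u z < u (Y x))"
  proof
    fix x assume x: "x \<in> K"
    have "\<forall>\<^sub>F z in at x within K. u z < u (Y x)"
      using assms(3) x Y[OF x] by (simp add: usc_on_def)
    then obtain V where "open V" "x \<in> V" "\<And>z. z \<in> V \<Longrightarrow> z \<noteq> x \<Longrightarrow> z \<in> K \<Longrightarrow> u z < u (Y x)"
      unfolding eventually_at_topological by blast
    then show "\<exists>V. open V \<and> x \<in> V \<and> (\<forall>z\<in>V \<inter> K. u z < u (Y x))" using Y[OF x] by blast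
  qed
  then obtain V where V: "\<And>x. x \<in> K \<Longrightarrow> open (V x) \<and> x \<in> V x \<and> (\<forall>z\<in>V x \<inter> K. u z < u (Y x))"
    by metis
  obtain C where C: "C \<subseteq> K" "finite C" "K \<subseteq> (\<Union>x\<in>C. V x)"
    using compactE_image[OF assms(1), of K V] V by blast
  have "C \<noteq> {}" using C(3) assms(2) by auto
  define m where "m = Max ((\<lambda>x. u (Y x)) ` C)"
  have "m \<in> (\<lambda>x. u (Y x)) ` C" unfolding m_def using C(2) \<open>C \<noteq> {}\<close> by (intro Max_in) auto
  then obtain x where x: "x \<in> C" "m = u (Y x)" by auto
  obtain x' where x': "x' \<in> C" "Y x \<in> V x'" using C(1,3) x(1) Y by blast
  have "u (Y x) < u (Y x')" using V[of x'] x' C(1) Y[of x] x(1) by blast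
  moreover have "u (Y x') \<le> m" unfolding m_def using C(2) x'(1) by (intro Max_ge) auto
  ultimately show False using x(2) by simp
qed

section \<open>Identities and inequalities for paraboloids\<close>

lemma norm_add_square:
  fixes x y :: "'a::real_inner"
  shows "(norm (x + y))\<^sup>2 = (norm x)\<^sup>2 + 2 * (x \<bullet> y) + (norm y)\<^sup>2"
  unfolding power2_norm_eq_inner by (simp add: inner_simps inner_commute)

lemma norm_convex_combination:
  fixes x y :: "'a::real_inner"
  shows "(norm ((1 - t) *\<^sub>R x + t *\<^sub>R y))\<^sup>2
    = (1 - t) * (norm x)\<^sup>2 + t * (norm y)\<^sup>2 - t * (1 - t) * (norm (x - y))\<^sup>2"
  unfolding power2_norm_eq_inner by (simp add: inner_simps inner_commute algebra_simps)

text \<open>Completing the square. The constant \<open>c = a * b / (b - a)\<close>, for which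
  \<open>1/a = 1/b + 1/c\<close>, is the sharp one: it is the maximum over \<open>d\<close> of
  \<open>a |d|^2 - b |e - d|^2\<close>, divided by \<open>|e|^2\<close>. It says which weight
  results from a supremal convolution of weight \<open>a\<close> followed by an infimal one of
  weight \<open>b\<close>.\<close>

lemma parallel_sum_inequality:
  fixes d e :: "'a::real_inner" and a b :: real
  assumes "0 < a" "a < b"
  shows "a * (norm d)\<^sup>2 \<le> a * b / (b - a) * (norm e)\<^sup>2 + b * (norm (e - d))\<^sup>2"
proof -
  have "a * b / (b - a) * (norm e)\<^sup>2 + b * (norm (e - d))\<^sup>2 - a * (norm d)\<^sup>2
      = (norm (b *\<^sub>R e - (b - a) *\<^sub>R d))\<^sup>2 / (b - a)"
    using assms unfolding power2_norm_eq_inner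
    by (simp add: inner_simps inner_commute field_simps)
  moreover have "\<dots> \<ge> 0" using assms by simp
  ultimately show ?thesis by linarith
qed

text \<open>Used to identify slopes: if a function lies between two quadratics through the same
  value, their linear parts agree. A small step along \<open>- v\<close> would otherwise make the
  right-hand side negative.\<close>

lemma linear_term_zero:
  fixes v :: "'a::real_inner"
  assumes "\<rho> > 0" and ineq: "\<And>h. norm h < \<rho> \<Longrightarrow> 0 \<le> v \<bullet> h + C * (norm h)\<^sup>2"
  shows "v = 0"
proof (rule ccontr)
  assume "v \<noteq> 0"
  then have v: "norm v > 0" by simp
  define D where "D = \<bar>C\<bar> + 1"
  have D: "D > 0" "C \<le> D" by (auto simp: D_def)
  define s where "s = min (\<rho> / (2 * norm v)) (1 / (2 * D))"
  have s: "s > 0" using v \<open>\<rho> > 0\<close> D by (simp add: s_def)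
  have "s * norm v \<le> \<rho> / (2 * norm v) * norm v" by (intro mult_right_mono) (auto simp: s_def)
  then have s1: "s * norm v < \<rho>" using v \<open>\<rho> > 0\<close> by simp
  have "s * D \<le> 1 / (2 * D) * D" using D by (intro mult_right_mono) (auto simp: s_def)
  also have "\<dots> = 1/2" using D by (simp add: field_simps)
  finally have s2: "s * D < 1" by simp
  have "0 \<le> v \<bullet> (- s *\<^sub>R v) + C * (norm (- s *\<^sub>R v))\<^sup>2" by (rule ineq) (use s s1 in simp)
  also have "\<dots> \<le> v \<bullet> (- s *\<^sub>R v) + D * (norm (- s *\<^sub>R v))\<^sup>2" using D by (intro add_left_mono mult_right_mono) auto
  also have "\<dots> = s * (norm v)\<^sup>2 * (s * D - 1)"
    by (simp add: power_mult_distrib power2_norm_eq_inner power2_eq_square[of s] algebra_simps)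
  also have "\<dots> < 0" using s s2 v by (intro mult_pos_neg) auto
  finally show False by simp
qed

text \<open>Only these consequences of the construction are used afterwards. In the last clause
  \<open>x + (1 / (2 * c)) *\<^sub>R p\<close> is the vertex \<eta> of the paraboloid
  \<open>u \<eta> - c |. - \<eta>|^2\<close> that touches \<open>U\<close> from below at
  \<open>x\<close> with slope \<open>p\<close>.\<close>

definition lasry_lions ::
  "'a::euclidean_space set \<Rightarrow> ('a \<Rightarrow> real) \<Rightarrow> real \<Rightarrow> real \<Rightarrow> real \<Rightarrow> ('a \<Rightarrow> real) \<Rightarrow> ('a \<Rightarrow> 'a) \<Rightarrow> bool" where
  "lasry_lions K u a b c U g \<longleftrightarrow>
    (\<forall>x h. U (x + h) \<ge> U x + g x \<bullet> h - c * (norm h)\<^sup>2) \<and>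
    (\<forall>x h. U (x + h) \<le> U x + g x \<bullet> h + b * (norm h)\<^sup>2) \<and>
    (\<forall>x. \<exists>\<eta>\<in>K. U x \<le> u \<eta> - a * (norm (x - \<eta>))\<^sup>2) \<and>
    (\<forall>x. \<forall>\<eta>\<in>K. u \<eta> - c * (norm (x - \<eta>))\<^sup>2 \<le> U x) \<and>
    (\<forall>x p q b' \<rho>. b' < b \<and> \<rho> > 0 \<and> (\<forall>h. norm h < \<rho> \<longrightarrow> U (x + h) \<le> U x + p \<bullet> h + q h) \<and>
       (\<forall>h. q h \<le> b' * (norm h)\<^sup>2) \<longrightarrow>
       p = g x \<and> x + (1 / (2 * c)) *\<^sub>R p \<in> K \<and> u (x + (1 / (2 * c)) *\<^sub>R p) = U x + (norm p)\<^sup>2 / (4 * c))"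

text \<open>The double regularisation of Lasry and Lions. It is of class \<open>C1,1\<close>, and wherever it is touched
  from above by a quadratic function flatter than \<open>b\<close> the function \<open>u\<close> itself is touched from above by
  the same quadratic, translated.\<close>

theorem sup_inf_convolution:
  fixes u :: "'a::euclidean_space \<Rightarrow> real" and a b :: real
  assumes K: "compact K" "K \<noteq> {}" "usc_on K u" and ab: "0 < a" "a < b"
  defines "c \<equiv> a * b / (b - a)"
  shows "\<exists>U g. lasry_lions K u a b c U g"
proof -
  have c: "c > 0" using ab by (simp add: c_def)
  have "\<exists>\<eta>\<in>K. \<forall>y\<in>K. u y + - (a * (norm (x - y))\<^sup>2) \<le> u \<eta> + - (a * (norm (x - \<eta>))\<^sup>2)" for x
    by (intro usc_on_attains_max K usc_on_add_continuous continuous_intros)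
  then obtain H where H: "\<And>x. H x \<in> K" "\<And>x y. y \<in> K \<Longrightarrow> u y - a * (norm (x - y))\<^sup>2 \<le> u (H x) - a * (norm (x - H x))\<^sup>2"
    by (metis (no_types, lifting) diff_conv_add_uminus)
  \<comment> \<open>The supremal convolution: a supremum of translated paraboloids with leading
    coefficient \<open>- a\<close>, hence semiconvex and, being finite everywhere,
    continuous.\<close>
  define F where "F x = u (H x) - a * (norm (x - H x))\<^sup>2" for x
  have F_ge: "u y - a * (norm (x - y))\<^sup>2 \<le> F x" if "y \<in> K" for x y using H(2)[OF that] by (simp add: F_def)
  have F_semiconvex: "F ((1 - t) *\<^sub>R x + t *\<^sub>R y) \<le> (1 - t) * F x + t * F y + a * (t * (1 - t)) * (norm (x - y))\<^sup>2"
    if t: "0 \<le> t" "t \<le> 1" for t x y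
  proof -
    define z where "z = (1 - t) *\<^sub>R x + t *\<^sub>R y"
    define \<eta> where "\<eta> = H z"
    have zn: "z - \<eta> = (1 - t) *\<^sub>R (x - \<eta>) + t *\<^sub>R (y - \<eta>)" by (simp add: z_def algebra_simps)
    have "F z = u \<eta> - a * ((1 - t) * (norm (x - \<eta>))\<^sup>2 + t * (norm (y - \<eta>))\<^sup>2 - t * (1 - t) * (norm (x - y))\<^sup>2)"
      unfolding F_def \<eta>_def[symmetric] zn norm_convex_combination by simp
    also have "\<dots> = (1 - t) * (u \<eta> - a * (norm (x - \<eta>))\<^sup>2) + t * (u \<eta> - a * (norm (y - \<eta>))\<^sup>2) + a * (t * (1 - t)) * (norm (x - y))\<^sup>2"
      by (simp add: algebra_simps)
    also have "\<dots> \<le> (1 - t) * F x + t * F y + a * (t * (1 - t)) * (norm (x - y))\<^sup>2"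
      using t F_ge[OF H(1)[of z]] unfolding \<eta>_def[symmetric]
      by (intro add_mono mult_left_mono order_refl) auto
    finally show ?thesis by (simp add: z_def)
  qed
  have F_cont: "continuous_on UNIV F"
  proof -
    have "convex_on UNIV (\<lambda>x. F x + a * (norm x)\<^sup>2)"
    proof (rule convex_onI)
      fix t :: real and x y :: 'a assume t: "0 < t" "t < 1"
      show "F ((1 - t) *\<^sub>R x + t *\<^sub>R y) + a * (norm ((1 - t) *\<^sub>R x + t *\<^sub>R y))\<^sup>2
          \<le> (1 - t) * (F x + a * (norm x)\<^sup>2) + t * (F y + a * (norm y)\<^sup>2)"
        using F_semiconvex[of t x y] t unfolding norm_convex_combination by (simp add: algebra_simps)
    qed auto
    then have "continuous_on UNIV (\<lambda>x. F x + a * (norm x)\<^sup>2)" by (intro convex_on_continuous) auto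
    then have "continuous_on UNIV (\<lambda>x. (F x + a * (norm x)\<^sup>2) - a * (norm x)\<^sup>2)"
      by (rule continuous_on_diff) (intro continuous_intros)
    then show ?thesis by simp
  qed
  have "\<exists>\<xi>. \<forall>\<xi>'. F \<xi> + b * (norm (x - \<xi>))\<^sup>2 \<le> F \<xi>' + b * (norm (x - \<xi>'))\<^sup>2" for x
  proof -
    obtain \<eta> where \<eta>: "\<eta> \<in> K" using K(2) by auto
    \<comment> \<open>An intermediate weight: \<open>b0\<close> pays for the possible decrease of
      \<open>F\<close> through \<open>parallel_sum_inequality\<close>, and the remaining
      \<open>b - b0 > 0\<close> makes the function to be minimised coercive.\<close>
    define b0 where "b0 = (a + b) / 2"
    have b0: "a < b0" "b0 < b" using ab by (auto simp: b0_def)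
    define A where "A = u \<eta> - a * b0 / (b0 - a) * (norm (\<eta> - x))\<^sup>2"
    have low: "A + (b - b0) * (norm (x - \<xi>))\<^sup>2 \<le> F \<xi> + b * (norm (x - \<xi>))\<^sup>2" for \<xi>
    proof -
      have "a * (norm (\<eta> - \<xi>))\<^sup>2 \<le> a * b0 / (b0 - a) * (norm (\<eta> - x))\<^sup>2 + b0 * (norm (\<eta> - x - (\<eta> - \<xi>)))\<^sup>2"
        by (rule parallel_sum_inequality) (use ab b0 in auto)
      moreover have "norm (\<eta> - x - (\<eta> - \<xi>)) = norm (x - \<xi>)" by (simp add: norm_minus_commute)
      ultimately show ?thesis using F_ge[OF \<eta>, of \<xi>] by (simp add: A_def norm_minus_commute algebra_simps)
    qed
    define \<rho> where "\<rho> = sqrt (max 0 ((F x - A) / (b - b0)))"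
    have "\<exists>\<xi>\<in>cball x \<rho>. \<forall>\<xi>'\<in>cball x \<rho>. F \<xi> + b * (norm (x - \<xi>))\<^sup>2 \<le> F \<xi>' + b * (norm (x - \<xi>'))\<^sup>2"
      by (rule continuous_attains_inf)
        (auto simp: \<rho>_def intro!: continuous_intros continuous_on_subset[OF F_cont])
    then obtain \<xi> where \<xi>: "\<And>\<xi>'. \<xi>' \<in> cball x \<rho> \<Longrightarrow> F \<xi> + b * (norm (x - \<xi>))\<^sup>2 \<le> F \<xi>' + b * (norm (x - \<xi>'))\<^sup>2" by blast
    have "F \<xi> + b * (norm (x - \<xi>))\<^sup>2 \<le> F \<xi>' + b * (norm (x - \<xi>'))\<^sup>2" for \<xi>'
    proof (cases "\<xi>' \<in> cball x \<rho>")
      case False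
      then have "\<rho> < norm (x - \<xi>')" by (simp add: dist_norm)
      then have "\<rho>\<^sup>2 < (norm (x - \<xi>'))\<^sup>2" by (intro power_strict_mono) (auto simp: \<rho>_def)
      then have "(F x - A) / (b - b0) < (norm (x - \<xi>'))\<^sup>2" by (simp add: \<rho>_def)
      then have "F x - A < (b - b0) * (norm (x - \<xi>'))\<^sup>2" using b0 by (simp add: pos_divide_less_eq mult.commute)
      then have "F x \<le> F \<xi>' + b * (norm (x - \<xi>'))\<^sup>2" using low[of \<xi>'] by linarith
      moreover have "F \<xi> + b * (norm (x - \<xi>))\<^sup>2 \<le> F x" using \<xi>[of x] by (simp add: \<rho>_def)
      ultimately show ?thesis by linarith
    qed (rule \<xi>)
    then show ?thesis by blast
  qed
  then obtain \<Xi> where \<Xi>: "\<And>x \<xi>. F (\<Xi> x) + b * (norm (x - \<Xi> x))\<^sup>2 \<le> F \<xi> + b * (norm (x - \<xi>))\<^sup>2" by metis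
  \<comment> \<open>The infimal convolution. The minimiser at \<open>x\<close> is still a competitor
    at \<open>x + h\<close>; this gives the upper expansion and shows what the gradient must
    be.\<close>
  define U where "U x = F (\<Xi> x) + b * (norm (x - \<Xi> x))\<^sup>2" for x
  define g where "g x = (2 * b) *\<^sub>R (x - \<Xi> x)" for x
  have U_le: "U x \<le> F \<xi> + b * (norm (x - \<xi>))\<^sup>2" for x \<xi> using \<Xi> by (simp add: U_def)
  have upper: "U (x + h) \<le> U x + g x \<bullet> h + b * (norm h)\<^sup>2" for x h
  proof -
    have "x + h - \<Xi> x = (x - \<Xi> x) + h" by simp
    then have "(norm (x + h - \<Xi> x))\<^sup>2 = (norm (x - \<Xi> x))\<^sup>2 + 2 * ((x - \<Xi> x) \<bullet> h) + (norm h)\<^sup>2"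
      by (simp only: norm_add_square)
    then have "b * (norm (x + h - \<Xi> x))\<^sup>2 = b * (norm (x - \<Xi> x))\<^sup>2 + g x \<bullet> h + b * (norm h)\<^sup>2"
      by (simp add: g_def ring_distribs)
    then show ?thesis using U_le[of "x + h" "\<Xi> x"] by (simp add: U_def)
  qed
  have U_semiconvex: "U ((1 - t) *\<^sub>R x + t *\<^sub>R y) \<le> (1 - t) * U x + t * U y + c * (t * (1 - t)) * (norm (x - y))\<^sup>2"
    if t: "0 \<le> t" "t \<le> 1" for t x y
  proof -
    let ?\<xi> = "(1 - t) *\<^sub>R \<Xi> x + t *\<^sub>R \<Xi> y"
    have eq: "(1 - t) *\<^sub>R x + t *\<^sub>R y - ?\<xi> = (1 - t) *\<^sub>R (x - \<Xi> x) + t *\<^sub>R (y - \<Xi> y)" by (simp add: algebra_simps)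
    have eq2: "x - \<Xi> x - (y - \<Xi> y) = (x - y) - (\<Xi> x - \<Xi> y)" by simp
    have "U ((1 - t) *\<^sub>R x + t *\<^sub>R y) \<le> F ?\<xi> + b * (norm ((1 - t) *\<^sub>R x + t *\<^sub>R y - ?\<xi>))\<^sup>2" by (rule U_le)
    also have "\<dots> \<le> ((1 - t) * F (\<Xi> x) + t * F (\<Xi> y) + a * (t * (1 - t)) * (norm (\<Xi> x - \<Xi> y))\<^sup>2)
        + b * ((1 - t) * (norm (x - \<Xi> x))\<^sup>2 + t * (norm (y - \<Xi> y))\<^sup>2 - t * (1 - t) * (norm ((x - y) - (\<Xi> x - \<Xi> y)))\<^sup>2)"
      unfolding eq norm_convex_combination eq2 using F_semiconvex[OF t] by simp
    also have "\<dots> = (1 - t) * U x + t * U y + t * (1 - t) * (a * (norm (\<Xi> x - \<Xi> y))\<^sup>2 - b * (norm ((x - y) - (\<Xi> x - \<Xi> y)))\<^sup>2)"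
      by (simp add: U_def algebra_simps)
    also have "\<dots> \<le> (1 - t) * U x + t * U y + t * (1 - t) * (c * (norm (x - y))\<^sup>2)"
      using t parallel_sum_inequality[OF ab, of "\<Xi> x - \<Xi> y" "x - y"]
      by (intro add_left_mono mult_left_mono) (auto simp: c_def)
    finally show ?thesis by (simp add: algebra_simps)
  qed
  have lower: "U (x + h) \<ge> U x + g x \<bullet> h - c * (norm h)\<^sup>2" for x h
  proof -
    \<comment> \<open>Semiconvexity along \<open>x - s h\<close>, \<open>x\<close>,
      \<open>x + h\<close>, with the upper expansion inserted at \<open>x - s h\<close>. Its error
      is of order \<open>s^2\<close>, so it disappears when the inequality is divided by
      \<open>s\<close> and \<open>s\<close> tends to 0.\<close>
    have est: "U x \<le> U (x + h) - g x \<bullet> h + b * s * (norm h)\<^sup>2 + c * (1 + s) * (norm h)\<^sup>2" if s: "s > 0" for s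
    proof -
      define t where "t = s / (1 + s)"
      have t: "0 \<le> t" "t \<le> 1" using s by (auto simp: t_def)
      have t1: "1 - t = 1 / (1 + s)" using s by (simp add: t_def field_simps)
      have "(1 - t) *\<^sub>R (x + (- s) *\<^sub>R h) + t *\<^sub>R (x + h) = x + (t - (1 - t) * s) *\<^sub>R h" by (simp add: algebra_simps)
      also have "t - (1 - t) * s = 0" unfolding t1 by (simp add: t_def)
      finally have eq: "(1 - t) *\<^sub>R (x + (- s) *\<^sub>R h) + t *\<^sub>R (x + h) = x" by simp
      have "(x + h) - (x + (- s) *\<^sub>R h) = (1 + s) *\<^sub>R h" by (simp add: algebra_simps)
      then have nn: "(norm ((x + (- s) *\<^sub>R h) - (x + h)))\<^sup>2 = (1 + s)\<^sup>2 * (norm h)\<^sup>2"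
        unfolding norm_minus_commute[of "x + (- s) *\<^sub>R h"] by (simp add: power_mult_distrib)
      have 1: "U x \<le> (1 - t) * U (x + (- s) *\<^sub>R h) + t * U (x + h) + c * (t * (1 - t)) * ((1 + s)\<^sup>2 * (norm h)\<^sup>2)"
        using U_semiconvex[OF t, of "x + (- s) *\<^sub>R h" "x + h"] unfolding eq nn .
      have "U (x + (- s) *\<^sub>R h) \<le> U x - s * (g x \<bullet> h) + b * s\<^sup>2 * (norm h)\<^sup>2"
        using upper[of x "(- s) *\<^sub>R h"] by (simp add: power_mult_distrib mult.assoc)
      then have 2: "(1 - t) * U (x + (- s) *\<^sub>R h) \<le> (1 - t) * (U x - s * (g x \<bullet> h) + b * s\<^sup>2 * (norm h)\<^sup>2)"
        using t by (intro mult_left_mono) auto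
      have 3: "t * (1 - t) * (1 + s)\<^sup>2 = s" unfolding t1 unfolding t_def using s by (simp add: power2_eq_square)
      have "c * (t * (1 - t)) * ((1 + s)\<^sup>2 * (norm h)\<^sup>2) = c * (t * (1 - t) * (1 + s)\<^sup>2) * (norm h)\<^sup>2"
        by (simp only: mult.assoc)
      then have "U x \<le> (1 - t) * (U x - s * (g x \<bullet> h) + b * s\<^sup>2 * (norm h)\<^sup>2) + t * U (x + h) + c * s * (norm h)\<^sup>2"
        using 1 2 unfolding 3 by linarith
      then have "(1 + s) * U x \<le> (1 + s) * ((1 - t) * (U x - s * (g x \<bullet> h) + b * s\<^sup>2 * (norm h)\<^sup>2) + t * U (x + h) + c * s * (norm h)\<^sup>2)"
        using s by (intro mult_left_mono) auto
      also have "\<dots> = ((1 + s) * (1 - t)) * (U x - s * (g x \<bullet> h) + b * s\<^sup>2 * (norm h)\<^sup>2) + ((1 + s) * t) * U (x + h) + (1 + s) * (c * s * (norm h)\<^sup>2)"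
        by (simp add: algebra_simps)
      also have "(1 + s) * (1 - t) = 1" unfolding t1 using s by simp
      also have "(1 + s) * t = s" using s by (simp add: t_def)
      finally have "s * U x \<le> s * (U (x + h) - g x \<bullet> h + b * s * (norm h)\<^sup>2 + c * (1 + s) * (norm h)\<^sup>2)"
        by (simp add: algebra_simps power2_eq_square)
      then show ?thesis using s by (simp only: mult_le_cancel_left_pos)
    qed
    have "((\<lambda>s. U (x + h) - g x \<bullet> h + b * s * (norm h)\<^sup>2 + c * (1 + s) * (norm h)\<^sup>2) \<longlongrightarrow>
        U (x + h) - g x \<bullet> h + b * 0 * (norm h)\<^sup>2 + c * (1 + 0) * (norm h)\<^sup>2) (at_right 0)"
      by (intro tendsto_intros)
    then have "U x \<le> U (x + h) - g x \<bullet> h + b * 0 * (norm h)\<^sup>2 + c * (1 + 0) * (norm h)\<^sup>2"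
      by (rule tendsto_lowerbound) (use est in \<open>auto simp: eventually_at_right_less intro: eventually_mono[OF eventually_at_right_less]\<close>)
    then show ?thesis by simp
  qed
  have "lasry_lions K u a b c U g"
    unfolding lasry_lions_def
  proof (intro conjI[OF _ conjI[OF _ conjI[OF _ conjI]]] allI ballI impI lower upper)
    fix x
    show "\<exists>\<eta>\<in>K. U x \<le> u \<eta> - a * (norm (x - \<eta>))\<^sup>2"
      using U_le[of x x] H(1)[of x] by (auto simp: F_def intro!: bexI[of _ "H x"])
  next
    fix x \<eta> assume \<eta>: "\<eta> \<in> K"
    have "a * (norm (\<eta> - \<Xi> x))\<^sup>2 \<le> c * (norm (\<eta> - x))\<^sup>2 + b * (norm (\<eta> - x - (\<eta> - \<Xi> x)))\<^sup>2"
      unfolding c_def by (rule parallel_sum_inequality[OF ab])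
    then show "u \<eta> - c * (norm (x - \<eta>))\<^sup>2 \<le> U x"
      using F_ge[OF \<eta>, of "\<Xi> x"] by (simp add: U_def norm_minus_commute)
  next
    fix x p q b' \<rho>
    assume *: "b' < b \<and> \<rho> > 0 \<and> (\<forall>h. norm h < \<rho> \<longrightarrow> U (x + h) \<le> U x + p \<bullet> h + q h) \<and> (\<forall>h. q h \<le> b' * (norm h)\<^sup>2)"
    then have b': "b' < b" and \<rho>: "\<rho> > 0" and touch: "\<And>h. norm h < \<rho> \<Longrightarrow> U (x + h) \<le> U x + p \<bullet> h + q h"
      and q: "\<And>h. q h \<le> b' * (norm h)\<^sup>2" by auto
    have "p - g x = 0"
    proof (rule linear_term_zero[OF \<rho>])
      fix h :: 'a assume "norm h < \<rho>"
      then show "0 \<le> (p - g x) \<bullet> h + (b' + c) * (norm h)\<^sup>2"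
        using touch[of h] lower[of x h] q[of h] by (simp add: inner_diff_left ring_distribs)
    qed
    then have p: "p = g x" by simp
    \<comment> \<open>\<xi> attains the infimum and \<eta> the supremum behind it. On the segment
      between them \<open>y\<close> is the point where the lower bound
      \<open>u \<eta> - c |. - \<eta>|^2\<close> and the upper bound
      \<open>F \<xi> + b |. - \<xi>|^2\<close> for \<open>U\<close> meet.\<close>
    define \<xi> where "\<xi> = \<Xi> x"
    define \<eta> where "\<eta> = H \<xi>"
    define y where "y = \<xi> + (a / b) *\<^sub>R (\<eta> - \<xi>)"
    have Ux: "U x = F \<xi> + b * (norm (x - \<xi>))\<^sup>2" by (simp add: U_def \<xi>_def)
    have Uy: "F \<xi> + b * (norm (y - \<xi>))\<^sup>2 \<le> U y"
    proof -
      have y\<eta>: "y - \<eta> = - (1 - a / b) *\<^sub>R (\<eta> - \<xi>)" by (simp add: y_def algebra_simps)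
      have "u \<eta> - c * (norm (y - \<eta>))\<^sup>2 \<le> U y"
      proof -
        have "a * (norm (\<eta> - \<Xi> y))\<^sup>2 \<le> c * (norm (\<eta> - y))\<^sup>2 + b * (norm (\<eta> - y - (\<eta> - \<Xi> y)))\<^sup>2"
          unfolding c_def by (rule parallel_sum_inequality[OF ab])
        then show ?thesis
          using F_ge[OF H(1)[of \<xi>], of "\<Xi> y"] by (simp add: U_def norm_minus_commute \<eta>_def)
      qed
      moreover have "u \<eta> = F \<xi> + a * (norm (\<eta> - \<xi>))\<^sup>2" by (simp add: F_def \<eta>_def norm_minus_commute)
      moreover have "c * (norm (y - \<eta>))\<^sup>2 = c * (1 - a / b)\<^sup>2 * (norm (\<eta> - \<xi>))\<^sup>2"
        unfolding y\<eta> norm_scaleR power_mult_distrib by (simp add: power2_commute)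
      moreover have "c * (1 - a / b)\<^sup>2 = a - b * (a / b)\<^sup>2"
        unfolding c_def using ab by (simp add: field_simps power2_eq_square)
      moreover have "(norm (y - \<xi>))\<^sup>2 = (a / b)\<^sup>2 * (norm (\<eta> - \<xi>))\<^sup>2"
        by (simp add: y_def power_mult_distrib power_divide)
      ultimately show ?thesis by (simp add: algebra_simps)
    qed
    \<comment> \<open>\<open>U - b |.|^2\<close> is concave, and \<open>U\<close> coincides with the
      upper paraboloid at \<open>x\<close> and at \<open>y\<close>. So it coincides with it on the
      segment; the leading coefficient \<open>b\<close> along that segment excludes a touching
      quadratic with \<open>b' < b\<close>.\<close>
    have xy: "y = x"
    proof (rule ccontr)
      assume "y \<noteq> x"
      then have d: "norm (y - x) > 0" by simp
      define t where "t = min 1 (\<rho> / (2 * norm (y - x)))"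
      have t: "0 < t" "t \<le> 1" using d \<rho> by (auto simp: t_def)
      have "t * norm (y - x) \<le> \<rho> / (2 * norm (y - x)) * norm (y - x)" by (intro mult_right_mono) (auto simp: t_def)
      then have t\<rho>: "norm (t *\<^sub>R (y - x)) < \<rho>" using d \<rho> t by simp
      define w where "w = (1 - t) *\<^sub>R x + t *\<^sub>R y"
      have w: "w = x + t *\<^sub>R (y - x)" by (simp add: w_def algebra_simps)
      have w\<xi>: "w - \<xi> = (1 - t) *\<^sub>R (x - \<xi>) + t *\<^sub>R (y - \<xi>)" by (simp add: w_def algebra_simps)
      have xw: "x = w + (- t) *\<^sub>R (y - x)" by (simp add: w)
      have yw: "y = w + (1 - t) *\<^sub>R (y - x)" by (simp add: w algebra_simps)
      have "U x \<le> U w - t * (g w \<bullet> (y - x)) + b * t\<^sup>2 * (norm (y - x))\<^sup>2"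
        using upper[of w "(- t) *\<^sub>R (y - x)", folded xw] by (simp add: power_mult_distrib)
      then have "(1 - t) * U x \<le> (1 - t) * (U w - t * (g w \<bullet> (y - x)) + b * t\<^sup>2 * (norm (y - x))\<^sup>2)"
        using t by (intro mult_left_mono) auto
      moreover have "U y \<le> U w + (1 - t) * (g w \<bullet> (y - x)) + b * (1 - t)\<^sup>2 * (norm (y - x))\<^sup>2"
        using upper[of w "(1 - t) *\<^sub>R (y - x)", folded yw] by (simp add: power_mult_distrib)
      then have "t * U y \<le> t * (U w + (1 - t) * (g w \<bullet> (y - x)) + b * (1 - t)\<^sup>2 * (norm (y - x))\<^sup>2)"
        using t by (intro mult_left_mono) auto
      ultimately have "(1 - t) * U x + t * U y \<le> U w + b * (t * (1 - t)) * (norm (y - x))\<^sup>2"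
        by (simp add: algebra_simps power2_eq_square)
      moreover have "(1 - t) * U x + t * U y \<ge> (1 - t) * (F \<xi> + b * (norm (x - \<xi>))\<^sup>2) + t * (F \<xi> + b * (norm (y - \<xi>))\<^sup>2)"
        using t Uy Ux by (intro add_mono mult_left_mono) auto
      moreover have "b * (norm (w - \<xi>))\<^sup>2 = b * ((1 - t) * (norm (x - \<xi>))\<^sup>2 + t * (norm (y - \<xi>))\<^sup>2 - t * (1 - t) * (norm (y - x))\<^sup>2)"
        unfolding w\<xi> norm_convex_combination by (simp add: norm_minus_commute)
      ultimately have "F \<xi> + b * (norm (w - \<xi>))\<^sup>2 \<le> U w" by (simp add: algebra_simps)
      also have "U w \<le> U x + g x \<bullet> (t *\<^sub>R (y - x)) + b' * (norm (t *\<^sub>R (y - x)))\<^sup>2"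
        unfolding w using touch[OF t\<rho>] q[of "t *\<^sub>R (y - x)"] p by simp
      also have "\<dots> < U x + g x \<bullet> (t *\<^sub>R (y - x)) + b * (norm (t *\<^sub>R (y - x)))\<^sup>2"
        using b' t d by simp
      also have "\<dots> = F \<xi> + b * (norm (w - \<xi>))\<^sup>2"
      proof -
        have "w - \<xi> = (x - \<xi>) + t *\<^sub>R (y - x)" by (simp add: w)
        then have "(norm (w - \<xi>))\<^sup>2 = (norm (x - \<xi>))\<^sup>2 + 2 * ((x - \<xi>) \<bullet> (t *\<^sub>R (y - x))) + (norm (t *\<^sub>R (y - x)))\<^sup>2"
          by (simp only: norm_add_square)
        then show ?thesis by (simp add: Ux g_def \<xi>_def ring_distribs)
      qed
      finally show False by simp
    qed
    have px: "p = (2 * b) *\<^sub>R (x - \<xi>)" by (simp add: p g_def \<xi>_def)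
    have x_eq: "x = \<xi> + (a / b) *\<^sub>R (\<eta> - \<xi>)" using xy by (simp only: y_def)
    then have ex: "x - \<xi> = (a / b) *\<^sub>R (\<eta> - \<xi>)" by (metis add_diff_cancel_left')
    have px': "p = (2 * a) *\<^sub>R (\<eta> - \<xi>)" unfolding px ex using ab by simp
    have e\<eta>: "x + (1 / (2 * c)) *\<^sub>R p = \<eta>"
    proof -
      have "x + (1 / (2 * c)) *\<^sub>R p = \<xi> + (a / b) *\<^sub>R (\<eta> - \<xi>) + (a / c) *\<^sub>R (\<eta> - \<xi>)"
        unfolding px' x_eq[symmetric] using c by simp
      also have "\<dots> = \<xi> + (a / b + a / c) *\<^sub>R (\<eta> - \<xi>)" by (simp add: algebra_simps)
      also have "a / b + a / c = 1" unfolding c_def using ab by (simp add: field_simps)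
      finally show ?thesis by simp
    qed
    have "u \<eta> = U x + (norm p)\<^sup>2 / (4 * c)"
    proof -
      have "u \<eta> = F \<xi> + a * (norm (\<eta> - \<xi>))\<^sup>2" by (simp add: F_def \<eta>_def norm_minus_commute)
      moreover have "U x = F \<xi> + b * ((a / b)\<^sup>2 * (norm (\<eta> - \<xi>))\<^sup>2)"
        unfolding Ux ex norm_scaleR power_mult_distrib by (simp add: power_divide)
      moreover have "(norm p)\<^sup>2 / (4 * c) = a\<^sup>2 / c * (norm (\<eta> - \<xi>))\<^sup>2"
        unfolding px' norm_scaleR power_mult_distrib using c by (simp add: field_simps)
      moreover have "a = b * (a / b)\<^sup>2 + a\<^sup>2 / c" unfolding c_def using ab by (simp add: field_simps power2_eq_square)
      then have "a * (norm (\<eta> - \<xi>))\<^sup>2 = (b * (a / b)\<^sup>2 + a\<^sup>2 / c) * (norm (\<eta> - \<xi>))\<^sup>2" by simp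
      ultimately show ?thesis by (simp add: algebra_simps)
    qed
    then show "p = g x \<and> x + (1 / (2 * c)) *\<^sub>R p \<in> K \<and> u (x + (1 / (2 * c)) *\<^sub>R p) = U x + (norm p)\<^sup>2 / (4 * c)"
      unfolding e\<eta> using p H(1)[of \<xi>] by (simp add: \<eta>_def)
  qed
  then show ?thesis by blast
qed

section \<open>The theorem on sums\<close>

lemma C11_has_derivative:
  fixes U :: "'a::euclidean_space \<Rightarrow> real"
  assumes "\<And>x h. \<bar>U (x + h) - U x - g x \<bullet> h\<bar> \<le> C * (norm h)\<^sup>2"
  shows "(U has_derivative (\<lambda>h. g x \<bullet> h)) (at x)"
  unfolding has_derivative_at
proof (intro conjI bounded_linear_intros)
  show "(\<lambda>h. norm (U (x + h) - U x - g x \<bullet> h) / norm h) \<midarrow>0\<rightarrow> 0"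
  proof (rule tendsto_sandwich[of "\<lambda>_. 0" _ _ "\<lambda>h. C * norm h"])
    show "\<forall>\<^sub>F h in at 0. norm (U (x + h) - U x - g x \<bullet> h) / norm h \<le> C * norm h"
    proof (rule always_eventually, rule allI)
      fix h
      show "norm (U (x + h) - U x - g x \<bullet> h) / norm h \<le> C * norm h"
        using assms[of x h] by (cases "h = 0") (auto simp: divide_simps power2_eq_square ac_simps)
    qed
    show "(\<lambda>h. C * norm h) \<midarrow>(0::'a)\<rightarrow> 0"
      by (rule tendsto_mult_right_zero[OF tendsto_norm_zero[OF tendsto_ident_at]])
  qed auto
qed

text \<open>The expansions at \<open>x\<close> and at \<open>y = x + k\<close> are compared at
  \<open>x + k + h\<close>, where \<open>h\<close> has the length of \<open>k\<close> and points
  along the difference of the gradients. Since \<open>|k + h| \<le> 2 |k|\<close>, the constant is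
  \<open>1 + 4 + 1\<close>.\<close>

lemma C11_gradient_lipschitz:
  fixes U :: "'a::euclidean_space \<Rightarrow> real"
  assumes U: "\<And>x h. \<bar>U (x + h) - U x - g x \<bullet> h\<bar> \<le> C * (norm h)\<^sup>2"
  shows "norm (g x - g y) \<le> 6 * C * norm (x - y)"
proof (cases "g x = g y \<or> x = y")
  case True
  have "C \<ge> 0"
  proof -
    obtain i :: 'a where "i \<in> Basis" using nonempty_Basis by blast
    then have "0 \<le> C * (norm i)\<^sup>2" using U[of 0 i] abs_ge_zero order_trans by blast
    then show ?thesis using \<open>i \<in> Basis\<close> by simp
  qed
  then show ?thesis using True by auto
next
  case False
  define k where "k = y - x"
  define d where "d = g y - g x"
  have kd: "norm k > 0" "norm d > 0" using False by (auto simp: k_def d_def)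
  define h where "h = (norm k / norm d) *\<^sub>R d"
  have nh: "norm h = norm k" using kd by (simp add: h_def)
  have C: "C \<ge> 0"
  proof -
    have "0 \<le> C * (norm k)\<^sup>2" using U[of 0 k] abs_ge_zero order_trans by blast
    then show ?thesis using kd by (simp add: zero_le_mult_iff)
  qed
  have "(norm (k + h))\<^sup>2 \<le> (2 * norm k)\<^sup>2"
    using norm_triangle_ineq[of k h] nh by (intro power_mono) auto
  then have n2: "C * (norm (k + h))\<^sup>2 \<le> C * (4 * (norm k)\<^sup>2)" using C by (intro mult_left_mono) (auto simp: power_mult_distrib)
  have "d \<bullet> h \<le> C * (norm h)\<^sup>2 + C * (norm (k + h))\<^sup>2 + C * (norm k)\<^sup>2"
    using U[of "x + k" h] U[of x "k + h"] U[of x k] unfolding abs_le_iff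
    by (simp add: d_def k_def inner_simps add.assoc)
  also have "\<dots> \<le> 6 * C * (norm k)\<^sup>2" using n2 by (simp add: nh)
  also have "d \<bullet> h = norm k * norm d" using kd by (simp add: h_def dot_square_norm power2_eq_square)
  finally have "norm k * norm d \<le> norm k * (6 * C * norm k)" by (simp add: power2_eq_square ac_simps)
  then show ?thesis using kd by (simp add: d_def k_def norm_minus_commute)
qed

text \<open>Along the segment the derivative of the remainder is the error of the linear
  approximation to the gradient, so the mean value inequality carries that error over to the
  function.\<close>

lemma C11_taylor:
  fixes U :: "'a::euclidean_space \<Rightarrow> real"
  assumes U: "\<And>x h. \<bar>U (x + h) - U x - g x \<bullet> h\<bar> \<le> C * (norm h)\<^sup>2"
    and X: "\<And>t. 0 \<le> t \<Longrightarrow> t \<le> 1 \<Longrightarrow> norm (g (x + t *\<^sub>R k) - g x - t *\<^sub>R X k) \<le> e"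
  shows "\<bar>U (x + k) - U x - g x \<bullet> k - (k \<bullet> X k) / 2\<bar> \<le> e * norm k"
proof -
  define f where "f t = U (x + t *\<^sub>R k) - t * (g x \<bullet> k) - t\<^sup>2 / 2 * (k \<bullet> X k)" for t :: real
  define f' where "f' t = (g (x + t *\<^sub>R k) - g x - t *\<^sub>R X k) \<bullet> k" for t :: real
  have der: "(f has_derivative (\<lambda>s. s * f' t)) (at t within {0..1})" for t
  proof -
    have "((\<lambda>t. U (x + t *\<^sub>R k)) has_derivative (\<lambda>s. g (x + t *\<^sub>R k) \<bullet> (s *\<^sub>R k))) (at t within {0..1})"
      by (rule has_derivative_compose[of "\<lambda>t. x + t *\<^sub>R k" _ _ _ U, OF _ C11_has_derivative[OF U]])
        (auto intro!: derivative_eq_intros)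
    then show ?thesis unfolding f_def f'_def
      by (auto intro!: derivative_eq_intros simp: inner_simps algebra_simps inner_commute power2_eq_square)
  qed
  have "norm (f 1 - f 0) \<le> (e * norm k) * norm (1 - 0 :: real)"
  proof (rule differentiable_bound[of "{0..1}" f "\<lambda>t s. s * f' t"])
    fix t :: real assume t: "t \<in> {0..1}"
    have "\<bar>f' t\<bar> \<le> norm (g (x + t *\<^sub>R k) - g x - t *\<^sub>R X k) * norm k"
      unfolding f'_def by (rule Cauchy_Schwarz_ineq2)
    also have "\<dots> \<le> e * norm k" using t X[of t] by (intro mult_right_mono) auto
    finally have *: "\<bar>f' t\<bar> \<le> e * norm k" .
    show "onorm (\<lambda>s. s * f' t) \<le> e * norm k"
      proof (rule onorm_bound)
      show "norm (s * f' t) \<le> e * norm k * norm s" for s :: real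
        using mult_left_mono[OF *, of "\<bar>s\<bar>"] by (simp add: abs_mult ac_simps)
      show "0 \<le> e * norm k" using * abs_ge_zero order_trans by blast
    qed
  qed (auto intro: der)
  then show ?thesis by (simp add: f_def inner_commute)
qed

section \<open>Contact sets of positive measure\<close>

lemma compact_contact_set:
  fixes W :: "'b::euclidean_space \<Rightarrow> real"
  assumes W: "\<And>z h. \<bar>W (z + h) - W z - G z \<bullet> h\<bar> \<le> C * (norm h)\<^sup>2"
    and "linear Q"
  shows "compact {z. norm z \<le> \<rho> \<and> (\<forall>h. W (z + h) \<le> W z + G z \<bullet> h + h \<bullet> Q h + \<eta> * (norm h)\<^sup>2)}"
proof -
  have cW: "continuous_on UNIV W"
    by (meson C11_has_derivative[OF W] continuous_at_imp_continuous_on has_derivative_continuous)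
  have cG: "continuous_on UNIV G" by (rule lipschitz_imp_continuous[OF C11_gradient_lipschitz[OF W]])
  have eq: "{z. norm z \<le> \<rho> \<and> (\<forall>h. W (z + h) \<le> W z + G z \<bullet> h + h \<bullet> Q h + \<eta> * (norm h)\<^sup>2)}
    = cball 0 \<rho> \<inter> (\<Inter>h. {z. W (z + h) \<le> W z + G z \<bullet> h + h \<bullet> Q h + \<eta> * (norm h)\<^sup>2})"
    by auto
  show ?thesis unfolding eq
    by (intro compact_Int_closed compact_cball closed_INT ballI closed_Collect_le continuous_intros cG cW
        continuous_on_compose2[OF cW]) auto
qed

text \<open>Every small slope is attained as the slope of a global maximum, so the contact set is mapped
  onto a ball by a Lipschitz map.\<close>

lemma contact_set_nonnegligible:
  fixes W :: "'b::euclidean_space \<Rightarrow> real"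
  assumes W: "\<And>z h. \<bar>W (z + h) - W z - G z \<bullet> h\<bar> \<le> C * (norm h)\<^sup>2"
    and W0: "W 0 = 0" and WQ: "\<And>z. W z \<le> z \<bullet> Q z"
    and Q: "linear Q" "\<And>x y. x \<bullet> Q y = Q x \<bullet> y"
    and pos: "\<eta> > 0" "\<rho> > 0"
  shows "\<not> negligible {z. norm z \<le> \<rho> \<and> (\<forall>h. W (z + h) \<le> W z + G z \<bullet> h + h \<bullet> Q h + \<eta> * (norm h)\<^sup>2)}"
    (is "\<not> negligible ?S")
proof
  assume neg: "negligible ?S"
  \<comment> \<open>\<open>T z\<close> is the slope \<open>p\<close> for which \<open>z\<close> is
    critical for \<open>W - P - p\<close>, with the quadratic \<open>P\<close> introduced
    below.\<close>
  define T where "T z = G z - 2 *\<^sub>R Q z - (2 * \<eta>) *\<^sub>R z" for z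
  have cW: "continuous_on UNIV W"
    by (meson C11_has_derivative[OF W] continuous_at_imp_continuous_on has_derivative_continuous)
  have cQ: "continuous_on A Q" for A by (rule linear_continuous_on[OF linear_linear[THEN iffD2, OF Q(1)]])
  obtain B where B: "\<And>z. norm (Q z) \<le> B * norm z" using linear_bounded[OF Q(1)] by blast
  define P where "P z = z \<bullet> Q z + \<eta> * (norm z)\<^sup>2" for z
  have P_add: "P (z + h) = P z + (2 *\<^sub>R Q z + (2 * \<eta>) *\<^sub>R z) \<bullet> h + P h" for z h
  proof -
    have "(z + h) \<bullet> Q (z + h) = z \<bullet> Q z + Q z \<bullet> h + Q z \<bullet> h + h \<bullet> Q h"
      unfolding linear_add[OF Q(1)] inner_add_left inner_add_right
      using Q(2)[of z h] inner_commute[of h "Q z"] by linarith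
    then show ?thesis unfolding P_def norm_add_square inner_add_left inner_scaleR_left distrib_left by linarith
  qed
  have PB: "P h \<le> (B + \<eta>) * (norm h)\<^sup>2" for h
  proof -
    have "h \<bullet> Q h \<le> norm h * norm (Q h)" by (rule norm_cauchy_schwarz)
    also have "\<dots> \<le> norm h * (B * norm h)" using B by (intro mult_left_mono) auto
    finally show ?thesis by (simp add: P_def power2_eq_square algebra_simps)
  qed
  have "negligible (T ` ?S)"
  proof (rule negligible_locally_Lipschitz_image[OF order_refl neg])
    fix x
    have "norm (T y - T x) \<le> (6 * C + 2 * B + 2 * \<eta>) * norm (y - x)" for y
    proof -
      have "T y - T x = (G y - G x) - 2 *\<^sub>R Q (y - x) - (2 * \<eta>) *\<^sub>R (y - x)"
        by (simp add: T_def linear_diff[OF Q(1)] algebra_simps)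
      then have "norm (T y - T x) \<le> norm (G y - G x) + norm (2 *\<^sub>R Q (y - x)) + norm ((2 * \<eta>) *\<^sub>R (y - x))"
        by (metis (no_types, lifting) add_right_mono norm_triangle_ineq4 order_trans)
      moreover have "norm ((2 * \<eta>) *\<^sub>R (y - x)) = 2 * \<eta> * norm (y - x)" using pos by simp
      moreover have "norm (2 *\<^sub>R Q (y - x)) \<le> 2 * B * norm (y - x)" using B[of "y - x"] by simp
      ultimately show ?thesis
        using C11_gradient_lipschitz[OF W, of y x] unfolding distrib_right by linarith
    qed
    then show "\<exists>V B. open V \<and> x \<in> V \<and> (\<forall>y\<in>?S \<inter> V. norm (T y - T x) \<le> B * norm (y - x))"
      by (intro exI[of _ UNIV]) auto
  qed
  moreover have "ball 0 (\<eta> * \<rho>) \<subseteq> T ` ?S"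
  proof
    fix p :: 'b assume "p \<in> ball 0 (\<eta> * \<rho>)"
    then have p: "norm p < \<eta> * \<rho>" by simp
    have "\<exists>z\<in>cball 0 \<rho>. \<forall>y\<in>cball 0 \<rho>. W y - P y - p \<bullet> y \<le> W z - P z - p \<bullet> z"
      unfolding P_def
      by (intro continuous_attains_sup continuous_intros continuous_on_subset[OF cW] cQ) (use pos in auto)
    then obtain z where z: "norm z \<le> \<rho>" "\<And>y. norm y \<le> \<rho> \<Longrightarrow> W y - P y - p \<bullet> y \<le> W z - P z - p \<bullet> z" by auto
    \<comment> \<open>Outside the ball the term \<open>\<eta> * (norm y)\<^sup>2\<close> outweighs
      any slope below \<open>\<eta> * \<rho>\<close>, while the value at 0 is 0; hence the maximum
      over the ball is global.\<close>
    have max: "W y - P y - p \<bullet> y \<le> W z - P z - p \<bullet> z" for y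
    proof (cases "norm y \<le> \<rho>")
      case False
      have "W y - P y - p \<bullet> y \<le> - (\<eta> * (norm y)\<^sup>2) + norm p * norm y"
        using WQ[of y] Cauchy_Schwarz_ineq2[of p y] by (simp add: P_def abs_le_iff)
      also have "\<dots> \<le> 0"
      proof -
        have "norm p * norm y \<le> (\<eta> * norm y) * norm y"
          using p False pos mult_left_mono[of \<rho> "norm y" \<eta>] by (intro mult_right_mono) linarith+
        then show ?thesis by (simp add: power2_eq_square)
      qed
      also have "0 \<le> W z - P z - p \<bullet> z" using z(2)[of 0] pos W0 by (simp add: P_def linear_0[OF Q(1)])
      finally show ?thesis .
    qed (rule z(2))
    define w where "w = p + 2 *\<^sub>R Q z + (2 * \<eta>) *\<^sub>R z"
    have up: "W (z + h) \<le> W z + w \<bullet> h + P h" for h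
      using max[of "z + h"] unfolding P_add by (simp add: w_def inner_simps)
    have "w - G z = 0"
    proof (rule linear_term_zero[of 1])
      fix h
      show "0 \<le> (w - G z) \<bullet> h + (B + \<eta> + C) * (norm h)\<^sup>2"
        using up[of h] PB[of h] W[of z h] unfolding abs_le_iff by (simp add: inner_simps algebra_simps)
    qed simp
    then have w: "w = G z" by simp
    then have "p = T z" by (simp add: T_def w_def[symmetric] algebra_simps) (simp add: w_def algebra_simps flip: w)
    moreover have "z \<in> ?S" using up z(1) by (simp add: w P_def add.assoc)
    ultimately show "p \<in> T ` ?S" by blast
  qed
  ultimately have "negligible (ball (0::'b) (\<eta> * \<rho>))" by (rule negligible_subset)
  then show False using mult_pos_pos[OF pos] open_not_negligible[of "ball (0::'b) (\<eta> * \<rho>)"] by auto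
qed

text \<open>Strictness on the sphere against equality at the centre moves a maximum of the
  difference into the open ball. There \<open>U\<close> is touched exactly by a quadratic with
  matrix \<open>X\<close>, and since this is flatter than \<open>b\<close>, the contact passes on to
  \<open>u\<close>.\<close>

lemma touch_from_approximate_expansion:
  fixes U :: "'a::euclidean_space \<Rightarrow> real"
  assumes LL: "lasry_lions K u a b c U g" and c: "0 < c"
    and X: "linear X" "\<And>h k. h \<bullet> X k = X h \<bullet> k" "\<And>h. (h \<bullet> X h) / 2 \<le> b' * (norm h)\<^sup>2" and b': "b' < b"
    and r: "r > 0"
    and ap: "\<And>h. norm h = r \<Longrightarrow> U (x0 + h) < U x0 + g x0 \<bullet> h + (h \<bullet> X h) / 2"
  obtains x \<rho> where "norm (x - x0) < r" "\<rho> > 0"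
    "x + (1 / (2 * c)) *\<^sub>R g x \<in> K" "u (x + (1 / (2 * c)) *\<^sub>R g x) = U x + (norm (g x))\<^sup>2 / (4 * c)"
    "\<And>\<eta>. \<eta> \<in> K \<Longrightarrow> norm (\<eta> - (x + (1 / (2 * c)) *\<^sub>R g x)) < \<rho> \<Longrightarrow>
      u \<eta> \<le> u (x + (1 / (2 * c)) *\<^sub>R g x) + g x \<bullet> (\<eta> - (x + (1 / (2 * c)) *\<^sub>R g x))
        + ((\<eta> - (x + (1 / (2 * c)) *\<^sub>R g x)) \<bullet> X (\<eta> - (x + (1 / (2 * c)) *\<^sub>R g x))) / 2"
proof -
  have low: "U (x + h) \<ge> U x + g x \<bullet> h - c * (norm h)\<^sup>2"
    and upp: "U (x + h) \<le> U x + g x \<bullet> h + b * (norm h)\<^sup>2"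
    and min: "\<eta> \<in> K \<Longrightarrow> u \<eta> - c * (norm (x - \<eta>))\<^sup>2 \<le> U x"
    and touch: "\<lbrakk>b' < b; \<rho> > 0; \<And>h. norm h < \<rho> \<Longrightarrow> U (x + h) \<le> U x + p \<bullet> h + q h; \<And>h. q h \<le> b' * (norm h)\<^sup>2\<rbrakk> \<Longrightarrow>
       p = g x \<and> x + (1 / (2 * c)) *\<^sub>R p \<in> K \<and> u (x + (1 / (2 * c)) *\<^sub>R p) = U x + (norm p)\<^sup>2 / (4 * c)"
    for x h p q b' \<rho> \<eta>
    using LL unfolding lasry_lions_def by blast+
  have ab: "\<bar>U (x + h) - U x - g x \<bullet> h\<bar> \<le> max b c * (norm h)\<^sup>2" for x h
  proof -
    have "b * (norm h)\<^sup>2 \<le> max b c * (norm h)\<^sup>2" "c * (norm h)\<^sup>2 \<le> max b c * (norm h)\<^sup>2"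
      by (auto intro: mult_right_mono)
    then show ?thesis using low[of x h] upp[of x h] by (simp add: abs_le_iff)
  qed
  have cU: "continuous_on UNIV U"
    by (meson C11_has_derivative[OF ab] continuous_at_imp_continuous_on has_derivative_continuous)
  have cX: "continuous_on A X" for A using X(1) by (simp add: linear_continuous_on linear_linear)
  define \<psi> where "\<psi> h = U (x0 + h) - g x0 \<bullet> h - (h \<bullet> X h) / 2" for h
  have "\<exists>h\<in>cball 0 r. \<forall>k\<in>cball 0 r. \<psi> k \<le> \<psi> h"
    unfolding \<psi>_def
    by (intro continuous_attains_sup continuous_intros cX continuous_on_compose2[OF cU]) (use r in auto)
  then obtain h0 where h0: "norm h0 \<le> r" "\<And>k. norm k \<le> r \<Longrightarrow> \<psi> k \<le> \<psi> h0" by auto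
  have "norm h0 \<noteq> r"
  proof
    assume "norm h0 = r"
    from ap[OF this] h0(2)[of 0] r show False by (simp add: \<psi>_def linear_0[OF X(1)])
  qed
  then have h0r: "norm h0 < r" using h0(1) by simp
  define x where "x = x0 + h0"
  define \<rho> where "\<rho> = r - norm h0"
  have \<rho>: "\<rho> > 0" using h0r by (simp add: \<rho>_def)
  define p where "p = g x0 + X h0"
  have near: "U (x + h) \<le> U x + p \<bullet> h + (h \<bullet> X h) / 2" if "norm h < \<rho>" for h
  proof -
    have "norm (h0 + h) \<le> r" using norm_triangle_ineq[of h0 h] that by (simp add: \<rho>_def)
    then have "\<psi> (h0 + h) \<le> \<psi> h0" by (rule h0(2))
    moreover have "(h0 + h) \<bullet> X (h0 + h) = h0 \<bullet> X h0 + X h0 \<bullet> h + X h0 \<bullet> h + h \<bullet> X h"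
      unfolding linear_add[OF X(1)] inner_add_left inner_add_right
      using X(2)[of h0 h] inner_commute[of h "X h0"] by linarith
    moreover have "p \<bullet> h = g x0 \<bullet> (h0 + h) - g x0 \<bullet> h0 + X h0 \<bullet> h" by (simp add: p_def inner_add_left inner_add_right)
    ultimately show ?thesis unfolding \<psi>_def x_def add.assoc[of x0] by linarith
  qed
  have t: "p = g x \<and> x + (1 / (2 * c)) *\<^sub>R p \<in> K \<and> u (x + (1 / (2 * c)) *\<^sub>R p) = U x + (norm p)\<^sup>2 / (4 * c)"
    by (rule touch[OF b' \<rho> near X(3)])
  define \<eta>0 where "\<eta>0 = x + (1 / (2 * c)) *\<^sub>R g x"
  have u0: "u \<eta>0 = U x + (norm (g x))\<^sup>2 / (4 * c)" using t unfolding \<eta>0_def by metis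
  have \<eta>0K: "\<eta>0 \<in> K" using t unfolding \<eta>0_def by metis
  have pg: "p = g x" using t by blast
  show ?thesis
  proof (rule that[of x \<rho>, folded \<eta>0_def])
    fix \<eta> assume \<eta>: "\<eta> \<in> K" "norm (\<eta> - \<eta>0) < \<rho>"
    \<comment> \<open>Moving \<open>x\<close> and the vertex by the same vector leaves the penalty
      unchanged, so it cancels against the one contained in \<open>u \<eta>0\<close>.\<close>
    have "u \<eta> - c * (norm (x + (\<eta> - \<eta>0) - \<eta>))\<^sup>2 \<le> U (x + (\<eta> - \<eta>0))" by (rule min[OF \<eta>(1)])
    moreover have "c * (norm (x + (\<eta> - \<eta>0) - \<eta>))\<^sup>2 = (norm (g x))\<^sup>2 / (4 * c)"
    proof -
      have eq: "x + (\<eta> - \<eta>0) - \<eta> = - (1 / (2 * c)) *\<^sub>R g x" by (simp add: \<eta>0_def)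
      show ?thesis unfolding eq norm_scaleR power_mult_distrib using c by (simp add: power2_eq_square)
    qed
    ultimately show "u \<eta> \<le> u \<eta>0 + g x \<bullet> (\<eta> - \<eta>0) + ((\<eta> - \<eta>0) \<bullet> X (\<eta> - \<eta>0)) / 2"
      using near[OF \<eta>(2)] unfolding u0 pg by simp
  qed (use \<rho> h0r \<eta>0K u0 in \<open>auto simp: x_def\<close>)
qed

text \<open>The linear map supplied by approximate differentiation is not known to be symmetric, but
  only its quadratic form enters, which is that of its symmetric part.\<close>

lemma symmetric_part:
  fixes A :: "'a::euclidean_space \<Rightarrow> 'a"
  assumes "linear A"
  obtains X where "linear X" "\<And>h k. h \<bullet> X k = X h \<bullet> k" "\<And>h. h \<bullet> X h = h \<bullet> A h"
proof (rule that[of "\<lambda>h. (1/2) *\<^sub>R (A h + adjoint A h)"])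
  have adj: "x \<bullet> adjoint A y = A x \<bullet> y" for x y by (rule adjoint_works[OF assms])
  show "linear (\<lambda>h. (1/2) *\<^sub>R (A h + adjoint A h))"
    by (intro linear_compose_scale_right linear_compose_add assms adjoint_linear)
  show "h \<bullet> ((1/2) *\<^sub>R (A k + adjoint A k)) = ((1/2) *\<^sub>R (A h + adjoint A h)) \<bullet> k" for h k
    using adj[of h k] adj[of k h] by (simp add: inner_add_left inner_add_right inner_commute)
  show "h \<bullet> ((1/2) *\<^sub>R (A h + adjoint A h)) = h \<bullet> A h" for h
    using adj[of h h] by (simp add: inner_add_right inner_commute)
qed

text \<open>Exact jets at points within \<delta> of the contact point take the place of limiting
  jets; their errors fit into the slack of the comparison argument. If \<open>A\<close> is the
  matrix of the quadratic form in \<open>sum\<close>, the upper bound is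
  \<open>2 A + \<delta>\<close> instead of the customary \<open>A + \<epsilon> A^2\<close>; the
  factor 2 is the one lost in \<open>q_add\<close>.\<close>

theorem ishii_sums:
  fixes u1 u2 :: "'a::euclidean_space \<Rightarrow> real"
  assumes K: "compact K1" "compact K2" "0 \<in> K1" "0 \<in> K2"
    and usc: "usc_on K1 u1" "usc_on K2 u2"
    and u0: "u1 0 = 0" "u2 0 = 0"
    and b12: "b1 \<ge> 0" "b2 > 0"
    and sum: "\<And>x y. x \<in> K1 \<Longrightarrow> y \<in> K2 \<Longrightarrow>
      2 * (u1 x + u2 y) \<le> b1 * (norm (x - y))\<^sup>2 + b2 * ((norm x)\<^sup>2 + (norm y)\<^sup>2)"
    and \<delta>: "\<delta> > 0"
  obtains x y p1 p2 X Y \<rho> where "x \<in> K1" "y \<in> K2" "norm x < \<delta>" "norm y < \<delta>"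
    "norm p1 < \<delta>" "norm p2 < \<delta>" "\<bar>u1 x\<bar> < \<delta>" "\<bar>u2 y\<bar> < \<delta>"
    "linear X" "\<And>h k. h \<bullet> X k = X h \<bullet> k" "linear Y" "\<And>h k. h \<bullet> Y k = Y h \<bullet> k" "\<rho> > 0"
    "\<And>\<eta>. \<eta> \<in> K1 \<Longrightarrow> norm (\<eta> - x) < \<rho> \<Longrightarrow> u1 \<eta> \<le> u1 x + p1 \<bullet> (\<eta> - x) + ((\<eta> - x) \<bullet> X (\<eta> - x)) / 2"
    "\<And>\<eta>. \<eta> \<in> K2 \<Longrightarrow> norm (\<eta> - y) < \<rho> \<Longrightarrow> u2 \<eta> \<le> u2 y + p2 \<bullet> (\<eta> - y) + ((\<eta> - y) \<bullet> Y (\<eta> - y)) / 2"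
    "\<And>h k. h \<bullet> X h + k \<bullet> Y k \<le> 2 * b1 * (norm (h - k))\<^sup>2 + (2 * b2 + \<delta>) * ((norm h)\<^sup>2 + (norm k)\<^sup>2)"
    "\<And>h k. - (8 * b1 + 4 * b2) * ((norm h)\<^sup>2 + (norm k)\<^sup>2) \<le> h \<bullet> X h + k \<bullet> Y k"
proof -
  \<comment> \<open>\<open>a\<close> is the largest eigenvalue of the form \<open>q\<close> below.
    Taking \<open>b > 2 * a\<close> gives \<open>c \<le> 2 * a\<close>, which becomes the lower
    bound for the matrices, and leaves \<open>b\<close> above the curvature of the touching
    quadratics.\<close>
  define a where "a = 2 * b1 + b2"
  define b where "b = 2 * a + \<delta>"
  define c where "c = a * b / (b - a)"
  have a: "a > 0" using b12 by (simp add: a_def)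
  have b: "b > 2 * a" "b > a" using a \<delta> by (auto simp: b_def)
  have c: "c > 0" using a b by (simp add: c_def)
  have c2: "c \<le> 2 * a"
  proof -
    have "a * b \<le> 2 * a * (b - a)" using a b by (simp add: algebra_simps)
    then show ?thesis using b by (simp add: c_def pos_divide_le_eq)
  qed
  have cb: "c < b" using c2 b by simp
  obtain U1 g1 where LL1: "lasry_lions K1 u1 a b c U1 g1"
    using sup_inf_convolution[OF K(1) _ usc(1) a b(2)] K(3) unfolding c_def by blast
  obtain U2 g2 where LL2: "lasry_lions K2 u2 a b c U2 g2"
    using sup_inf_convolution[OF K(2) _ usc(2) a b(2)] K(4) unfolding c_def by blast
  have C11: "\<bar>U (x + h) - U x - g x \<bullet> h\<bar> \<le> b * (norm h)\<^sup>2" if "lasry_lions K u a b c U g" for K u U g x and h :: 'a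
  proof -
    have "c * (norm h)\<^sup>2 \<le> b * (norm h)\<^sup>2" using cb by (intro mult_right_mono) auto
    moreover have "U (x + h) \<ge> U x + g x \<bullet> h - c * (norm h)\<^sup>2" "U (x + h) \<le> U x + g x \<bullet> h + b * (norm h)\<^sup>2"
      using that unfolding lasry_lions_def by blast+
    ultimately show ?thesis by (simp add: abs_le_iff)
  qed
  note C1 = C11[OF LL1] and C2 = C11[OF LL2]
  define W where "W z = U1 (fst z) + U2 (snd z)" for z
  define G where "G z = (g1 (fst z), g2 (snd z))" for z
  define Q where "Q z = (b1 *\<^sub>R (fst z - snd z) + b2 *\<^sub>R fst z, b1 *\<^sub>R (snd z - fst z) + b2 *\<^sub>R snd z)" for z :: "'a \<times> 'a"
  define q where "q h k = b1 * (norm (h - k))\<^sup>2 + b2 * ((norm h)\<^sup>2 + (norm k)\<^sup>2)" for h k :: 'a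
  have Qlin: "linear Q" by (rule linearI) (auto simp: Q_def algebra_simps)
  have Qsym: "x \<bullet> Q y = Q x \<bullet> y" for x y
    by (cases x; cases y) (simp add: Q_def inner_simps inner_commute algebra_simps)
  have Qq: "z \<bullet> Q z = q (fst z) (snd z)" for z
    by (cases z) (simp add: Q_def q_def inner_simps inner_commute algebra_simps power2_norm_eq_inner)
  have normz: "(norm z)\<^sup>2 = (norm (fst z))\<^sup>2 + (norm (snd z))\<^sup>2" for z :: "'a \<times> 'a"
    by (cases z) (simp add: norm_Pair)
  have C: "\<bar>W (z + h) - W z - G z \<bullet> h\<bar> \<le> b * (norm h)\<^sup>2" for z h
    using C1[of "fst z" "fst h"] C2[of "snd z" "snd h"] unfolding abs_le_iff
    by (cases z; cases h) (simp add: W_def G_def normz distrib_left)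
  have q_small: "q h k \<le> a * ((norm h)\<^sup>2 + (norm k)\<^sup>2)" for h k
  proof -
    have "(norm (h - k))\<^sup>2 + (norm (h + k))\<^sup>2 = 2 * ((norm h)\<^sup>2 + (norm k)\<^sup>2)"
      unfolding power2_norm_eq_inner by (simp add: inner_simps inner_commute)
    then have "(norm (h - k))\<^sup>2 \<le> 2 * ((norm h)\<^sup>2 + (norm k)\<^sup>2)" by (smt (verit) zero_le_power2)
    then have "b1 * (norm (h - k))\<^sup>2 \<le> b1 * (2 * ((norm h)\<^sup>2 + (norm k)\<^sup>2))" using b12 by (intro mult_left_mono)
    then show ?thesis by (simp add: q_def a_def algebra_simps)
  qed
  have sq: "(norm (x + y))\<^sup>2 \<le> 2 * (norm x)\<^sup>2 + 2 * (norm y)\<^sup>2" for x y :: 'a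
  proof -
    have "(norm (x - y))\<^sup>2 + (norm (x + y))\<^sup>2 = 2 * ((norm x)\<^sup>2 + (norm y)\<^sup>2)"
      unfolding power2_norm_eq_inner by (simp add: inner_simps inner_commute)
    then show ?thesis by (smt (verit) zero_le_power2)
  qed
  have q_add: "q (x + h) (y + k) \<le> 2 * q x y + 2 * q h k" for x y h k
  proof -
    have e: "x + h - (y + k) = (x - y) + (h - k)" by simp
    have "b1 * (norm (x + h - (y + k)))\<^sup>2 \<le> b1 * (2 * (norm (x - y))\<^sup>2 + 2 * (norm (h - k))\<^sup>2)"
      unfolding e using b12 sq by (intro mult_left_mono) auto
    moreover have "b2 * ((norm (x + h))\<^sup>2 + (norm (y + k))\<^sup>2)
        \<le> b2 * ((2 * (norm x)\<^sup>2 + 2 * (norm h)\<^sup>2) + (2 * (norm y)\<^sup>2 + 2 * (norm k)\<^sup>2))"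
      using b12 sq by (intro mult_left_mono add_mono) auto
    ultimately show ?thesis by (simp add: q_def algebra_simps)
  qed
  \<comment> \<open>The factor 2 in \<open>sum\<close> pays for \<open>q_add\<close>, and the weight
    \<open>a\<close> pays for the displacement from \<open>(x, y)\<close> to the maximisers of the
    two supremal convolutions.\<close>
  have WQ: "W z \<le> z \<bullet> Q z" for z
  proof -
    obtain x y where z: "z = (x, y)" by (cases z)
    obtain \<eta> where \<eta>: "\<eta> \<in> K1" "U1 x \<le> u1 \<eta> - a * (norm (x - \<eta>))\<^sup>2" using LL1 unfolding lasry_lions_def by blast
    obtain \<theta> where \<theta>: "\<theta> \<in> K2" "U2 y \<le> u2 \<theta> - a * (norm (y - \<theta>))\<^sup>2" using LL2 unfolding lasry_lions_def by blast
    have "2 * (u1 \<eta> + u2 \<theta>) \<le> q \<eta> \<theta>" using sum[OF \<eta>(1) \<theta>(1)] by (simp add: q_def)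
    also have "q \<eta> \<theta> \<le> 2 * q x y + 2 * q (\<eta> - x) (\<theta> - y)" using q_add[of x "\<eta> - x" y "\<theta> - y"] by simp
    finally have "u1 \<eta> + u2 \<theta> \<le> q x y + q (\<eta> - x) (\<theta> - y)" by simp
    moreover have "q (\<eta> - x) (\<theta> - y) \<le> a * (norm (x - \<eta>))\<^sup>2 + a * (norm (y - \<theta>))\<^sup>2"
      using q_small[of "\<eta> - x" "\<theta> - y"] by (simp add: norm_minus_commute distrib_left)
    ultimately show ?thesis using \<eta>(2) \<theta>(2) by (simp add: z W_def Qq)
  qed
  have "u1 0 - c * (norm (0 - 0 :: 'a))\<^sup>2 \<le> U1 0" "u2 0 - c * (norm (0 - 0 :: 'a))\<^sup>2 \<le> U2 0"
    using LL1 LL2 K(3,4) unfolding lasry_lions_def by blast+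
  then have "U1 0 \<ge> 0" "U2 0 \<ge> 0" using u0 by auto
  moreover have "W 0 \<le> 0" using WQ[of 0] by simp
  ultimately have U0: "U1 0 = 0" "U2 0 = 0" by (auto simp: W_def)
  then have W0: "W 0 = 0" by (simp add: W_def)
  have "- G 0 = 0"
  proof (rule linear_term_zero[of 1])
    fix h
    show "0 \<le> (- G 0) \<bullet> h + (a + b) * (norm h)\<^sup>2"
      using C[of 0 h] WQ[of h] q_small[of "fst h" "snd h"] W0 unfolding abs_le_iff Qq
      by (simp add: normz distrib_right)
  qed simp
  then have g0: "g1 0 = 0" "g2 0 = 0" by (auto simp: G_def zero_prod_def)
  have gb: "norm (g1 x) \<le> 6 * b * norm x" "norm (g2 x) \<le> 6 * b * norm x" for x
    using C11_gradient_lipschitz[OF C1, of x 0] C11_gradient_lipschitz[OF C2, of x 0] g0 by auto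
  have Ub: "\<bar>U1 x\<bar> \<le> b * (norm x)\<^sup>2" "\<bar>U2 x\<bar> \<le> b * (norm x)\<^sup>2" for x
    using C1[of 0 x] C2[of 0 x] U0 g0 by auto
  \<comment> \<open>Each summand after the first belongs to one output: the point shifted by
    \<open>(1 / (2 * c)) *\<^sub>R p\<close>, the slope, and the value. Points of norm at most
    \<open>2 * \<rho>0\<close> then keep all of them below \<delta>.\<close>
  define M where "M = 1 + 3 * b / c + 6 * b + b + 9 * b\<^sup>2 / c"
  have "3 * b / c \<ge> 0" "9 * b\<^sup>2 / c \<ge> 0" "6 * b \<ge> 0" using a b c by auto
  then have M: "M \<ge> 1" "1 + 3 * b / c \<le> M" "6 * b \<le> M" "b + 9 * b\<^sup>2 / c \<le> M"
    using a b by (auto simp: M_def)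
  define \<rho>0 where "\<rho>0 = min (1/2) (\<delta> / (4 * M))"
  have \<rho>0: "\<rho>0 > 0" "2 * \<rho>0 \<le> 1" using \<delta> M by (auto simp: \<rho>0_def)
  have "2 * \<rho>0 * M \<le> 2 * (\<delta> / (4 * M)) * M" using M by (intro mult_right_mono) (auto simp: \<rho>0_def)
  also have "\<dots> = \<delta> / 2" using M by (simp add: field_simps)
  finally have \<rho>0M: "2 * \<rho>0 * M < \<delta>" using \<delta> by linarith
  define S where "S = {z. norm z \<le> \<rho>0 \<and> (\<forall>h. W (z + h) \<le> W z + G z \<bullet> h + h \<bullet> Q h + (\<delta> / 8) * (norm h)\<^sup>2)}"
  have S: "compact S" unfolding S_def by (rule compact_contact_set[OF C Qlin])
  have S': "\<not> negligible S"
    unfolding S_def by (rule contact_set_nonnegligible[OF C W0 WQ Qlin Qsym]) (use \<rho>0 \<delta> in auto)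
  define \<epsilon> where "\<epsilon> = \<delta> / 16"
  have \<epsilon>: "\<epsilon> > 0" using \<delta> by (simp add: \<epsilon>_def)
  obtain z r \<Lambda> where zr: "\<And>k. z k \<in> S" "\<And>k. r k > 0" "r \<longlonglongrightarrow> 0" and \<Lambda>: "linear \<Lambda>"
    and ap: "\<And>\<eta>. \<eta> > 0 \<Longrightarrow> \<forall>\<^sub>F k in sequentially. \<forall>h\<in>cball 0 1.
      norm (G (z k + r k *\<^sub>R h) - G (z k) - r k *\<^sub>R \<Lambda> h) \<le> \<eta> * r k"
    using approx_differentiable[OF C11_gradient_lipschitz[OF C] S S'] by blast
  have "\<forall>\<^sub>F k in sequentially. r k < \<rho>0" using order_tendstoD(2)[OF zr(3) \<rho>0(1)] .
  then have "\<forall>\<^sub>F k in sequentially. r k < \<rho>0 \<and> (\<forall>h\<in>cball 0 1. norm (G (z k + r k *\<^sub>R h) - G (z k) - r k *\<^sub>R \<Lambda> h) \<le> \<epsilon> * r k)"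
    using ap[OF \<epsilon>] by eventually_elim auto
  then obtain k0 where k0: "r k0 < \<rho>0" "\<And>h. norm h \<le> 1 \<Longrightarrow> norm (G (z k0 + r k0 *\<^sub>R h) - G (z k0) - r k0 *\<^sub>R \<Lambda> h) \<le> \<epsilon> * r k0"
    using eventually_happens'[OF sequentially_bot] by (metis (no_types, lifting) mem_cball_0)
  define s where "s = r k0"
  have s: "s > 0" "s < \<rho>0" using zr k0 by (auto simp: s_def)
  obtain x0 y0 where z0: "z k0 = (x0, y0)" by (cases "z k0")
  have xy0: "norm x0 \<le> \<rho>0" "norm y0 \<le> \<rho>0"
    using zr(1)[of k0] norm_fst_le[of x0 y0] norm_snd_le[of y0 x0] unfolding S_def z0 by (auto intro: order_trans)
  \<comment> \<open>\<open>G\<close> acts on the two components separately, so the diagonal blocks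
    of \<Lambda> approximate the two gradients one by one.\<close>
  define A1 where "A1 h = fst (\<Lambda> (h, 0))" for h
  define A2 where "A2 k = snd (\<Lambda> (0, k))" for k
  have lin1: "linear A1" "linear A2"
  proof -
    have p1: "linear (\<lambda>h::'a. (h, 0::'a))" and p2: "linear (\<lambda>h::'a. (0::'a, h))" by (auto intro: linearI)
    have "linear (fst \<circ> (\<Lambda> \<circ> (\<lambda>h. (h, 0))))" "linear (snd \<circ> (\<Lambda> \<circ> (\<lambda>h. (0, h))))"
      by (intro linear_compose p1 p2 \<Lambda> linear_fst linear_snd)+
    moreover have "A1 = fst \<circ> (\<Lambda> \<circ> (\<lambda>h. (h, 0)))" "A2 = snd \<circ> (\<Lambda> \<circ> (\<lambda>h. (0, h)))"
      by (auto simp: A1_def A2_def)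
    ultimately show "linear A1" "linear A2" by simp_all
  qed
  have e1: "norm (g1 (x0 + h) - g1 x0 - A1 h) \<le> \<epsilon> * s" if "norm h \<le> s" for h
  proof -
    have "norm (G (z k0 + s *\<^sub>R (h /\<^sub>R s, 0)) - G (z k0) - s *\<^sub>R \<Lambda> (h /\<^sub>R s, 0)) \<le> \<epsilon> * s"
      unfolding s_def by (rule k0(2)) (use that s in \<open>simp add: s_def[symmetric] norm_Pair field_simps\<close>)
    moreover have "s *\<^sub>R \<Lambda> (h /\<^sub>R s, 0) = \<Lambda> (h, 0)"
      using s by (simp flip: linear_scale[OF \<Lambda>])
    ultimately have "norm (G (x0 + h, y0) - G (x0, y0) - \<Lambda> (h, 0)) \<le> \<epsilon> * s" using s by (simp add: z0)
    moreover have "norm (fst (G (x0 + h, y0) - G (x0, y0) - \<Lambda> (h, 0))) \<le> norm (G (x0 + h, y0) - G (x0, y0) - \<Lambda> (h, 0))"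
      by (metis norm_fst_le prod.collapse)
    ultimately show ?thesis by (simp add: G_def A1_def)
  qed
  have e2: "norm (g2 (y0 + h) - g2 y0 - A2 h) \<le> \<epsilon> * s" if "norm h \<le> s" for h
  proof -
    have "norm (G (z k0 + s *\<^sub>R (0, h /\<^sub>R s)) - G (z k0) - s *\<^sub>R \<Lambda> (0, h /\<^sub>R s)) \<le> \<epsilon> * s"
      unfolding s_def by (rule k0(2)) (use that s in \<open>simp add: s_def[symmetric] norm_Pair field_simps\<close>)
    moreover have "s *\<^sub>R \<Lambda> (0, h /\<^sub>R s) = \<Lambda> (0, h)"
      using s by (simp flip: linear_scale[OF \<Lambda>])
    ultimately have "norm (G (x0, y0 + h) - G (x0, y0) - \<Lambda> (0, h)) \<le> \<epsilon> * s" using s by (simp add: z0)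
    moreover have "norm (snd (G (x0, y0 + h) - G (x0, y0) - \<Lambda> (0, h))) \<le> norm (G (x0, y0 + h) - G (x0, y0) - \<Lambda> (0, h))"
      by (metis norm_snd_le prod.collapse)
    ultimately show ?thesis by (simp add: G_def A2_def)
  qed
  obtain X0 where X0: "linear X0" "\<And>h k. h \<bullet> X0 k = X0 h \<bullet> k" "\<And>h. h \<bullet> X0 h = h \<bullet> A1 h" using symmetric_part[OF lin1(1)] by blast
  obtain Y0 where Y0: "linear Y0" "\<And>h k. h \<bullet> Y0 k = Y0 h \<bullet> k" "\<And>h. h \<bullet> Y0 h = h \<bullet> A2 h" using symmetric_part[OF lin1(2)] by blast
  have taylor: "\<bar>U (x + h) - U x - g x \<bullet> h - (h \<bullet> A h) / 2\<bar> \<le> \<epsilon> * s * norm h"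
    if LL: "lasry_lions K u a b c U g" and A: "linear A" and e: "\<And>h. norm h \<le> s \<Longrightarrow> norm (g (x + h) - g x - A h) \<le> \<epsilon> * s"
      and h: "norm h \<le> s" for K u U g A x and h :: 'a
  proof (rule C11_taylor[OF C11[OF LL]])
    fix t :: real assume t: "0 \<le> t" "t \<le> 1"
    have "norm (t *\<^sub>R h) \<le> s" using t h mult_mono[of t 1 "norm h" s] s by simp
    from e[OF this] show "norm (g (x + t *\<^sub>R h) - g x - t *\<^sub>R A h) \<le> \<epsilon> * s" by (simp add: linear_scale[OF A])
  qed
  have t1: "\<bar>U1 (x0 + h) - U1 x0 - g1 x0 \<bullet> h - (h \<bullet> X0 h) / 2\<bar> \<le> \<epsilon> * s * norm h" if "norm h \<le> s" for h
    using taylor[OF LL1 lin1(1) e1 that] by (simp add: X0(3))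
  have t2: "\<bar>U2 (y0 + h) - U2 y0 - g2 y0 \<bullet> h - (h \<bullet> Y0 h) / 2\<bar> \<le> \<epsilon> * s * norm h" if "norm h \<le> s" for h
    using taylor[OF LL2 lin1(2) e2 that] by (simp add: Y0(3))
  \<comment> \<open>The contact inequality and the Taylor expansions are compared at the single
    radius \<open>s\<close>, which suffices because both sides are homogeneous of degree two. The
    tolerance is \<open>\<delta> / 8\<close> from the contact set plus twice
    \<open>\<epsilon> = \<delta> / 16\<close>.\<close>
  have upper0: "(h \<bullet> X0 h + k \<bullet> Y0 k) / 2 \<le> q h k + (\<delta> / 4) * ((norm h)\<^sup>2 + (norm k)\<^sup>2)" for h k
  proof (cases "h = 0 \<and> k = 0")
    case True then show ?thesis by (simp add: q_def)
  next
    case False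
    define n where "n = norm (h, k)"
    have n: "n > 0" using False by (auto simp: n_def norm_Pair zero_less_norm_iff sum_power2_gt_zero_iff)
    define t where "t = s / n"
    have t: "t > 0" using s n by (simp add: t_def)
    have hk: "norm (t *\<^sub>R h) \<le> s" "norm (t *\<^sub>R k) \<le> s"
      using s n norm_fst_le[of h k] norm_snd_le[of k h] by (auto simp: t_def n_def[symmetric] field_simps)
    have n2: "t\<^sup>2 * ((norm h)\<^sup>2 + (norm k)\<^sup>2) = s\<^sup>2"
    proof -
      have "t\<^sup>2 * n\<^sup>2 = s\<^sup>2" using n by (simp add: t_def power_divide)
      then show ?thesis using normz[of "(h, k)"] by (simp add: n_def)
    qed
    have "W (z k0 + (t *\<^sub>R h, t *\<^sub>R k)) \<le> W (z k0) + G (z k0) \<bullet> (t *\<^sub>R h, t *\<^sub>R k)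
        + (t *\<^sub>R h, t *\<^sub>R k) \<bullet> Q (t *\<^sub>R h, t *\<^sub>R k) + (\<delta> / 8) * (norm (t *\<^sub>R h, t *\<^sub>R k))\<^sup>2"
      using zr(1)[of k0] unfolding S_def by blast
    then have "U1 (x0 + t *\<^sub>R h) + U2 (y0 + t *\<^sub>R k) \<le> U1 x0 + U2 y0 + g1 x0 \<bullet> (t *\<^sub>R h) + g2 y0 \<bullet> (t *\<^sub>R k)
        + q (t *\<^sub>R h) (t *\<^sub>R k) + (\<delta> / 8) * ((norm (t *\<^sub>R h))\<^sup>2 + (norm (t *\<^sub>R k))\<^sup>2)"
      unfolding Qq normz by (simp add: W_def G_def z0)
    moreover have "q (t *\<^sub>R h) (t *\<^sub>R k) = t\<^sup>2 * q h k"
      by (simp add: q_def power_mult_distrib algebra_simps flip: scaleR_diff_right)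
    moreover have "(norm (t *\<^sub>R h))\<^sup>2 + (norm (t *\<^sub>R k))\<^sup>2 = s\<^sup>2"
      unfolding n2[symmetric] by (simp add: power_mult_distrib distrib_left)
    then have "(\<delta> / 8) * ((norm (t *\<^sub>R h))\<^sup>2 + (norm (t *\<^sub>R k))\<^sup>2) = \<delta> / 8 * s\<^sup>2" by simp
    moreover have "(t *\<^sub>R h) \<bullet> X0 (t *\<^sub>R h) = t\<^sup>2 * (h \<bullet> X0 h)" "(t *\<^sub>R k) \<bullet> Y0 (t *\<^sub>R k) = t\<^sup>2 * (k \<bullet> Y0 k)"
      by (simp_all add: linear_scale[OF X0(1)] linear_scale[OF Y0(1)] power2_eq_square)
    moreover have "\<epsilon> * s * norm (t *\<^sub>R h) \<le> \<epsilon> * s\<^sup>2" "\<epsilon> * s * norm (t *\<^sub>R k) \<le> \<epsilon> * s\<^sup>2"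
      using hk s \<epsilon> by (auto simp: power2_eq_square mult.assoc)
    ultimately have "t\<^sup>2 * (h \<bullet> X0 h) / 2 + t\<^sup>2 * (k \<bullet> Y0 k) / 2 \<le> t\<^sup>2 * q h k + \<delta> / 8 * s\<^sup>2 + 2 * (\<epsilon> * s\<^sup>2)"
      using t1[OF hk(1), THEN abs_le_D2] t2[OF hk(2), THEN abs_le_D2] by linarith
    also have "\<dots> = t\<^sup>2 * (q h k + (\<delta> / 4) * ((norm h)\<^sup>2 + (norm k)\<^sup>2))"
      unfolding n2[symmetric] \<epsilon>_def by (simp add: algebra_simps)
    finally have "t\<^sup>2 * ((h \<bullet> X0 h + k \<bullet> Y0 k) / 2) \<le> t\<^sup>2 * (q h k + (\<delta> / 4) * ((norm h)\<^sup>2 + (norm k)\<^sup>2))"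
      by (simp add: distrib_left add_divide_distrib)
    then show ?thesis using t by (simp only: mult_le_cancel_left_pos zero_less_power)
  qed
  \<comment> \<open>On the sphere of radius \<open>s\<close> the added term contributes
    \<open>\<delta>' * s\<^sup>2\<close>, twice the Taylor error
    \<open>\<epsilon> * s\<^sup>2\<close>; this is the strictness that
    \<open>touch_from_approximate_expansion\<close> requires.\<close>
  define \<delta>' where "\<delta>' = \<delta> / 8"
  define X where "X h = X0 h + (2 * \<delta>') *\<^sub>R h" for h
  define Y where "Y h = Y0 h + (2 * \<delta>') *\<^sub>R h" for h
  have lX: "linear X" "linear Y" unfolding X_def Y_def
    by (intro linear_compose_add X0(1) Y0(1) linear_compose_scale_right linear_ident)+
  have sX: "h \<bullet> X k = X h \<bullet> k" "h \<bullet> Y k = Y h \<bullet> k" for h k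
    using X0(2)[of h k] Y0(2)[of h k] by (simp_all add: X_def Y_def inner_add_left inner_add_right)
  have qX: "h \<bullet> X h = h \<bullet> X0 h + 2 * \<delta>' * (norm h)\<^sup>2" "h \<bullet> Y h = h \<bullet> Y0 h + 2 * \<delta>' * (norm h)\<^sup>2" for h
    by (simp_all add: X_def Y_def inner_add_right power2_norm_eq_inner)
  have upper: "h \<bullet> X h + k \<bullet> Y k \<le> 2 * b1 * (norm (h - k))\<^sup>2 + (2 * b2 + \<delta>) * ((norm h)\<^sup>2 + (norm k)\<^sup>2)" for h k
    using upper0[of h k] mult_nonneg_nonneg[OF less_imp_le[OF \<delta>] zero_le_power2[of "norm h"]]
      mult_nonneg_nonneg[OF less_imp_le[OF \<delta>] zero_le_power2[of "norm k"]]
    unfolding qX q_def \<delta>'_def by (simp add: algebra_simps)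
  have X_up: "(h \<bullet> X h) / 2 \<le> (b1 + b2 + \<delta> / 2) * (norm h)\<^sup>2" "(h \<bullet> Y h) / 2 \<le> (b1 + b2 + \<delta> / 2) * (norm h)\<^sup>2" for h
    using upper[of h 0] upper[of 0 h] by (simp_all add: linear_0[OF lX(1)] linear_0[OF lX(2)] algebra_simps)
  have b'b: "b1 + b2 + \<delta> / 2 < b" using b12 \<delta> by (simp add: b_def a_def)
  \<comment> \<open>The semiconvexity constant \<open>c \<le> 2 * a\<close> is read off at radius
    \<open>s\<close>; the added multiple of the identity outweighs the Taylor error.\<close>
  have low0: "- (4 * a) * (norm h)\<^sup>2 \<le> h \<bullet> (A h + (2 * \<delta>') *\<^sub>R h)"
    if LL: "lasry_lions K u a b c U g" and A: "linear A"
      and t: "\<And>h. norm h \<le> s \<Longrightarrow> \<bar>U (x + h) - U x - g x \<bullet> h - (h \<bullet> A h) / 2\<bar> \<le> \<epsilon> * s * norm h" for K u U g A x and h :: 'a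
  proof (cases "h = 0")
    case False
    define t where "t = s / norm h"
    have t0: "t > 0" using s False by (simp add: t_def)
    have nt: "norm (t *\<^sub>R h) = s" using False s by (simp add: t_def)
    have f1: "U (x + t *\<^sub>R h) \<ge> U x + g x \<bullet> (t *\<^sub>R h) - c * s\<^sup>2"
      using LL unfolding lasry_lions_def nt[symmetric] by blast
    have f2: "U (x + t *\<^sub>R h) - U x - g x \<bullet> (t *\<^sub>R h) - ((t *\<^sub>R h) \<bullet> A (t *\<^sub>R h)) / 2 \<le> \<epsilon> * s\<^sup>2"
      using abs_le_D1[OF t[of "t *\<^sub>R h"]] unfolding nt by (simp add: power2_eq_square)
    have f3: "(t *\<^sub>R h) \<bullet> A (t *\<^sub>R h) = t\<^sup>2 * (h \<bullet> A h)" by (simp add: linear_scale[OF A] power2_eq_square)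
    have "- 2 * (c * s\<^sup>2) - 2 * (\<epsilon> * s\<^sup>2) \<le> t\<^sup>2 * (h \<bullet> A h)" using f1 f2 unfolding f3 by linarith
    moreover have "s\<^sup>2 = t\<^sup>2 * (norm h)\<^sup>2" unfolding nt[symmetric] by (simp add: power_mult_distrib)
    ultimately have "t\<^sup>2 * (- 2 * (c + \<epsilon>) * (norm h)\<^sup>2) \<le> t\<^sup>2 * (h \<bullet> A h)" by (simp add: algebra_simps)
    then have 1: "- 2 * (c + \<epsilon>) * (norm h)\<^sup>2 \<le> h \<bullet> A h" using t0 by (simp only: mult_le_cancel_left_pos zero_less_power)
    have "(- (4 * a)) * (norm h)\<^sup>2 \<le> (- 2 * (c + \<epsilon>) + 2 * \<delta>') * (norm h)\<^sup>2"
      using c2 \<delta> by (intro mult_right_mono) (auto simp: \<epsilon>_def \<delta>'_def)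
    then show ?thesis using 1 by (simp add: inner_add_right power2_norm_eq_inner algebra_simps)
  qed (simp add: linear_0[OF A])
  have lower: "- (8 * b1 + 4 * b2) * ((norm h)\<^sup>2 + (norm k)\<^sup>2) \<le> h \<bullet> X h + k \<bullet> Y k" for h k
    using low0[OF LL1 X0(1) t1, of h] low0[OF LL2 Y0(1) t2, of k] unfolding X_def Y_def a_def
    by (simp add: algebra_simps)
  have bdry1: "U1 (x0 + h) < U1 x0 + g1 x0 \<bullet> h + (h \<bullet> X h) / 2"
    and bdry2: "U2 (y0 + h) < U2 y0 + g2 y0 \<bullet> h + (h \<bullet> Y h) / 2" if h: "norm h = s" for h
  proof -
    have "\<epsilon> * s * s < \<delta>' * s\<^sup>2" using s \<delta> by (simp add: \<epsilon>_def \<delta>'_def power2_eq_square)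
    moreover have "(h \<bullet> X h) / 2 = (h \<bullet> X0 h) / 2 + \<delta>' * s\<^sup>2" "(h \<bullet> Y h) / 2 = (h \<bullet> Y0 h) / 2 + \<delta>' * s\<^sup>2"
      unfolding qX h by auto
    moreover have "U1 (x0 + h) - U1 x0 - g1 x0 \<bullet> h - (h \<bullet> X0 h) / 2 \<le> \<epsilon> * s * s"
      "U2 (y0 + h) - U2 y0 - g2 y0 \<bullet> h - (h \<bullet> Y0 h) / 2 \<le> \<epsilon> * s * s"
      using t1[of h] t2[of h] h by auto
    ultimately show "U1 (x0 + h) < U1 x0 + g1 x0 \<bullet> h + (h \<bullet> X h) / 2" "U2 (y0 + h) < U2 y0 + g2 y0 \<bullet> h + (h \<bullet> Y h) / 2"
      by linarith+
  qed
  obtain x1 \<rho>1 where x1: "norm (x1 - x0) < s" "\<rho>1 > 0" "x1 + (1 / (2 * c)) *\<^sub>R g1 x1 \<in> K1"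
    "u1 (x1 + (1 / (2 * c)) *\<^sub>R g1 x1) = U1 x1 + (norm (g1 x1))\<^sup>2 / (4 * c)"
    and T1: "\<And>\<eta>. \<eta> \<in> K1 \<Longrightarrow> norm (\<eta> - (x1 + (1 / (2 * c)) *\<^sub>R g1 x1)) < \<rho>1 \<Longrightarrow>
      u1 \<eta> \<le> u1 (x1 + (1 / (2 * c)) *\<^sub>R g1 x1) + g1 x1 \<bullet> (\<eta> - (x1 + (1 / (2 * c)) *\<^sub>R g1 x1))
        + ((\<eta> - (x1 + (1 / (2 * c)) *\<^sub>R g1 x1)) \<bullet> X (\<eta> - (x1 + (1 / (2 * c)) *\<^sub>R g1 x1))) / 2"
    using touch_from_approximate_expansion[OF LL1 c lX(1) sX(1) X_up(1) b'b s(1) bdry1] by blast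
  obtain y1 \<rho>2 where y1: "norm (y1 - y0) < s" "\<rho>2 > 0" "y1 + (1 / (2 * c)) *\<^sub>R g2 y1 \<in> K2"
    "u2 (y1 + (1 / (2 * c)) *\<^sub>R g2 y1) = U2 y1 + (norm (g2 y1))\<^sup>2 / (4 * c)"
    and T2: "\<And>\<eta>. \<eta> \<in> K2 \<Longrightarrow> norm (\<eta> - (y1 + (1 / (2 * c)) *\<^sub>R g2 y1)) < \<rho>2 \<Longrightarrow>
      u2 \<eta> \<le> u2 (y1 + (1 / (2 * c)) *\<^sub>R g2 y1) + g2 y1 \<bullet> (\<eta> - (y1 + (1 / (2 * c)) *\<^sub>R g2 y1))
        + ((\<eta> - (y1 + (1 / (2 * c)) *\<^sub>R g2 y1)) \<bullet> Y (\<eta> - (y1 + (1 / (2 * c)) *\<^sub>R g2 y1))) / 2"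
    using touch_from_approximate_expansion[OF LL2 c lX(2) sX(2) X_up(2) b'b s(1) bdry2] by blast
  have bounds: "norm p < \<delta>" "norm (x + (1 / (2 * c)) *\<^sub>R p) < \<delta>" "\<bar>U + (norm p)\<^sup>2 / (4 * c)\<bar> < \<delta>"
    if x: "norm (x - x') < s" "norm x' \<le> \<rho>0" and p: "norm p \<le> 6 * b * norm x" and U: "\<bar>U\<bar> \<le> b * (norm x)\<^sup>2"
    for x x' p :: 'a and U
  proof -
    have nx: "norm x \<le> 2 * \<rho>0" using x s norm_triangle_ineq2[of x x'] by simp
    have "norm x * M \<le> 2 * \<rho>0 * M" using nx M by (intro mult_right_mono) auto
    then have MM: "norm x * M < \<delta>" using \<rho>0M by linarith
    have "6 * b * norm x \<le> M * norm x" using M by (intro mult_right_mono) auto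
    then show "norm p < \<delta>" using p MM by (simp add: mult.commute)
    have "norm (x + (1 / (2 * c)) *\<^sub>R p) \<le> norm x + norm p / (2 * c)"
      using norm_triangle_ineq[of x "(1 / (2 * c)) *\<^sub>R p"] c by simp
    also have "\<dots> \<le> norm x + (6 * b * norm x) / (2 * c)" using p c by (intro add_left_mono divide_right_mono) auto
    also have "\<dots> = (1 + 3 * b / c) * norm x" using c by (simp add: field_simps)
    also have "\<dots> \<le> M * norm x" using M by (intro mult_right_mono) auto
    finally show "norm (x + (1 / (2 * c)) *\<^sub>R p) < \<delta>" using MM by (simp add: mult.commute)
    have "(norm p)\<^sup>2 \<le> (6 * b * norm x)\<^sup>2" using p by (intro power_mono) auto
    then have "(norm p)\<^sup>2 / (4 * c) \<le> (6 * b * norm x)\<^sup>2 / (4 * c)" using c by (intro divide_right_mono) auto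
    also have "\<dots> = 9 * b\<^sup>2 / c * (norm x)\<^sup>2" using c by (simp add: power_mult_distrib field_simps)
    finally have P: "(norm p)\<^sup>2 / (4 * c) \<le> 9 * b\<^sup>2 / c * (norm x)\<^sup>2" .
    have "0 \<le> (norm p)\<^sup>2 / (4 * c)" using c by simp
    then have "\<bar>U + (norm p)\<^sup>2 / (4 * c)\<bar> \<le> b * (norm x)\<^sup>2 + 9 * b\<^sup>2 / c * (norm x)\<^sup>2"
      using U P by linarith
    also have "\<dots> = (b + 9 * b\<^sup>2 / c) * (norm x)\<^sup>2" by (simp add: distrib_right)
    also have "\<dots> \<le> M * (norm x)\<^sup>2" using M by (intro mult_right_mono) auto
    also have "\<dots> \<le> M * norm x"
      using nx \<rho>0 M by (intro mult_left_mono) (auto simp: power2_eq_square mult_left_le_one_le)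
    finally show "\<bar>U + (norm p)\<^sup>2 / (4 * c)\<bar> < \<delta>" using MM by (simp add: mult.commute)
  qed
  note B1 = bounds[OF x1(1) xy0(1) gb(1) Ub(1)] and B2 = bounds[OF y1(1) xy0(2) gb(2) Ub(2)]
  show ?thesis
  proof (rule that[OF x1(3) y1(3) B1(2) B2(2) B1(1) B2(1) _ _ lX(1) sX(1) lX(2) sX(2) _ _ _ upper lower])
    show "\<bar>u1 (x1 + (1 / (2 * c)) *\<^sub>R g1 x1)\<bar> < \<delta>" using B1(3) x1(4) by simp
    show "\<bar>u2 (y1 + (1 / (2 * c)) *\<^sub>R g2 y1)\<bar> < \<delta>" using B2(3) y1(4) by simp
    show "min \<rho>1 \<rho>2 > 0" using x1 y1 by simp
  qed (use T1 T2 in auto)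
qed

section \<open>Quadratic test functions\<close>

lemma symmetric_matrix_inner:
  fixes X :: "real^'n^'n"
  assumes "X \<in> sym_mats"
  shows "x \<bullet> (X *v y) = (X *v x) \<bullet> y"
proof -
  have "X *v x = x v* X" using assms transpose_matrix_vector[of X x] by (simp add: sym_mats_def)
  then show ?thesis by (simp add: dot_lmul_matrix)
qed

lemma Ck_const: "Ck k (\<lambda>x. c)"
proof (induction k arbitrary: c)
  case (Suc k)
  have "frechet_derivative (\<lambda>x::'a. c) (at x) = (\<lambda>_. 0)" for x
    by (rule frechet_derivative_at[symmetric]) auto
  then show ?case using Suc by simp
qed simp

lemma Ck_affine: "Ck k (\<lambda>x. c + q \<bullet> x)"
proof (cases k)
  case (Suc l)
  have D: "((\<lambda>x. c + q \<bullet> x) has_derivative (\<lambda>h. q \<bullet> h)) (at x)" for x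
    by (auto intro!: derivative_eq_intros)
  then have "frechet_derivative (\<lambda>x. c + q \<bullet> x) (at x) = (\<lambda>h. q \<bullet> h)" for x
    by (rule frechet_derivative_at[symmetric])
  then show ?thesis using Suc D Ck_const by (auto simp: differentiable_def)
qed (auto intro!: continuous_intros)

definition quadratic :: "real \<Rightarrow> real^'n \<Rightarrow> real^'n^'n \<Rightarrow> real^'n \<Rightarrow> real^'n \<Rightarrow> real" where
  "quadratic c p X a x = c + p \<bullet> (x - a) + ((x - a) \<bullet> (X *v (x - a))) / 2"

lemma quadratic_has_derivative:
  assumes "X \<in> sym_mats"
  shows "(quadratic c p X a has_derivative (\<lambda>h. (p + X *v (x - a)) \<bullet> h)) (at x)"
proof -
  have "((\<lambda>x. c + p \<bullet> (x - a) + ((x - a) \<bullet> (X *v (x - a))) / 2) has_derivative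
    (\<lambda>h. p \<bullet> h + ((x - a) \<bullet> (X *v h) + h \<bullet> (X *v (x - a))) / 2)) (at x)"
    by (auto intro!: derivative_eq_intros bounded_linear.has_derivative[OF matrix_vector_mul_bounded_linear])
  moreover have "p \<bullet> h + ((x - a) \<bullet> (X *v h) + h \<bullet> (X *v (x - a))) / 2 = (p + X *v (x - a)) \<bullet> h" for h
    using symmetric_matrix_inner[OF assms, of "x - a" h] by (simp add: inner_add_left inner_add_right inner_commute)
  ultimately show ?thesis by (simp add: quadratic_def[abs_def])
qed

lemma quadratic_test_function:
  assumes X: "X \<in> sym_mats"
  shows "smooth (quadratic c p X a)" "grad (quadratic c p X a) x = p + X *v (x - a)"
    "hessian (quadratic c p X a) x = X"
proof -
  have D: "frechet_derivative (quadratic c p X a) (at x) = (\<lambda>h. (p + X *v (x - a)) \<bullet> h)" for x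
    by (rule frechet_derivative_at[symmetric]) (rule quadratic_has_derivative[OF X])
  have "Ck k (quadratic c p X a)" for k
  proof (cases k)
    case 0
    then show ?thesis
      using quadratic_has_derivative[OF X] by (auto intro!: continuous_at_imp_continuous_on has_derivative_continuous)
  next
    case (Suc l)
    \<comment> \<open>Written in this way, the directional derivatives of a quadratic are affine,
      and \<open>Ck_affine\<close> covers all orders.\<close>
    have eq: "(p + X *v (x - a)) \<bullet> v = (p \<bullet> v - (X *v a) \<bullet> v) + (X *v v) \<bullet> x" for x v
      using symmetric_matrix_inner[OF X, of x v]
      by (simp add: inner_add_left inner_diff_left inner_add_right inner_diff_right matrix_vector_mult_diff_distrib inner_commute)
    have "Ck l (\<lambda>x. (p + X *v (x - a)) \<bullet> v)" for v
      unfolding eq by (rule Ck_affine)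
    then show ?thesis using Suc D quadratic_has_derivative[OF X, of c p a] by (auto simp: differentiable_def)
  qed
  then show "smooth (quadratic c p X a)" by (simp add: smooth_def)
  have g: "grad (quadratic c p X a) = (\<lambda>x. p + X *v (x - a))"
    by (simp add: grad_def D fun_eq_iff vec_eq_iff inner_axis)
  then show "grad (quadratic c p X a) x = p + X *v (x - a)" by simp
  have "((\<lambda>x. p + X *v (x - a)) has_derivative (\<lambda>h. X *v h)) (at x)"
    by (auto intro!: derivative_eq_intros bounded_linear.has_derivative[OF matrix_vector_mul_bounded_linear])
  then have "frechet_derivative (\<lambda>x. p + X *v (x - a)) (at x) = (\<lambda>h. X *v h)"
    by (rule frechet_derivative_at[symmetric])
  then show "hessian (quadratic c p X a) x = X"
    by (simp add: hessian_def g)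
qed

lemma subsolution_quadratic:
  assumes sub: "dirichlet_subsolution \<Omega> F g u" and x0: "x0 \<in> closure \<Omega>" and X: "X \<in> sym_mats"
    and "\<rho> > 0"
    and touch: "\<And>y. y \<in> closure \<Omega> \<Longrightarrow> norm (y - x0) < \<rho> \<Longrightarrow>
      u y \<le> u x0 + p \<bullet> (y - x0) + ((y - x0) \<bullet> (X *v (y - x0))) / 2"
  shows "x0 \<in> \<Omega> \<Longrightarrow> F X p (u x0) x0 \<le> 0"
    and "x0 \<in> frontier \<Omega> \<Longrightarrow> g x0 < u x0 \<Longrightarrow> F X p (u x0) x0 \<le> 0"
proof -
  have "local_max_on (closure \<Omega>) (\<lambda>x. u x - quadratic (u x0) p X x0 x) x0"
    unfolding local_max_on_def
    by (intro conjI x0 exI[of _ \<rho>] \<open>\<rho> > 0\<close>)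
      (use touch in \<open>force simp: quadratic_def dist_norm norm_minus_commute\<close>)
  with sub quadratic_test_function(1)[OF X]
  have "(x0 \<in> \<Omega> \<longrightarrow> F (hessian (quadratic (u x0) p X x0) x0) (grad (quadratic (u x0) p X x0) x0) (u x0) x0 \<le> 0) \<and>
      (x0 \<in> frontier \<Omega> \<longrightarrow> min (F (hessian (quadratic (u x0) p X x0) x0) (grad (quadratic (u x0) p X x0) x0) (u x0) x0) (u x0 - g x0) \<le> 0)"
    unfolding dirichlet_subsolution_def by blast
  then have "(x0 \<in> \<Omega> \<longrightarrow> F X p (u x0) x0 \<le> 0) \<and> (x0 \<in> frontier \<Omega> \<longrightarrow> min (F X p (u x0) x0) (u x0 - g x0) \<le> 0)"
    by (simp add: quadratic_test_function(2,3)[OF X])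
  then show "x0 \<in> \<Omega> \<Longrightarrow> F X p (u x0) x0 \<le> 0" "x0 \<in> frontier \<Omega> \<Longrightarrow> g x0 < u x0 \<Longrightarrow> F X p (u x0) x0 \<le> 0"
    by (auto simp: min_le_iff_disj)
qed

lemma supersolution_quadratic:
  assumes sup: "dirichlet_supersolution \<Omega> F g v" and x0: "x0 \<in> closure \<Omega>" and X: "X \<in> sym_mats"
    and "\<rho> > 0"
    and touch: "\<And>y. y \<in> closure \<Omega> \<Longrightarrow> norm (y - x0) < \<rho> \<Longrightarrow>
      v x0 + p \<bullet> (y - x0) + ((y - x0) \<bullet> (X *v (y - x0))) / 2 \<le> v y"
  shows "x0 \<in> \<Omega> \<Longrightarrow> F X p (v x0) x0 \<ge> 0"
    and "x0 \<in> frontier \<Omega> \<Longrightarrow> v x0 < g x0 \<Longrightarrow> F X p (v x0) x0 \<ge> 0"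
proof -
  have "local_min_on (closure \<Omega>) (\<lambda>x. v x - quadratic (v x0) p X x0 x) x0"
    unfolding local_min_on_def
    by (intro conjI x0 exI[of _ \<rho>] \<open>\<rho> > 0\<close>)
      (use touch in \<open>force simp: quadratic_def dist_norm norm_minus_commute\<close>)
  with sup quadratic_test_function(1)[OF X]
  have "(x0 \<in> \<Omega> \<longrightarrow> F (hessian (quadratic (v x0) p X x0) x0) (grad (quadratic (v x0) p X x0) x0) (v x0) x0 \<ge> 0) \<and>
      (x0 \<in> frontier \<Omega> \<longrightarrow> max (F (hessian (quadratic (v x0) p X x0) x0) (grad (quadratic (v x0) p X x0) x0) (v x0) x0) (v x0 - g x0) \<ge> 0)"
    unfolding dirichlet_supersolution_def by blast
  then have "(x0 \<in> \<Omega> \<longrightarrow> F X p (v x0) x0 \<ge> 0) \<and> (x0 \<in> frontier \<Omega> \<longrightarrow> max (F X p (v x0) x0) (v x0 - g x0) \<ge> 0)"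
    by (simp add: quadratic_test_function(2,3)[OF X])
  then show "x0 \<in> \<Omega> \<Longrightarrow> F X p (v x0) x0 \<ge> 0" "x0 \<in> frontier \<Omega> \<Longrightarrow> v x0 < g x0 \<Longrightarrow> F X p (v x0) x0 \<ge> 0"
    by (auto simp: le_max_iff_disj)
qed

lemma scalar_matrix_vector: "(H *\<^sub>R mat 1) *v x = H *\<^sub>R (x :: real^'n)"
  by (metis matrix_vector_mul_lid scaleR_matrix_vector_assoc)

lemma scalar_sym_mats: "H *\<^sub>R mat 1 \<in> sym_mats"
  by (simp add: sym_mats_def vec_eq_iff transpose_def mat_def)

text \<open>Positive homogeneity reduces \<open>G\<close> on multiples of the identity to the single
  number \<open>G (mat 1)\<close>. Barriers are accordingly touched by quadratics with scalar
  Hessian, at the price of overestimating their curvature.\<close>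

lemma H4'_scalar_hessian:
  fixes F :: "'n::finite nonlinearity"
  assumes "H4' m \<Omega> F" "R > 0"
  shows "\<exists>K1>0. \<exists>K2>0. \<exists>\<Gamma>\<ge>0. \<forall>p s H. \<forall>x\<in>closure \<Omega>. \<bar>s\<bar> \<le> R \<longrightarrow> 0 < H \<longrightarrow>
    F (H *\<^sub>R mat 1) p s x \<le> 0 \<longrightarrow> K1 * norm p powr m \<le> K2 + \<Gamma> * H"
proof -
  obtain K1 K2 G where K: "K1 > 0" "K2 > 0" and G: "homogeneous1 G"
    and le: "\<And>M p s x. M \<in> sym_mats \<Longrightarrow> x \<in> closure \<Omega> \<Longrightarrow> \<bar>s\<bar> \<le> R \<Longrightarrow> F M p s x \<le> 0 \<Longrightarrow>
      G M + K1 * norm p powr m - K2 \<le> 0"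
  proof -
    have "\<exists>K1>0. \<exists>K2>0. \<exists>G. (\<exists>L. L-lipschitz_on sym_mats G) \<and> elliptic_op G \<and> homogeneous1 G \<and>
        (\<forall>M\<in>sym_mats. \<forall>p s. \<forall>x\<in>closure \<Omega>. \<bar>s\<bar> \<le> R \<longrightarrow> F M p s x \<le> 0 \<longrightarrow> G M + K1 * norm p powr m - K2 \<le> 0)"
      using assms unfolding H4'_def by simp
    then obtain K1 K2 G where *: "K1 > 0" "K2 > 0" "homogeneous1 G"
      "\<forall>M\<in>sym_mats. \<forall>p s. \<forall>x\<in>closure \<Omega>. \<bar>s\<bar> \<le> R \<longrightarrow> F M p s x \<le> 0 \<longrightarrow> G M + K1 * norm p powr m - K2 \<le> 0"
      by (elim exE conjE) (rule that)
    show thesis by (rule that[of K1 K2 G]) (use * in auto)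
  qed
  define \<Gamma> where "\<Gamma> = \<bar>G (mat 1)\<bar>"
  have "K1 * norm p powr m \<le> K2 + \<Gamma> * H" if "x \<in> closure \<Omega>" "\<bar>s\<bar> \<le> R" "0 < H" "F (H *\<^sub>R mat 1) p s x \<le> 0" for p s H x
  proof -
    have "G (H *\<^sub>R mat 1) = H * G (mat 1)"
    proof -
      have "mat 1 \<in> (sym_mats :: (real^'n^'n) set)" using scalar_sym_mats[of 1] by simp
      then show ?thesis using G that(3) by (simp add: homogeneous1_def)
    qed
    moreover have "- (\<Gamma> * H) \<le> H * G (mat 1)"
      using that(3) mult_left_mono[of "- \<Gamma>" "G (mat 1)" H] by (simp add: \<Gamma>_def mult.commute)
    ultimately show ?thesis using le[OF scalar_sym_mats that(1,2,4)] by linarith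
  qed
  then show ?thesis using K by (intro exI[of _ K1] exI[of _ K2] exI[of _ \<Gamma>] conjI) (auto simp: \<Gamma>_def)
qed

section \<open>The interior Hoelder estimate\<close>

text \<open>The weighted arithmetic-geometric mean inequality, from convexity of \<open>exp\<close>.
  It lets the concave part of the barrier enter without any second-order term.\<close>

lemma powr_le_tangent:
  fixes s t \<beta> :: real
  assumes "0 < s" "0 < t" "0 \<le> \<beta>" "\<beta> \<le> 1"
  shows "t powr \<beta> \<le> s powr \<beta> + \<beta> * s powr (\<beta> - 1) * (t - s)"
proof -
  have "exp ((1 - \<beta>) *\<^sub>R 0 + \<beta> *\<^sub>R ln (t / s)) \<le> (1 - \<beta>) * exp 0 + \<beta> * exp (ln (t / s))"
    by (rule convex_onD[OF exp_convex]) (use assms in auto)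
  then have "(t / s) powr \<beta> \<le> (1 - \<beta>) + \<beta> * (t / s)"
    using assms by (simp add: powr_def)
  then have "s powr \<beta> * (t / s) powr \<beta> \<le> s powr \<beta> * ((1 - \<beta>) + \<beta> * (t / s))"
    by (intro mult_left_mono) auto
  moreover have "s powr \<beta> * (t / s) powr \<beta> = t powr \<beta>" using assms by (simp add: powr_divide)
  moreover have "s powr \<beta> * ((1 - \<beta>) + \<beta> * (t / s)) = s powr \<beta> + \<beta> * s powr (\<beta> - 1) * (t - s)"
    using assms by (simp add: powr_diff field_simps)
  ultimately show ?thesis by simp
qed

lemma inverse_quadratic_bound:
  fixes \<theta> d :: real
  assumes "\<theta> > 0" "d \<le> \<theta> / 2"
  shows "1 / (\<theta> - d) \<le> 1 / \<theta> + d / \<theta>\<^sup>2 + 2 * d\<^sup>2 / \<theta>^3"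
proof -
  have p: "\<theta> - d > 0" using assms by simp
  have "1 / (\<theta> - d) = 1 / \<theta> + d / \<theta>\<^sup>2 + d\<^sup>2 / (\<theta>\<^sup>2 * (\<theta> - d))"
    using p assms(1) by (simp add: divide_simps power2_eq_square) (simp add: algebra_simps)
  also have "d\<^sup>2 / (\<theta>\<^sup>2 * (\<theta> - d)) \<le> d\<^sup>2 / (\<theta>\<^sup>2 * (\<theta> / 2))"
    using assms p by (intro divide_left_mono mult_left_mono) auto
  also have "d\<^sup>2 / (\<theta>\<^sup>2 * (\<theta> / 2)) = 2 * d\<^sup>2 / \<theta>^3" using assms(1) by (simp add: power2_eq_square power3_eq_cube)
  finally show ?thesis by simp
qed

text \<open>The barrier is \<open>C r\<^sup>\<alpha> (\<sigma>\<^sup>\<alpha> + \<sigma>\<^sup>2 / (1 - \<sigma>\<^sup>2))\<close> with \<open>\<sigma> = |y - x| / r\<close>. Its gradient term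
  beats its Hessian also near the sphere, where it blows up: this is the effect of \<open>m > 2\<close>, and it makes
  \<open>C\<close> independent of \<open>r\<close> and of the size of \<open>u\<close>.\<close>

lemma barrier_strict:
  fixes K1 K2 \<Gamma> m \<alpha> C \<sigma> r :: real
  assumes K: "K1 > 0" "K2 > 0" "\<Gamma> \<ge> 0" and \<alpha>: "0 < \<alpha>" "\<alpha> < 1" and m: "m > 2" "m * (1 - \<alpha>) = 2 - \<alpha>"
    and C: "C = 1 + 4 * (K2 + 38 * \<Gamma>) / (K1 * \<alpha> powr m)"
    and \<sigma>: "0 < \<sigma>" "\<sigma> < 1" and r: "0 < r" "r \<le> 1"
  defines "\<theta> \<equiv> 1 - \<sigma>\<^sup>2"
  defines "d \<equiv> \<alpha> / 2 * \<sigma> powr (\<alpha> - 2) + 1 / \<theta>\<^sup>2"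
  shows "K2 + \<Gamma> * (2 * r powr (\<alpha> - 2) * C * (d + 18 * \<sigma>\<^sup>2 / \<theta>^3)) < K1 * (2 * r powr (\<alpha> - 1) * \<sigma> * C * d) powr m"
proof -
  define A where "A = \<sigma> powr (\<alpha> - 2)"
  \<comment> \<open>\<open>B\<close> measures the Hessian of the barrier: the first term governs
    near the centre, the second near the sphere.\<close>
  define B where "B = A + 1 / \<theta>^3"
  have \<alpha>m: "\<alpha> powr m > 0" using \<alpha> by simp
  have C1: "C \<ge> 1" using K \<alpha>m by (simp add: C)
  have \<sigma>2: "\<sigma>\<^sup>2 < 1" using \<sigma> by (simp add: power_less_one_iff abs_square_less_1)
  have \<theta>: "0 < \<theta>" "\<theta> \<le> 1" using \<sigma>2 by (auto simp: \<theta>_def)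
  have A1: "A \<ge> 1"
  proof -
    have "\<sigma> powr 0 \<le> \<sigma> powr (\<alpha> - 2)" using \<sigma> \<alpha> by (intro powr_mono') auto
    then show ?thesis using \<sigma> by (simp add: A_def)
  qed
  have \<theta>23: "1 / \<theta>\<^sup>2 \<le> 1 / \<theta>^3" using \<theta> by (intro divide_left_mono) (auto simp: power_decreasing)
  have "1 / \<theta>^3 \<ge> 0" using \<theta> by simp
  then have B1: "B \<ge> 1" "B > 0" unfolding B_def using A1 by linarith+
  define P where "P = 2 * \<sigma> * C * d"
  have R: "r powr (\<alpha> - 2) \<ge> 1"
  proof -
    have "r powr 0 \<le> r powr (\<alpha> - 2)" using r \<alpha> by (intro powr_mono') auto
    then show ?thesis using r by simp
  qed
  have d0: "d > 0" using \<alpha> \<sigma> \<theta> by (simp add: d_def add_pos_pos)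
  have P0: "P > 0" using \<sigma> C1 d0 by (simp add: P_def)
  \<comment> \<open>This identity determines \<alpha>: the gradient term scales in \<open>r\<close>
    exactly like the Hessian term, so that the power of \<open>r\<close> factors out.\<close>
  have exps: "(\<alpha> - 1) * m = \<alpha> - 2" using m(2) by (simp add: algebra_simps)
  have "(2 * r powr (\<alpha> - 1) * \<sigma> * C * d) powr m = (r powr (\<alpha> - 1) * P) powr m" by (simp add: P_def ac_simps)
  also have "\<dots> = r powr (\<alpha> - 2) * P powr m"
    using P0 r by (simp add: powr_mult powr_powr exps)
  finally have lhs: "(2 * r powr (\<alpha> - 1) * \<sigma> * C * d) powr m = r powr (\<alpha> - 2) * P powr m" .
  have first: "C powr m * \<alpha> powr m * A \<le> P powr m"
  proof -
    have "C * \<alpha> * \<sigma> powr (\<alpha> - 1) \<le> P"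
    proof -
      have "C * \<alpha> * \<sigma> powr (\<alpha> - 1) = 2 * \<sigma> * C * (\<alpha> / 2 * \<sigma> powr (\<alpha> - 2))"
        using \<sigma> powr_add[of \<sigma> 1 "\<alpha> - 2"] by (simp add: algebra_simps)
      also have "\<dots> \<le> P" unfolding P_def d_def using \<sigma> C1 \<theta> by (intro mult_left_mono) auto
      finally show ?thesis .
    qed
    then have "(C * \<alpha> * \<sigma> powr (\<alpha> - 1)) powr m \<le> P powr m" using \<alpha> C1 m by (intro powr_mono2) auto
    also have "(C * \<alpha> * \<sigma> powr (\<alpha> - 1)) powr m = C powr m * \<alpha> powr m * A"
      using C1 \<alpha> by (simp add: powr_mult powr_powr exps A_def)
    finally show ?thesis .
  qed
  have \<alpha>m1: "\<alpha> powr m \<le> 1" using powr_mono2[of m \<alpha> 1] \<alpha> m by simp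
  \<comment> \<open>For \<open>\<sigma> < 1/2\<close> the blow-up term is at most
    \<open>3 * A\<close>. For \<open>\<sigma> \<ge> 1/2\<close> the blow-up part of the slope is at
    least \<open>C / \<theta>\<^sup>2\<close>, and \<open>m > 2\<close> makes its power dominate
    \<open>1 / \<theta>^3\<close>.\<close>
  have main: "C powr m * \<alpha> powr m * (B / 4) \<le> P powr m"
  proof (cases "\<sigma> < 1/2")
    case True
    have "\<sigma>\<^sup>2 \<le> (1/2)\<^sup>2" using True \<sigma> by (intro power_mono) auto
    then have "\<theta> \<ge> 3/4" by (simp add: \<theta>_def power2_eq_square)
    then have "(3/4)^3 \<le> \<theta>^3" by (intro power_mono) auto
    then have "1 / \<theta>^3 \<le> 1 / (3/4)^3" using \<theta> by (intro divide_left_mono) auto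
    then have "1 / \<theta>^3 \<le> 3 * A" using A1 by (simp add: power3_eq_cube)
    then have "B / 4 \<le> A" by (simp add: B_def)
    then have "C powr m * \<alpha> powr m * (B / 4) \<le> C powr m * \<alpha> powr m * A" by (intro mult_left_mono) auto
    then show ?thesis using first by linarith
  next
    case False
    have "C powr m * (1 / \<theta>^3) \<le> P powr m"
    proof -
      have "C * (1 / \<theta>\<^sup>2) \<le> P"
      proof -
        have "1 * (C * (1 / \<theta>\<^sup>2)) \<le> (2 * \<sigma>) * (C * (1 / \<theta>\<^sup>2))"
          using False C1 \<theta> by (intro mult_right_mono) auto
        also have "\<dots> = 2 * \<sigma> * C * (1 / \<theta>\<^sup>2)" by simp
        also have "\<dots> \<le> P" unfolding P_def d_def using \<sigma> C1 \<alpha> by (intro mult_left_mono) auto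
        finally show ?thesis by simp
      qed
      then have "(C * (1 / \<theta>\<^sup>2)) powr m \<le> P powr m" using C1 m by (intro powr_mono2) auto
      moreover have "(C * (1 / \<theta>\<^sup>2)) powr m = C powr m * (1 / \<theta>\<^sup>2) powr m"
        by (rule powr_mult)
      moreover have "1 / \<theta>^3 \<le> (1 / \<theta>\<^sup>2) powr m"
      proof -
        have "1 \<le> 1 / \<theta>\<^sup>2" using \<theta> by (simp add: power_le_one)
        then have "(1 / \<theta>\<^sup>2) powr 2 \<le> (1 / \<theta>\<^sup>2) powr m" using m by (intro powr_mono) auto
        moreover have "(1 / \<theta>\<^sup>2) powr 2 = 1 / \<theta>^4" using \<theta> by (simp add: powr_numeral power_divide)
        moreover have "1 / \<theta>^3 \<le> 1 / \<theta>^4" using \<theta> by (intro divide_left_mono) (auto simp: power_decreasing)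
        ultimately show ?thesis by linarith
      qed
      then have "C powr m * (1 / \<theta>^3) \<le> C powr m * (1 / \<theta>\<^sup>2) powr m" by (intro mult_left_mono) auto
      ultimately show ?thesis by linarith
    qed
    moreover have "C powr m * \<alpha> powr m * (1 / \<theta>^3) \<le> C powr m * 1 * (1 / \<theta>^3)"
      using \<alpha>m1 \<theta> by (intro mult_right_mono mult_left_mono) auto
    ultimately have "C powr m * \<alpha> powr m * (1 / \<theta>^3) \<le> P powr m" by simp
    moreover have "0 \<le> P powr m" by simp
    ultimately have "C powr m * \<alpha> powr m * A + C powr m * \<alpha> powr m * (1 / \<theta>^3) \<le> 4 * P powr m" using first by linarith
    then show ?thesis by (simp add: B_def distrib_left)
  qed
  have hess: "2 * C * (d + 18 * \<sigma>\<^sup>2 / \<theta>^3) \<le> 38 * C * B"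
  proof -
    have "\<alpha> / 2 * \<sigma> powr (\<alpha> - 2) \<le> A" using \<alpha> A1 mult_right_mono[of "\<alpha> / 2" 1 A] by (simp add: A_def)
    moreover have "18 * \<sigma>\<^sup>2 / \<theta>^3 \<le> 18 * (1 / \<theta>^3)" using \<sigma>2 \<theta> by (simp add: divide_le_cancel)
    moreover have "1 / \<theta>^3 \<ge> 0" using \<theta> by simp
    ultimately have "d + 18 * \<sigma>\<^sup>2 / \<theta>^3 \<le> 19 * B" using \<theta>23 A1 by (simp add: d_def B_def)
    then have "2 * C * (d + 18 * \<sigma>\<^sup>2 / \<theta>^3) \<le> 2 * C * (19 * B)" using C1 by (intro mult_left_mono) auto
    then show ?thesis by simp
  qed
  \<comment> \<open>The gradient side grows at least like \<open>C^2\<close>, the Hessian side only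
    linearly. The 4 in the definition of \<open>C\<close> comes from \<open>main\<close>, the 38
    from \<open>hess\<close>.\<close>
  have "K2 + 38 * \<Gamma> * C < K1 * (C powr m * \<alpha> powr m / 4)"
  proof -
    have "K2 + 38 * \<Gamma> * C \<le> (K2 + 38 * \<Gamma>) * C" using C1 K mult_left_mono[of 1 C K2] by (simp add: algebra_simps)
    also have "\<dots> < K1 * \<alpha> powr m / 4 * C * C"
    proof -
      have "K2 + 38 * \<Gamma> = K1 * \<alpha> powr m / 4 * (C - 1)" using K \<alpha>m by (simp add: C)
      also have "\<dots> < K1 * \<alpha> powr m / 4 * C" using K \<alpha>m by simp
      finally show ?thesis using C1 by (intro mult_strict_right_mono) auto
    qed
    also have "\<dots> = K1 * \<alpha> powr m / 4 * C powr 2" using C1 by (simp add: powr_numeral power2_eq_square)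
    also have "\<dots> \<le> K1 * \<alpha> powr m / 4 * C powr m" using C1 m K \<alpha>m by (intro mult_left_mono powr_mono) auto
    finally show ?thesis by (simp add: ac_simps)
  qed
  then have "(K2 + 38 * \<Gamma> * C) * B < K1 * (C powr m * \<alpha> powr m / 4) * B" using B1 by (intro mult_strict_right_mono) auto
  also have "\<dots> = K1 * (C powr m * \<alpha> powr m * (B / 4))" by simp
  also have "\<dots> \<le> K1 * P powr m" using main K by (intro mult_left_mono) auto
  finally have "(K2 + 38 * \<Gamma> * C) * B < K1 * P powr m" .
  moreover have "K2 + \<Gamma> * (2 * C * (d + 18 * \<sigma>\<^sup>2 / \<theta>^3)) \<le> (K2 + 38 * \<Gamma> * C) * B"
  proof -
    have "\<Gamma> * (2 * C * (d + 18 * \<sigma>\<^sup>2 / \<theta>^3)) \<le> \<Gamma> * (38 * C * B)" using K hess by (intro mult_left_mono)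
    moreover have "K2 * 1 \<le> K2 * B" using K B1 by (intro mult_left_mono) auto
    ultimately show ?thesis by (simp add: algebra_simps)
  qed
  ultimately have fin: "K2 + \<Gamma> * (2 * C * (d + 18 * \<sigma>\<^sup>2 / \<theta>^3)) < K1 * P powr m" by linarith
  have "K2 + \<Gamma> * (2 * r powr (\<alpha> - 2) * C * (d + 18 * \<sigma>\<^sup>2 / \<theta>^3))
      \<le> r powr (\<alpha> - 2) * (K2 + \<Gamma> * (2 * C * (d + 18 * \<sigma>\<^sup>2 / \<theta>^3)))"
    using R K mult_right_mono[of 1 "r powr (\<alpha> - 2)" K2] by (simp add: algebra_simps)
  also have "\<dots> < r powr (\<alpha> - 2) * (K1 * P powr m)" using fin r by (intro mult_strict_left_mono) auto
  finally show ?thesis unfolding lhs by (simp add: ac_simps)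
qed

text \<open>The barrier vanishes at \<open>x\<close> and blows up on the sphere. On a slightly
  smaller ball \<open>u\<close> minus the barrier has its maximum at the centre, which is the
  estimate, or at another interior point, where \<open>barrier_strict\<close> contradicts the
  inequality for the slope. The bound \<open>M\<close> serves to select the smaller ball and does
  not enter \<open>C\<close>.\<close>

lemma interior_holder_estimate:
  fixes u :: "'a::euclidean_space \<Rightarrow> real"
  assumes K: "K1 > 0" "K2 > 0" "\<Gamma> \<ge> 0" and \<alpha>: "0 < \<alpha>" "\<alpha> < 1" and m: "m > 2" "m * (1 - \<alpha>) = 2 - \<alpha>"
    and usc: "usc_on \<Omega> u" and bdd: "\<And>x. x \<in> \<Omega> \<Longrightarrow> \<bar>u x\<bar> \<le> M" and \<Omega>: "open \<Omega>"
    and sub: "\<And>x p H \<rho>. \<lbrakk>x \<in> \<Omega>; 0 < H; 0 < \<rho>;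
      \<And>h. norm h < \<rho> \<Longrightarrow> u (x + h) \<le> u x + p \<bullet> h + H / 2 * (norm h)\<^sup>2\<rbrakk> \<Longrightarrow> K1 * norm p powr m \<le> K2 + \<Gamma> * H"
  obtains C where "C > 0" "\<And>x r y. \<lbrakk>0 < r; r \<le> 1; ball x r \<subseteq> \<Omega>; norm (y - x) \<le> r / 2\<rbrakk> \<Longrightarrow>
    u y \<le> u x + C * norm (y - x) powr \<alpha>"
proof -
  define C where "C = 1 + 4 * (K2 + 38 * \<Gamma>) / (K1 * \<alpha> powr m)"
  have C1: "C \<ge> 1" using K \<alpha> by (simp add: C_def)
  have "u y \<le> u x + 3 * C * norm (y - x) powr \<alpha>"
    if r: "0 < r" "r \<le> 1" and ball: "ball x r \<subseteq> \<Omega>" and y: "norm (y - x) \<le> r / 2" for x r y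
  proof -
    define S where "S z = (norm (z - x))\<^sup>2 / r\<^sup>2" for z
    define f where "f s = C * (s powr (\<alpha> / 2) + s / (1 - s))" for s :: real
    define \<phi> where "\<phi> z = r powr \<alpha> * f (S z)" for z
    have S0: "S z \<ge> 0" for z by (simp add: S_def)
    have key: "u y \<le> u x + \<phi> y"
    proof (rule ccontr)
      assume neg: "\<not> u y \<le> u x + \<phi> y"
      \<comment> \<open>\<open>q\<close> is the squared relative radius at which the blow-up term
        equals \<open>T + 1\<close>. There the barrier exceeds \<open>2 * M\<close>, so the maximum
        is not on that sphere; \<open>q \<ge> 1/2\<close> keeps the half ball inside.\<close>
      define T where "T = max 0 (2 * M / (C * r powr \<alpha>))"
      define q where "q = (T + 1) / (T + 2)"
      have T: "T \<ge> 0" "2 * M / (C * r powr \<alpha>) \<le> T" by (auto simp: T_def)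
      have q: "1/2 \<le> q" "q < 1" "q / (1 - q) = T + 1" using T by (auto simp: q_def field_simps)
      define r' where "r' = r * sqrt q"
      have r': "0 < r'" "r' < r" using r q by (auto simp: r'_def)
      have Sr: "S z = q" if "norm (z - x) = r'" for z
        using that r q by (simp add: S_def r'_def power_mult_distrib)
      have Sle: "S z \<le> q" if "norm (z - x) \<le> r'" for z
      proof -
        have "(norm (z - x))\<^sup>2 \<le> r'\<^sup>2" using that by (intro power_mono) auto
        also have "r'\<^sup>2 = q * r\<^sup>2" using q by (simp add: r'_def power_mult_distrib)
        finally show ?thesis using r by (simp add: S_def pos_divide_le_eq)
      qed
      have sub\<Omega>: "cball x r' \<subseteq> \<Omega>" using ball r' by (auto simp: subset_iff dist_norm)
      have c\<phi>: "continuous_on (cball x r') \<phi>"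
      proof -
        have "1 - S z \<noteq> 0" if "z \<in> cball x r'" for z
          using Sle[of z] that q by (auto simp: dist_norm norm_minus_commute)
        moreover have cS: "continuous_on A S" for A
          unfolding S_def using r by (intro continuous_intros) auto
        ultimately show ?thesis unfolding \<phi>_def f_def
          using \<alpha> S0 by (intro continuous_intros continuous_on_powr' cS) auto
      qed
      have "\<exists>z\<in>cball x r'. \<forall>w\<in>cball x r'. u w + - \<phi> w \<le> u z + - \<phi> z"
        using r' by (intro usc_on_attains_max usc_on_add_continuous usc_on_subset[OF usc sub\<Omega>] continuous_intros c\<phi>) auto
      then obtain z where z: "z \<in> cball x r'" "\<And>w. w \<in> cball x r' \<Longrightarrow> u w - \<phi> w \<le> u z - \<phi> z" by auto
      have yin: "y \<in> cball x r'"
      proof -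
        have "1/2 \<le> sqrt q" using q real_le_rsqrt[of "1/2" q] by (simp add: power2_eq_square)
        then have "r / 2 \<le> r'" using r mult_left_mono[of "1/2" "sqrt q" r] by (simp add: r'_def)
        then show ?thesis using y by (simp add: dist_norm norm_minus_commute)
      qed
      have big: "u z - \<phi> z > u x" using z(2)[OF yin] neg by simp
      have \<phi>x: "\<phi> x = 0" by (simp add: \<phi>_def f_def S_def)
      have zx: "z \<noteq> x" using big \<phi>x by auto
      have "norm (z - x) \<noteq> r'"
      proof
        assume "norm (z - x) = r'"
        then have "f (S z) \<ge> C * (T + 1)" unfolding Sr[OF \<open>norm (z - x) = r'\<close>] f_def q(3) using C1 by simp
        then have "\<phi> z \<ge> r powr \<alpha> * (C * (T + 1))" unfolding \<phi>_def by (intro mult_left_mono) auto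
        moreover have "r powr \<alpha> * (C * (T + 1)) = C * r powr \<alpha> * T + C * r powr \<alpha>" by (simp add: algebra_simps)
        moreover have "2 * M \<le> C * r powr \<alpha> * T" using T(2) C1 r by (simp add: pos_divide_le_eq mult.commute)
        moreover have "C * r powr \<alpha> > 0" using C1 r by simp
        moreover have "x \<in> \<Omega>" "z \<in> \<Omega>" using sub\<Omega> z(1) r' by auto
        then have "\<bar>u x\<bar> \<le> M" "\<bar>u z\<bar> \<le> M" using bdd by auto
        ultimately show False using big by linarith
      qed
      then have zr': "norm (z - x) < r'" using z(1) by (simp add: dist_norm norm_minus_commute)
      define a where "a = z - x"
      define s where "s = S z"
      define \<theta> where "\<theta> = 1 - s"
      have na: "norm a > 0" using zx by (simp add: a_def)
      have s: "0 < s" "s < 1" "s = (norm a)\<^sup>2 / r\<^sup>2"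
      proof -
        show "s = (norm a)\<^sup>2 / r\<^sup>2" by (simp add: s_def S_def a_def)
        then show "0 < s" using na r by simp
        have "S z \<le> q" using Sle[of z] zr' by simp
        then show "s < 1" using q by (simp add: s_def)
      qed
      have \<theta>: "\<theta> > 0" using s by (simp add: \<theta>_def)
      define \<sigma> where "\<sigma> = norm a / r"
      have \<sigma>: "0 < \<sigma>" "\<sigma>\<^sup>2 = s" using na r s by (auto simp: \<sigma>_def power_divide)
      have \<sigma>1: "\<sigma> < 1" using zr' r' r by (simp add: \<sigma>_def a_def)
      define d where "d = \<alpha> / 2 * \<sigma> powr (\<alpha> - 2) + 1 / \<theta>\<^sup>2"
      define c2 where "c2 = 2 * C / \<theta>^3"
      have f_exp: "f (s + e) \<le> f s + C * d * e + c2 * e\<^sup>2" if "- (s/2) \<le> e" "e \<le> \<theta> / 2" for e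
      proof -
        have pw: "s powr (\<alpha>/2 - 1) = \<sigma> powr (\<alpha> - 2)"
        proof -
          have "s = \<sigma> powr 2" using \<sigma> by (simp add: powr_numeral)
          then have "s powr (\<alpha>/2 - 1) = \<sigma> powr (2 * (\<alpha>/2 - 1))" by (simp only: powr_powr)
          then show ?thesis by (simp add: algebra_simps)
        qed
        have "(s + e) powr (\<alpha>/2) \<le> s powr (\<alpha>/2) + \<alpha>/2 * s powr (\<alpha>/2 - 1) * (s + e - s)"
          by (rule powr_le_tangent) (use s that \<alpha> in auto)
        then have 1: "(s + e) powr (\<alpha>/2) \<le> s powr (\<alpha>/2) + \<alpha>/2 * \<sigma> powr (\<alpha> - 2) * e" unfolding pw by simp
        have "1 / (\<theta> - e) \<le> 1 / \<theta> + e / \<theta>\<^sup>2 + 2 * e\<^sup>2 / \<theta>^3"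
          by (rule inverse_quadratic_bound) (use \<theta> that in auto)
        moreover have "(s + e) / (1 - (s + e)) = 1 / (\<theta> - e) - 1" "s / (1 - s) = 1 / \<theta> - 1"
          using \<theta> that by (auto simp: \<theta>_def field_simps)
        ultimately have 2: "(s + e) / (1 - (s + e)) \<le> s / (1 - s) + 1 / \<theta>\<^sup>2 * e + 2 / \<theta>^3 * e\<^sup>2" by simp
        have "(s + e) powr (\<alpha>/2) + (s + e) / (1 - (s + e)) \<le> s powr (\<alpha>/2) + s / (1 - s) + d * e + 2 / \<theta>^3 * e\<^sup>2"
          using 1 2 by (simp add: d_def distrib_right)
        then have "f (s + e) \<le> C * (s powr (\<alpha>/2) + s / (1 - s) + d * e + 2 / \<theta>^3 * e\<^sup>2)"
          unfolding f_def using C1 by (intro mult_left_mono) auto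
        then show ?thesis by (simp add: f_def c2_def algebra_simps)
      qed
      define L where "L = 3 * norm a / r\<^sup>2"
      have L: "L > 0" using na r by (simp add: L_def)
      \<comment> \<open>The first entry justifies \<open>\<bar>e\<bar> \<le> L * norm h\<close>, the
        second keeps \<open>z + h\<close> in the smaller ball, and the last two keep
        \<open>e\<close> in the range of \<open>f_exp\<close>.\<close>
      define \<rho> where "\<rho> = min (min (norm a) (r' - norm a)) (min (s / (2 * L)) (\<theta> / (2 * L)))"
      have \<rho>: "\<rho> > 0" using na zr' s(1) \<theta> L by (simp add: \<rho>_def a_def)
      define p where "p = (2 * r powr (\<alpha> - 2) * (C * d)) *\<^sub>R a"
      define H where "H = 2 * r powr (\<alpha> - 2) * (C * d + 9 * c2 * s)"
      have rr: "r powr \<alpha> / r\<^sup>2 = r powr (\<alpha> - 2)" using r by (simp add: powr_diff powr_numeral)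
      have touch: "u (z + h) \<le> u z + p \<bullet> h + H / 2 * (norm h)\<^sup>2" if h: "norm h < \<rho>" for h
      proof -
        define e where "e = (2 * (a \<bullet> h) + (norm h)\<^sup>2) / r\<^sup>2"
        have zh: "z + h - x = a + h" by (simp add: a_def)
        have Se: "S (z + h) = s + e"
          unfolding S_def zh norm_add_square s(3) e_def by (simp add: add_divide_distrib)
        have "\<bar>2 * (a \<bullet> h) + (norm h)\<^sup>2\<bar> \<le> 2 * (norm a * norm h) + norm h * norm h"
          using Cauchy_Schwarz_ineq2[of a h] mult_nonneg_nonneg[OF norm_ge_zero norm_ge_zero, of h h]
          unfolding power2_eq_square by linarith
        also have "\<dots> \<le> 2 * (norm a * norm h) + norm a * norm h"
          using h by (intro add_left_mono mult_right_mono) (auto simp: \<rho>_def)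
        finally have "\<bar>2 * (a \<bullet> h) + (norm h)\<^sup>2\<bar> \<le> 3 * norm a * norm h" by simp
        then have eL: "\<bar>e\<bar> \<le> L * norm h" using r by (simp add: e_def L_def abs_divide divide_right_mono)
        have "L * norm h \<le> L * (s / (2 * L))" "L * norm h \<le> L * (\<theta> / (2 * L))"
          using h L by (intro mult_left_mono; simp add: \<rho>_def)+
        then have "L * norm h \<le> s / 2" "L * norm h \<le> \<theta> / 2" using L by auto
        then have fe: "f (s + e) \<le> f s + C * d * e + c2 * e\<^sup>2" using eL by (intro f_exp) auto
        have "e\<^sup>2 \<le> (L * norm h)\<^sup>2" using eL power_mono[of "\<bar>e\<bar>" "L * norm h" 2] by simp
        also have "\<dots> = 9 * s / r\<^sup>2 * (norm h)\<^sup>2" unfolding L_def s(3) using r by (simp add: power_mult_distrib power_divide power2_eq_square)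
        finally have "c2 * e\<^sup>2 \<le> c2 * (9 * s / r\<^sup>2 * (norm h)\<^sup>2)" using C1 \<theta> by (intro mult_left_mono) (auto simp: c2_def)
        then have fe': "f (s + e) \<le> f s + C * d * e + c2 * (9 * s / r\<^sup>2 * (norm h)\<^sup>2)" using fe by linarith
        have "z + h \<in> cball x r'"
          using norm_triangle_ineq[of a h] h by (simp add: dist_norm norm_minus_commute[of x] zh \<rho>_def)
        then have "u (z + h) \<le> u z + (\<phi> (z + h) - \<phi> z)" using z(2) by force
        also have "\<phi> (z + h) - \<phi> z = r powr \<alpha> * (f (s + e) - f s)" unfolding \<phi>_def Se by (simp add: s_def right_diff_distrib)
        also have "\<dots> \<le> r powr \<alpha> * (C * d * e + c2 * (9 * s / r\<^sup>2 * (norm h)\<^sup>2))"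
          using fe' by (intro mult_left_mono) auto
        also have "\<dots> = r powr \<alpha> / r\<^sup>2 * (C * d * (2 * (a \<bullet> h) + (norm h)\<^sup>2) + c2 * (9 * s * (norm h)\<^sup>2))"
          by (simp add: e_def algebra_simps add_divide_distrib)
        also have "\<dots> = p \<bullet> h + H / 2 * (norm h)\<^sup>2"
          unfolding rr by (simp add: p_def H_def algebra_simps)
        finally show ?thesis by simp
      qed
      have "d > 0" using \<alpha> \<sigma> \<theta> by (simp add: d_def add_pos_pos)
      then have H: "H > 0" using r C1 s \<theta> by (simp add: H_def c2_def add_pos_nonneg)
      have "z \<in> \<Omega>" using sub\<Omega> z(1) by auto
      from sub[OF this H \<rho> touch] have "K1 * norm p powr m \<le> K2 + \<Gamma> * H" .
      moreover have "norm p = 2 * r powr (\<alpha> - 1) * \<sigma> * C * d"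
      proof -
        have "norm p = 2 * r powr (\<alpha> - 2) * (C * d) * norm a" using \<open>d > 0\<close> C1 by (simp add: p_def)
        also have "norm a = \<sigma> * r" using r by (simp add: \<sigma>_def)
        also have "2 * r powr (\<alpha> - 2) * (C * d) * (\<sigma> * r) = 2 * (r powr (\<alpha> - 2) * r) * \<sigma> * C * d" by simp
        also have "r powr (\<alpha> - 2) * r = r powr (\<alpha> - 1)" using powr_add[of r "\<alpha> - 2" 1] r by simp
        finally show ?thesis .
      qed
      moreover have "H = 2 * r powr (\<alpha> - 2) * C * (d + 18 * \<sigma>\<^sup>2 / \<theta>^3)"
        by (simp add: H_def c2_def \<sigma>(2) algebra_simps)
      moreover have "\<theta> = 1 - \<sigma>\<^sup>2" using \<sigma>(2) by (simp add: \<theta>_def)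
      ultimately show False
        using barrier_strict[OF K \<alpha> m C_def \<sigma>(1) \<sigma>1 r] unfolding d_def by simp
    qed
    \<comment> \<open>On the half ball the blow-up term is at most \<open>2 * S y\<close>, hence at
      most twice the power term; together they give the factor 3.\<close>
    have S4: "S y \<le> 1/4"
    proof -
      have "(norm (y - x))\<^sup>2 \<le> (r / 2)\<^sup>2" using y by (intro power_mono) auto
      then show ?thesis using r by (simp add: S_def pos_divide_le_eq power_divide)
    qed
    have "S y / (1 - S y) \<le> S y / (3/4)" using S4 S0[of y] by (intro divide_left_mono) auto
    also have "\<dots> \<le> 2 * S y" using S0[of y] by simp
    also have "S y \<le> S y powr (\<alpha> / 2)"
    proof (cases "S y = 0")
      case False
      then have "S y powr 1 \<le> S y powr (\<alpha> / 2)" using S0[of y] S4 \<alpha> by (intro powr_mono') auto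
      then show ?thesis using False S0[of y] by simp
    qed simp
    finally have "f (S y) \<le> C * (S y powr (\<alpha> / 2) + 2 * S y powr (\<alpha> / 2))"
      unfolding f_def using C1 by (intro mult_left_mono) auto
    then have "\<phi> y \<le> r powr \<alpha> * (3 * C * S y powr (\<alpha> / 2))"
      unfolding \<phi>_def by (intro mult_left_mono) auto
    also have "S y powr (\<alpha> / 2) = norm (y - x) powr \<alpha> / r powr \<alpha>"
    proof -
      have "S y = (norm (y - x) / r) powr 2" using r by (cases "y = x") (simp_all add: S_def power_divide powr_numeral)
      then have "S y powr (\<alpha> / 2) = (norm (y - x) / r) powr (2 * (\<alpha> / 2))" by (simp only: powr_powr)
      then show ?thesis using r by (simp add: powr_divide)
    qed
    also have "r powr \<alpha> * (3 * C * (norm (y - x) powr \<alpha> / r powr \<alpha>)) = 3 * C * norm (y - x) powr \<alpha>"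
      using r by simp
    finally show ?thesis using key by simp
  qed
  then show ?thesis using that[of "3 * C"] C1 by simp
qed

section \<open>Geometry of the boundary\<close>

lemma Ck_imp_continuous: "Ck k f \<Longrightarrow> continuous_on S f"
proof (cases k)
  case 0
  then show "Ck k f \<Longrightarrow> continuous_on S f" by (auto intro: continuous_on_subset)
next
  case (Suc l)
  then show "Ck k f \<Longrightarrow> continuous_on S f"
    by (auto intro!: continuous_at_imp_continuous_on differentiable_imp_continuous_within)
qed

lemma frechet_derivative_expand:
  fixes f :: "'a::euclidean_space \<Rightarrow> real"
  assumes "f differentiable (at x)"
  shows "frechet_derivative f (at x) h = (\<Sum>i\<in>Basis. (h \<bullet> i) * frechet_derivative f (at x) i)"
proof -
  have lin: "linear (frechet_derivative f (at x))"
    using assms by (rule linear_frechet_derivative)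
  have "frechet_derivative f (at x) h = frechet_derivative f (at x) (\<Sum>i\<in>Basis. (h \<bullet> i) *\<^sub>R i)"
    by (simp add: euclidean_representation)
  also have "\<dots> = (\<Sum>i\<in>Basis. (h \<bullet> i) * frechet_derivative f (at x) i)"
    by (simp add: linear_sum[OF lin] linear_scale[OF lin])
  finally show ?thesis .
qed

lemma lipschitz_on_cball_if_C1:
  fixes f :: "'a::euclidean_space \<Rightarrow> real"
  assumes diff: "\<And>x. f differentiable (at x)"
    and cont: "\<And>i. i \<in> Basis \<Longrightarrow> continuous_on UNIV (\<lambda>x. frechet_derivative f (at x) i)"
  shows "\<exists>L\<ge>0. \<forall>x\<in>cball a R. \<forall>y\<in>cball a R. \<bar>f x - f y\<bar> \<le> L * norm (x - y)"
proof -
  have "\<exists>B. \<forall>x\<in>cball a R. \<bar>frechet_derivative f (at x) i\<bar> \<le> B" if "i \<in> Basis" for i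
  proof -
    have "compact ((\<lambda>x. frechet_derivative f (at x) i) ` cball a R)"
      by (intro compact_continuous_image continuous_on_subset[OF cont[OF that]]) auto
    then obtain B where "\<forall>y\<in>(\<lambda>x. frechet_derivative f (at x) i) ` cball a R. norm y \<le> B"
      using compact_imp_bounded bounded_iff by blast
    then show ?thesis by auto
  qed
  then obtain B where B: "\<And>i x. i \<in> Basis \<Longrightarrow> x \<in> cball a R \<Longrightarrow> \<bar>frechet_derivative f (at x) i\<bar> \<le> B i" by metis
  define L where "L = (\<Sum>i\<in>Basis. \<bar>B i\<bar>)"
  have L0: "L \<ge> 0" by (auto simp: L_def intro: sum_nonneg)
  have "\<bar>f x - f y\<bar> \<le> L * norm (x - y)" if "x \<in> cball a R" "y \<in> cball a R" for x y
  proof -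
    have "norm (f x - f y) \<le> L * norm (x - y)"
    proof (rule differentiable_bound[OF convex_cball[of a R] _ _ that(1) that(2)])
      fix z assume z: "z \<in> cball a R"
      show "(f has_derivative frechet_derivative f (at z)) (at z within cball a R)"
        using diff frechet_derivative_works has_derivative_at_withinI by blast
      show "onorm (frechet_derivative f (at z)) \<le> L"
      proof (rule onorm_bound[OF L0])
        fix h
        have "\<bar>frechet_derivative f (at z) h\<bar> \<le> (\<Sum>i\<in>Basis. \<bar>(h \<bullet> i) * frechet_derivative f (at z) i\<bar>)"
          by (subst frechet_derivative_expand[OF diff]) (rule sum_abs)
        also have "\<dots> \<le> (\<Sum>i\<in>Basis. norm h * \<bar>B i\<bar>)"
        proof (rule sum_mono)
          fix i :: 'a assume i: "i \<in> Basis"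
          have "\<bar>h \<bullet> i\<bar> * \<bar>frechet_derivative f (at z) i\<bar> \<le> norm h * \<bar>B i\<bar>"
            using Basis_le_norm[OF i, of h] B[OF i z] by (intro mult_mono) auto
          then show "\<bar>(h \<bullet> i) * frechet_derivative f (at z) i\<bar> \<le> norm h * \<bar>B i\<bar>" by (simp add: abs_mult)
        qed
        finally show "norm (frechet_derivative f (at z) h) \<le> L * norm h"
          by (simp add: L_def sum_distrib_left mult.commute)
      qed
    qed
    then show ?thesis by simp
  qed
  then show ?thesis using L0 by blast
qed

lemma C2_taylor_on_cball:
  fixes f :: "'a::euclidean_space \<Rightarrow> real"
  assumes diff: "\<And>x. f differentiable (at x)"
    and diff2: "\<And>i x. i \<in> Basis \<Longrightarrow> (\<lambda>x. frechet_derivative f (at x) i) differentiable (at x)"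
    and cont: "\<And>i j. i \<in> Basis \<Longrightarrow> j \<in> Basis \<Longrightarrow>
      continuous_on UNIV (\<lambda>x. frechet_derivative (\<lambda>x. frechet_derivative f (at x) i) (at x) j)"
  shows "\<exists>C\<ge>0. \<forall>h. norm h \<le> R \<longrightarrow> \<bar>f (a + h) - f a - frechet_derivative f (at a) h\<bar> \<le> C * (norm h)\<^sup>2"
proof -
  let ?D = "\<lambda>x. frechet_derivative f (at x)"
  have "\<exists>L\<ge>0. \<forall>x\<in>cball a R. \<forall>y\<in>cball a R. \<bar>?D x i - ?D y i\<bar> \<le> L * norm (x - y)" if "i \<in> Basis" for i
    by (rule lipschitz_on_cball_if_C1) (use diff2 cont that in auto)
  then obtain L where L: "\<And>i x y. i \<in> Basis \<Longrightarrow> x \<in> cball a R \<Longrightarrow> y \<in> cball a R \<Longrightarrow> \<bar>?D x i - ?D y i\<bar> \<le> L i * norm (x - y)"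
    and L0: "\<And>i. i \<in> Basis \<Longrightarrow> L i \<ge> 0" by metis
  define C where "C = (\<Sum>i\<in>Basis. L i)"
  have C0: "C \<ge> 0" unfolding C_def using L0 by (intro sum_nonneg) auto
  have "\<bar>f (a + h) - f a - ?D a h\<bar> \<le> C * (norm h)\<^sup>2" if h: "norm h \<le> R" for h
  proof -
    define k where "k t = f (a + t *\<^sub>R h) - t * ?D a h" for t :: real
    define k' where "k' t = ?D (a + t *\<^sub>R h) h - ?D a h" for t :: real
    have der: "(k has_derivative (\<lambda>s. s * k' t)) (at t within {0..1})" for t
    proof -
      have "(f has_derivative ?D (a + t *\<^sub>R h)) (at (a + t *\<^sub>R h))"
        using diff frechet_derivative_works by blast
      then have "((\<lambda>t. f (a + t *\<^sub>R h)) has_derivative (\<lambda>s. ?D (a + t *\<^sub>R h) (s *\<^sub>R h))) (at t within {0..1})"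
        by (intro has_derivative_compose[of "\<lambda>t. a + t *\<^sub>R h" _ _ _ f]) (auto intro!: derivative_eq_intros)
      moreover have "?D (a + t *\<^sub>R h) (s *\<^sub>R h) = s * ?D (a + t *\<^sub>R h) h" for s
        using linear_scale[OF linear_frechet_derivative[OF diff]] by simp
      ultimately show ?thesis unfolding k_def k'_def
        by (auto intro!: derivative_eq_intros simp: algebra_simps)
    qed
    have k'_bd: "\<bar>k' t\<bar> \<le> C * (norm h)\<^sup>2" if t: "0 \<le> t" "t \<le> 1" for t
    proof -
      have th: "norm (t *\<^sub>R h) \<le> R" using t h mult_mono[of t 1 "norm h" R] by simp
      have in_ball: "a + t *\<^sub>R h \<in> cball a R" "a \<in> cball a R"
        using th order_trans[OF norm_ge_zero h] by (auto simp: dist_norm)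
      have "k' t = (\<Sum>i\<in>Basis. (h \<bullet> i) * (?D (a + t *\<^sub>R h) i - ?D a i))"
        unfolding k'_def by (subst (1 2) frechet_derivative_expand[OF diff]) (simp add: sum_subtractf algebra_simps)
      then have "\<bar>k' t\<bar> \<le> (\<Sum>i\<in>Basis. \<bar>(h \<bullet> i) * (?D (a + t *\<^sub>R h) i - ?D a i)\<bar>)" by (simp add: sum_abs)
      also have "\<dots> \<le> (\<Sum>i\<in>Basis. norm h * (L i * norm h))"
      proof (rule sum_mono)
        fix i :: 'a assume i: "i \<in> Basis"
        have "\<bar>?D (a + t *\<^sub>R h) i - ?D a i\<bar> \<le> L i * norm (t *\<^sub>R h)" using L[OF i in_ball] by simp
        also have "\<dots> \<le> L i * norm h"
          using t L0[OF i] by (intro mult_left_mono) (auto simp: mult_left_le_one_le)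
        finally have "\<bar>h \<bullet> i\<bar> * \<bar>?D (a + t *\<^sub>R h) i - ?D a i\<bar> \<le> norm h * (L i * norm h)"
          using Basis_le_norm[OF i, of h] by (intro mult_mono) auto
        then show "\<bar>(h \<bullet> i) * (?D (a + t *\<^sub>R h) i - ?D a i)\<bar> \<le> norm h * (L i * norm h)" by (simp add: abs_mult)
      qed
      also have "\<dots> = C * (norm h)\<^sup>2" unfolding C_def sum_distrib_right by (simp add: power2_eq_square ac_simps)
      finally show ?thesis .
    qed
    have "norm (k 1 - k 0) \<le> (C * (norm h)\<^sup>2) * norm (1 - 0 :: real)"
    proof (rule differentiable_bound[of "{0..1}" k "\<lambda>t s. s * k' t"])
      fix t :: real assume t: "t \<in> {0..1}"
      show "onorm (\<lambda>s. s * k' t) \<le> C * (norm h)\<^sup>2"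
      proof (rule onorm_bound)
        show "norm (s * k' t) \<le> C * (norm h)\<^sup>2 * norm s" for s :: real
          using mult_left_mono[OF k'_bd, of t "\<bar>s\<bar>"] t by (simp add: abs_mult ac_simps)
      qed (use C0 in simp)
    qed (auto intro: der)
    then show ?thesis by (simp add: k_def)
  qed
  then show ?thesis using C0 by blast
qed

lemma C3_chart:
  fixes \<gamma> :: "'a::euclidean_space \<Rightarrow> real"
  assumes "Ck 3 \<gamma>"
  shows "\<exists>L\<ge>0. \<forall>x\<in>cball a R. \<forall>y\<in>cball a R. \<bar>\<gamma> x - \<gamma> y\<bar> \<le> L * norm (x - y)"
    and "\<exists>C\<ge>0. \<forall>h. norm h \<le> R \<longrightarrow> \<bar>\<gamma> (a + h) - \<gamma> a - frechet_derivative \<gamma> (at a) h\<bar> \<le> C * (norm h)\<^sup>2"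
    and "linear (frechet_derivative \<gamma> (at a))"
proof -
  have C: "Ck (Suc (Suc (Suc 0))) \<gamma>" using assms by (simp only: numeral_3_eq_3)
  have diff: "\<gamma> differentiable (at x)" for x using C by simp
  have C2: "Ck (Suc (Suc 0)) (\<lambda>x. frechet_derivative \<gamma> (at x) v)" for v using C by simp
  have diff2: "(\<lambda>x. frechet_derivative \<gamma> (at x) v) differentiable (at x)" for v x using C2 by simp
  have C1: "Ck (Suc 0) (\<lambda>x. frechet_derivative (\<lambda>x. frechet_derivative \<gamma> (at x) v) (at x) w)" for v w
    using C2[of v] by simp
  show "\<exists>L\<ge>0. \<forall>x\<in>cball a R. \<forall>y\<in>cball a R. \<bar>\<gamma> x - \<gamma> y\<bar> \<le> L * norm (x - y)"
    by (rule lipschitz_on_cball_if_C1[OF diff Ck_imp_continuous[OF C2]])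
  show "\<exists>C\<ge>0. \<forall>h. norm h \<le> R \<longrightarrow> \<bar>\<gamma> (a + h) - \<gamma> a - frechet_derivative \<gamma> (at a) h\<bar> \<le> C * (norm h)\<^sup>2"
    by (rule C2_taylor_on_cball[OF diff diff2 Ck_imp_continuous[OF C1]])
  show "linear (frechet_derivative \<gamma> (at a))" by (rule linear_frechet_derivative[OF diff])
qed

section \<open>Cones and one-sided tangency at the boundary\<close>

lemma projection_norm_le:
  fixes e :: "'a::real_inner"
  assumes "norm e = 1"
  shows "norm (x - (x \<bullet> e) *\<^sub>R e) \<le> norm x"
proof -
  have "(norm (x - (x \<bullet> e) *\<^sub>R e))\<^sup>2 = (norm x)\<^sup>2 - (x \<bullet> e)\<^sup>2"
  proof -
    have "e \<bullet> e = 1" using assms by (simp add: dot_square_norm)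
    then show ?thesis unfolding power2_norm_eq_inner
      by (simp add: inner_diff_left inner_diff_right inner_commute power2_eq_square)
  qed
  then have "(norm (x - (x \<bullet> e) *\<^sub>R e))\<^sup>2 \<le> (norm x)\<^sup>2" by simp
  then show ?thesis by (simp add: power2_le_iff_abs_le)
qed

lemma closure_below_chart:
  fixes \<gamma> :: "'a::euclidean_space \<Rightarrow> real"
  assumes \<gamma>: "continuous_on UNIV \<gamma>"
    and chart: "\<Omega> \<inter> ball x0 r = {x \<in> ball x0 r. x \<bullet> e > \<gamma> (x - (x \<bullet> e) *\<^sub>R e)}"
    and y: "y \<in> closure \<Omega>" "y \<in> ball x0 r"
  shows "y \<bullet> e \<ge> \<gamma> (y - (y \<bullet> e) *\<^sub>R e)"
proof -
  have "y \<in> closure (\<Omega> \<inter> ball x0 r)"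
    using y open_Int_closure_subset[OF open_ball, of x0 r \<Omega>] by (auto simp: Int_commute)
  moreover have "closure (\<Omega> \<inter> ball x0 r) \<subseteq> {x. \<gamma> (x - (x \<bullet> e) *\<^sub>R e) \<le> x \<bullet> e}"
    by (rule closure_minimal)
      (use chart in \<open>auto intro!: closed_Collect_le continuous_intros continuous_on_compose2[OF \<gamma>]\<close>)
  ultimately show ?thesis by auto
qed

text \<open>Over a time \<open>t\<close> the height grows by at least
  \<open>t * (1 - \<kappa>)\<close>, while the graph below rises by at most
  \<open>L * t * \<kappa>\<close>; the choice of \<kappa> makes the first larger. The start may lie
  on the boundary and the end is in the open set, which later allows several such moves in
  succession.\<close>

lemma local_cone_condition:
  fixes \<Omega> :: "(real^'n) set"
  assumes "C3_boundary \<Omega>" "x0 \<in> frontier \<Omega>"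
  shows "\<exists>r>0. \<exists>e \<kappa>. 0 < \<kappa> \<and> norm e = 1 \<and>
    (\<forall>y\<in>closure \<Omega> \<inter> ball x0 r. \<forall>w t. norm (w - e) \<le> \<kappa> \<longrightarrow> 0 < t \<longrightarrow> t * norm w < r \<longrightarrow> y + t *\<^sub>R w \<in> \<Omega>)"
proof -
  obtain r e \<gamma> where r: "r > 0" and e: "norm e = 1" and \<gamma>: "Ck 3 \<gamma>"
    and chart: "\<Omega> \<inter> ball x0 r = {x \<in> ball x0 r. x \<bullet> e > \<gamma> (x - (x \<bullet> e) *\<^sub>R e)}"
    using assms unfolding C3_boundary_def by blast
  define P where "P x = x - (x \<bullet> e) *\<^sub>R e" for x
  have P_le: "norm (P x) \<le> norm x" for x unfolding P_def by (rule projection_norm_le[OF e])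
  have P_diff: "P x - P y = P (x - y)" for x y by (simp add: P_def inner_diff_left algebra_simps)
  have ee: "e \<bullet> e = 1" using e by (simp add: dot_square_norm)
  obtain L where L: "L \<ge> 0" "\<And>x y. x \<in> cball (P x0) r \<Longrightarrow> y \<in> cball (P x0) r \<Longrightarrow> \<bar>\<gamma> x - \<gamma> y\<bar> \<le> L * norm (x - y)"
    using C3_chart(1)[OF \<gamma>, of "P x0" r] by blast
  define \<kappa> where "\<kappa> = 1 / (2 * (1 + L))"
  have \<kappa>: "\<kappa> > 0" "(1 + L) * \<kappa> = 1/2" using L by (auto simp: \<kappa>_def)
  have "y + t *\<^sub>R w \<in> \<Omega>" if y: "y \<in> closure \<Omega>" "y \<in> ball x0 (r/2)" and w: "norm (w - e) \<le> \<kappa>" and t: "0 < t" "t * norm w < r/2" for y w t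
  proof -
    define z where "z = y + t *\<^sub>R w"
    have yr: "y \<in> ball x0 r" using y(2) r by simp
    have zr: "z \<in> ball x0 r"
    proof -
      have "norm (z - x0) \<le> norm (y - x0) + norm (t *\<^sub>R w)" using norm_triangle_ineq[of "y - x0" "t *\<^sub>R w"] by (simp add: z_def algebra_simps)
      then show ?thesis using y(2) t by (simp add: dist_norm norm_minus_commute)
    qed
    have in_cball: "P x \<in> cball (P x0) r" if "x \<in> ball x0 r" for x
      using that P_le[of "x0 - x"] by (simp add: dist_norm P_diff)
    have Pe: "P e = 0" using ee by (simp add: P_def)
    have "norm (P z - P y) \<le> t * \<kappa>"
    proof -
      have "P z - P y = t *\<^sub>R P w" by (simp add: P_diff z_def) (simp add: P_def algebra_simps)
      moreover have "P w = P (w - e)" using P_diff[of w e] Pe by simp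
      then have "norm (P w) \<le> \<kappa>" using P_le[of "w - e"] w by simp
      ultimately show ?thesis using t by simp
    qed
    then have "L * norm (P z - P y) \<le> L * (t * \<kappa>)" using L by (intro mult_left_mono)
    then have 1: "\<gamma> (P z) \<le> \<gamma> (P y) + L * (t * \<kappa>)"
      using L(2)[OF in_cball[OF zr] in_cball[OF yr]] by linarith
    have 2: "\<gamma> (P y) \<le> y \<bullet> e"
      unfolding P_def by (rule closure_below_chart[OF Ck_imp_continuous[OF \<gamma>] chart y(1) yr])
    have "w \<bullet> e = 1 + (w - e) \<bullet> e" using ee by (simp add: inner_diff_left)
    moreover have "\<bar>(w - e) \<bullet> e\<bar> \<le> \<kappa>" using Cauchy_Schwarz_ineq2[of "w - e" e] e w by simp
    ultimately have "w \<bullet> e \<ge> 1 - \<kappa>" by linarith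
    then have "t * (w \<bullet> e) \<ge> t * (1 - \<kappa>)" using t by (intro mult_left_mono) auto
    then have 3: "z \<bullet> e \<ge> y \<bullet> e + t * (1 - \<kappa>)" by (simp add: z_def inner_add_left)
    have "L * (t * \<kappa>) < t * (1 - \<kappa>)"
    proof -
      have "L * \<kappa> + \<kappa> = 1/2" using \<kappa>(2) by (simp add: distrib_right)
      then have "L * \<kappa> < 1 - \<kappa>" by linarith
      then have "t * (L * \<kappa>) < t * (1 - \<kappa>)" using t by (intro mult_strict_left_mono)
      then show ?thesis by (simp add: ac_simps)
    qed
    then have "z \<bullet> e > \<gamma> (P z)" using 1 2 3 by linarith
    then have "z \<in> \<Omega> \<inter> ball x0 r" unfolding chart using zr by (simp add: P_def)
    then show ?thesis by (simp add: z_def)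
  qed
  then show ?thesis using \<kappa>(1) e r by (intro exI[of _ "r/2"] conjI exI[of _ e] exI[of _ \<kappa>]) auto
qed

text \<open>\<nu> is the gradient at \<open>x0\<close> of
  \<open>x \<bullet> e - \<gamma> (P x)\<close>, a function that is nonnegative on the closure near
  \<open>x0\<close> and not positive at \<open>x0\<close>; \<open>c\<close> bounds the Taylor
  remainder of \<gamma>. The bound on \<open>norm \<nu>\<close> follows from
  \<open>e \<bullet> \<nu> = 1\<close>, as \<open>P\<close> annihilates \<open>e\<close>.\<close>

lemma exterior_ball_function:
  fixes \<Omega> :: "(real^'n) set"
  assumes "C3_boundary \<Omega>" "x0 \<in> frontier \<Omega>"
  shows "\<exists>r>0. \<exists>\<nu> c. norm \<nu> \<ge> 1 \<and> c \<ge> 0 \<and> (\<forall>x\<in>closure \<Omega> \<inter> ball x0 r. (x - x0) \<bullet> \<nu> \<ge> - c * (norm (x - x0))\<^sup>2)"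
proof -
  obtain r e \<gamma> where r: "r > 0" and e: "norm e = 1" and \<gamma>: "Ck 3 \<gamma>"
    and chart: "\<Omega> \<inter> ball x0 r = {x \<in> ball x0 r. x \<bullet> e > \<gamma> (x - (x \<bullet> e) *\<^sub>R e)}"
    using assms unfolding C3_boundary_def by blast
  define P where "P x = x - (x \<bullet> e) *\<^sub>R e" for x
  have P_le: "norm (P x) \<le> norm x" for x unfolding P_def by (rule projection_norm_le[OF e])
  have P_diff: "P x - P y = P (x - y)" for x y by (simp add: P_def inner_diff_left algebra_simps)
  have ee: "e \<bullet> e = 1" using e by (simp add: dot_square_norm)
  have Plin: "linear P" unfolding P_def by (rule linearI) (auto simp: algebra_simps inner_add_left)
  define D where "D = frechet_derivative \<gamma> (at (P x0))"
  have Dlin: "linear D" unfolding D_def by (rule C3_chart(3)[OF \<gamma>])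
  obtain c where c: "c \<ge> 0" "\<And>h. norm h \<le> r \<Longrightarrow> \<bar>\<gamma> (P x0 + h) - \<gamma> (P x0) - D h\<bar> \<le> c * (norm h)\<^sup>2"
    using C3_chart(2)[OF \<gamma>, of r "P x0"] unfolding D_def by blast
  define \<nu> where "\<nu> = e - adjoint (D \<circ> P) 1"
  have DP: "linear (D \<circ> P)" by (rule linear_compose[OF Plin Dlin])
  have \<nu>: "x \<bullet> \<nu> = x \<bullet> e - D (P x)" for x
    using adjoint_works[OF DP, of x 1] by (simp add: \<nu>_def inner_diff_right)
  have "e \<bullet> \<nu> = 1" using ee linear_0[OF Dlin] by (simp add: \<nu> P_def)
  then have "1 \<le> norm e * norm \<nu>" using norm_cauchy_schwarz[of e \<nu>] by simp
  then have n\<nu>: "norm \<nu> \<ge> 1" using e by simp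
  have on_boundary: "x0 \<bullet> e \<le> \<gamma> (P x0)"
  proof (rule ccontr)
    assume neg: "\<not> x0 \<bullet> e \<le> \<gamma> (P x0)"
    define V where "V = {x \<in> ball x0 r. \<gamma> (x - (x \<bullet> e) *\<^sub>R e) < x \<bullet> e}"
    have cx: "continuous_on UNIV (\<lambda>x. \<gamma> (x - (x \<bullet> e) *\<^sub>R e))"
      by (intro continuous_on_compose2[OF Ck_imp_continuous[OF \<gamma>, of UNIV]] continuous_intros) auto
    have "open V"
    proof -
      have "V = ball x0 r \<inter> {x. \<gamma> (x - (x \<bullet> e) *\<^sub>R e) < x \<bullet> e}" by (auto simp: V_def)
      then show ?thesis by (auto intro!: open_Int open_Collect_less cx continuous_intros)
    qed
    moreover have "x0 \<in> V" using neg r by (simp add: V_def P_def)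
    moreover have "V \<subseteq> \<Omega>" using chart by (auto simp: V_def)
    ultimately have "x0 \<in> interior \<Omega>" by (rule interiorI)
    then show False using assms(2) by (simp add: frontier_def)
  qed
  have "(x - x0) \<bullet> \<nu> \<ge> - c * (norm (x - x0))\<^sup>2" if x: "x \<in> closure \<Omega>" "x \<in> ball x0 r" for x
  proof -
    have h: "norm (P (x - x0)) \<le> norm (x - x0)" by (rule P_le)
    have "\<gamma> (P x0 + P (x - x0)) - \<gamma> (P x0) - D (P (x - x0)) \<ge> - (c * (norm (P (x - x0)))\<^sup>2)"
      using c(2)[of "P (x - x0)"] h x(2) by (simp add: dist_norm norm_minus_commute abs_le_iff)
    moreover have "c * (norm (P (x - x0)))\<^sup>2 \<le> c * (norm (x - x0))\<^sup>2" using c(1) h by (intro mult_left_mono power_mono) auto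
    moreover have "P x0 + P (x - x0) = P x" using P_diff[of x x0] by (simp add: algebra_simps)
    moreover have "\<gamma> (P x) \<le> x \<bullet> e"
      unfolding P_def by (rule closure_below_chart[OF Ck_imp_continuous[OF \<gamma>] chart x])
    ultimately show ?thesis using on_boundary unfolding \<nu> by (simp add: inner_diff_left)
  qed
  then show ?thesis using r n\<nu> c(1) by (intro exI[of _ r] conjI exI[of _ \<nu>] exI[of _ c]) auto
qed

text \<open>The cutoffs of the transversal field are squares of positive parts. They have exact
  supports and yet a quadratic remainder with a global constant, which supplies the expansion of the
  field.\<close>

lemma pos_part_square_expansion:
  fixes s t :: real
  shows "\<bar>(max 0 (t + s))\<^sup>2 - (max 0 t)\<^sup>2 - 2 * max 0 t * s\<bar> \<le> s\<^sup>2"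
proof -
  consider "t \<ge> 0" "t + s \<ge> 0" | "t \<ge> 0" "t + s < 0" | "t < 0" "t + s \<ge> 0" | "t < 0" "t + s < 0" by linarith
  then show ?thesis
  proof cases
    case 1
    then show ?thesis by (simp add: power2_eq_square algebra_simps)
  next
    case 2
    have "(max 0 (t + s))\<^sup>2 - (max 0 t)\<^sup>2 - 2 * max 0 t * s = t * (t + s) + t * (- 2 * t - 3 * s)"
      using 2 by (simp add: power2_eq_square algebra_simps)
    moreover have "(t + s)\<^sup>2 \<ge> 0" by simp
    moreover have "0 \<le> t * (- 2 * s - t)" using 2 by (intro mult_nonneg_nonneg) auto
    ultimately show ?thesis using 2 by (simp add: power2_eq_square algebra_simps)
  next
    case 3
    then have "(t + s)\<^sup>2 \<le> s\<^sup>2" by (intro power_mono) auto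
    then show ?thesis using 3 by simp
  qed simp
qed

text \<open>The field is \<open>\<Sum>\<psi>\<^sub>x e\<^sub>x\<close> for cone directions \<open>e\<^sub>x\<close> at finitely many boundary points. Performing the
  moves \<open>t \<psi>\<^sub>x e\<^sub>x\<close> one after the other shows that it points inwards. The map \<open>N y\<close> plays the role of
  the derivative of \<open>n\<close> at \<open>y\<close>.\<close>

lemma transversal_field:
  fixes \<Omega> :: "(real^'n) set"
  assumes \<Omega>: "open \<Omega>" "bounded \<Omega>" "C3_boundary \<Omega>"
  obtains n :: "real^'n \<Rightarrow> real^'n" and N c t0 B where "0 < c" "0 < t0" "1 \<le> B"
    "\<And>y t. y \<in> closure \<Omega> \<Longrightarrow> 0 < t \<Longrightarrow> t \<le> t0 \<Longrightarrow> ball (y + t *\<^sub>R n y) (c * t) \<subseteq> \<Omega>"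
    "\<And>y. y \<in> closure \<Omega> \<Longrightarrow> norm (n y) \<le> B"
    "\<And>x y. x \<in> closure \<Omega> \<Longrightarrow> y \<in> closure \<Omega> \<Longrightarrow> norm (n x - n y) \<le> B * norm (x - y)"
    "\<And>y. linear (N y)"
    "\<And>y k. y \<in> closure \<Omega> \<Longrightarrow> norm (N y k) \<le> B * norm k"
    "\<And>y k. y \<in> closure \<Omega> \<Longrightarrow> y + k \<in> closure \<Omega> \<Longrightarrow> norm (n (y + k) - n y - N y k) \<le> B * (norm k)\<^sup>2"
proof -
  have "\<forall>x\<in>frontier \<Omega>. \<exists>r e \<kappa>. r > 0 \<and> 0 < \<kappa> \<and> norm e = 1 \<and>
    (\<forall>y\<in>closure \<Omega> \<inter> ball x r. \<forall>w t. norm (w - e) \<le> \<kappa> \<longrightarrow> 0 < t \<longrightarrow> t * norm w < r \<longrightarrow> y + t *\<^sub>R w \<in> \<Omega>)"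
    using local_cone_condition[OF \<Omega>(3)] by blast
  from bchoice[OF this] obtain r where "\<forall>x\<in>frontier \<Omega>. \<exists>e \<kappa>. r x > 0 \<and> 0 < \<kappa> \<and> norm e = 1 \<and>
    (\<forall>y\<in>closure \<Omega> \<inter> ball x (r x). \<forall>w t. norm (w - e) \<le> \<kappa> \<longrightarrow> 0 < t \<longrightarrow> t * norm w < r x \<longrightarrow> y + t *\<^sub>R w \<in> \<Omega>)" ..
  from bchoice[OF this] obtain e where "\<forall>x\<in>frontier \<Omega>. \<exists>\<kappa>. r x > 0 \<and> 0 < \<kappa> \<and> norm (e x) = 1 \<and>
    (\<forall>y\<in>closure \<Omega> \<inter> ball x (r x). \<forall>w t. norm (w - e x) \<le> \<kappa> \<longrightarrow> 0 < t \<longrightarrow> t * norm w < r x \<longrightarrow> y + t *\<^sub>R w \<in> \<Omega>)" ..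
  from bchoice[OF this] obtain \<kappa> where *: "\<forall>x\<in>frontier \<Omega>. r x > 0 \<and> 0 < \<kappa> x \<and> norm (e x) = 1 \<and>
    (\<forall>y\<in>closure \<Omega> \<inter> ball x (r x). \<forall>w t. norm (w - e x) \<le> \<kappa> x \<longrightarrow> 0 < t \<longrightarrow> t * norm w < r x \<longrightarrow> y + t *\<^sub>R w \<in> \<Omega>)" ..
  have r: "r x > 0" if "x \<in> frontier \<Omega>" for x using bspec[OF * that] by (elim conjE)
  have \<kappa>: "\<kappa> x > 0" if "x \<in> frontier \<Omega>" for x using bspec[OF * that] by (elim conjE)
  have e: "norm (e x) = 1" if "x \<in> frontier \<Omega>" for x using bspec[OF * that] by (elim conjE)
  have cone: "y + t *\<^sub>R w \<in> \<Omega>"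
    if "x \<in> frontier \<Omega>" "y \<in> closure \<Omega>" "y \<in> ball x (r x)" "norm (w - e x) \<le> \<kappa> x" "0 < t" "t * norm w < r x" for x y w t
  proof -
    from bspec[OF * that(1)]
    have "\<forall>y\<in>closure \<Omega> \<inter> ball x (r x). \<forall>w t. norm (w - e x) \<le> \<kappa> x \<longrightarrow> 0 < t \<longrightarrow> t * norm w < r x \<longrightarrow> y + t *\<^sub>R w \<in> \<Omega>"
      by (elim conjE)
    from bspec[OF this IntI[OF that(2,3)]] show ?thesis using that(4-6) by simp
  qed
  define \<rho> where "\<rho> x = r x / 2" for x
  have \<rho>: "\<rho> x > 0" if "x \<in> frontier \<Omega>" for x using r[OF that] by (simp add: \<rho>_def)
  have cf: "compact (frontier \<Omega>)" using \<Omega>(2) by (simp add: compact_frontier_bounded)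
  have cc: "compact (closure \<Omega>)" using \<Omega>(2) by (simp add: compact_closure)
  have fc: "frontier \<Omega> \<subseteq> closure \<Omega>" by (simp add: frontier_def)
  have cover: "frontier \<Omega> \<subseteq> (\<Union>x\<in>frontier \<Omega>. ball x (\<rho> x))"
  proof
    fix x assume "x \<in> frontier \<Omega>"
    then show "x \<in> (\<Union>x\<in>frontier \<Omega>. ball x (\<rho> x))" using \<rho> by (intro UN_I[of x]) auto
  qed
  obtain C where C: "C \<subseteq> frontier \<Omega>" "finite C" "frontier \<Omega> \<subseteq> (\<Union>x\<in>C. ball x (\<rho> x))"
    by (rule compactE_image[OF cf _ cover]) auto
  have Cc: "x \<in> C \<Longrightarrow> x \<in> frontier \<Omega>" for x using C(1) by blast
  obtain D where D: "D > 0" "\<And>x. x \<in> closure \<Omega> \<Longrightarrow> norm x \<le> D"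
    using compact_imp_bounded[OF cc] bounded_pos by blast
  define T where "T x y = (\<rho> x)\<^sup>2 - (norm (y - x))\<^sup>2" for x y
  define \<psi> where "\<psi> x y = (max 0 (T x y))\<^sup>2" for x y
  define n where "n y = (\<Sum>x\<in>C. \<psi> x y *\<^sub>R e x)" for y
  define S where "S y = (\<Sum>x\<in>C. \<psi> x y)" for y
  define N where "N y k = (\<Sum>x\<in>C. (2 * max 0 (T x y) * (- 2 * ((y - x) \<bullet> k))) *\<^sub>R e x)" for y k
  have \<psi>0: "\<psi> x y \<ge> 0" for x y by (simp add: \<psi>_def)
  have T_le: "max 0 (T x y) \<le> (\<rho> x)\<^sup>2" for x y by (simp add: T_def)
  have \<psi>_le: "\<psi> x y \<le> ((\<rho> x)\<^sup>2)\<^sup>2" for x y unfolding \<psi>_def using T_le by (intro power_mono) auto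
  have \<psi>_pos: "\<psi> x y > 0 \<longleftrightarrow> y \<in> ball x (\<rho> x)" if "x \<in> C" for x y
  proof -
    have "\<psi> x y > 0 \<longleftrightarrow> T x y > 0" by (auto simp: \<psi>_def max_def)
    also have "\<dots> \<longleftrightarrow> norm (y - x) < \<rho> x"
    proof
      assume "0 < T x y"
      then have "(norm (y - x))\<^sup>2 < (\<rho> x)\<^sup>2" by (simp add: T_def)
      then show "norm (y - x) < \<rho> x" using \<rho>[OF Cc[OF that]] power_less_imp_less_base by force
    next
      assume "norm (y - x) < \<rho> x"
      then have "(norm (y - x))\<^sup>2 < (\<rho> x)\<^sup>2" by (intro power_strict_mono) auto
      then show "0 < T x y" by (simp add: T_def)
    qed
    finally show ?thesis by (simp add: dist_norm norm_minus_commute)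
  qed
  define Sm where "Sm = (\<Sum>x\<in>C. ((\<rho> x)\<^sup>2)\<^sup>2)"
  have Sm0: "Sm \<ge> 0" unfolding Sm_def by (intro sum_nonneg) auto
  have S_le: "S y \<le> Sm" for y unfolding S_def Sm_def by (intro sum_mono \<psi>_le)
  have n_le: "norm (n y) \<le> Sm" for y
  proof -
    have "norm (n y) \<le> (\<Sum>x\<in>C. norm (\<psi> x y *\<^sub>R e x))" unfolding n_def by (rule norm_sum)
    also have "\<dots> = S y" unfolding S_def using e[OF Cc] \<psi>0 by (intro sum.cong) auto
    finally show ?thesis using S_le[of y] by linarith
  qed
  have S_cont: "continuous_on UNIV S"
    unfolding S_def \<psi>_def T_def by (intro continuous_intros)
  have S_front: "S y > 0" if "y \<in> frontier \<Omega>" for y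
  proof -
    obtain x where x: "x \<in> C" "y \<in> ball x (\<rho> x)" using C(3) \<open>y \<in> frontier \<Omega>\<close> by blast
    then have "0 < \<psi> x y" using \<psi>_pos by blast
    also have "\<psi> x y \<le> S y" unfolding S_def using x C(2) \<psi>0 by (intro member_le_sum) auto
    finally show ?thesis .
  qed
  \<comment> \<open>Where \<open>S \<le> s0\<close> a point of the closure is at a fixed distance
    inside \<Omega>, and short moves are harmless; elsewhere the cone directions act with total
    weight above \<open>s0\<close>.\<close>
  obtain s0 where s0: "s0 > 0" "\<And>y. y \<in> frontier \<Omega> \<Longrightarrow> s0 < S y"
  proof (cases "frontier \<Omega> = {}")
    case True
    then show ?thesis using that[of 1] by simp
  next
    case False
    then obtain y0 where "y0 \<in> frontier \<Omega>" "\<And>y. y \<in> frontier \<Omega> \<Longrightarrow> S y0 \<le> S y"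
      using continuous_attains_inf[OF cf False continuous_on_subset[OF S_cont]] by blast
    then show ?thesis using that[of "S y0 / 2"] S_front[of y0] by force
  qed
  define K where "K = closure \<Omega> \<inter> {y. S y \<le> s0}"
  have "compact K" unfolding K_def
    by (intro compact_Int_closed cc closed_Collect_le S_cont continuous_intros)
  moreover have "K \<subseteq> \<Omega>"
  proof
    fix y assume "y \<in> K"
    then have "y \<in> closure \<Omega>" "y \<notin> frontier \<Omega>" using s0(2)[of y] by (auto simp: K_def)
    then show "y \<in> \<Omega>" using \<Omega>(1) by (simp add: frontier_def interior_open)
  qed
  ultimately obtain d0 where d0: "d0 > 0" "(\<Union>y\<in>K. ball y d0) \<subseteq> \<Omega>"
    using compact_subset_open_imp_ball_epsilon_subset[OF _ \<Omega>(1)] by blast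
  define \<kappa>0 where "\<kappa>0 = Min (insert 1 (\<kappa> ` C))"
  define \<rho>0 where "\<rho>0 = Min (insert 1 (\<rho> ` C))"
  have \<kappa>0: "\<kappa>0 > 0" "\<kappa>0 \<le> 1" "\<And>x. x \<in> C \<Longrightarrow> \<kappa>0 \<le> \<kappa> x"
    unfolding \<kappa>0_def using C(2) \<kappa>[OF Cc] by (auto simp: Min_gr_iff)
  have \<rho>0: "\<rho>0 > 0" "\<And>x. x \<in> C \<Longrightarrow> \<rho>0 \<le> \<rho> x"
    unfolding \<rho>0_def using C(2) \<rho>[OF Cc] by (auto simp: Min_gr_iff)
  \<comment> \<open>A perturbation below this size, divided by \<open>S y > s0\<close>, tilts every
    cone direction by at most \<open>\<kappa>0\<close>, which all the cones tolerate.\<close>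
  define c where "c = s0 * \<kappa>0"
  have c: "c > 0" using s0 \<kappa>0 by (simp add: c_def)
  \<comment> \<open>The first bound keeps all intermediate points within the cone neighbourhoods,
    where \<open>\<rho> x = r x / 2\<close> leaves room for them; the second serves the points of
    \<open>K\<close>.\<close>
  define t0 where "t0 = min (\<rho>0 / (4 * (Sm + 1))) (d0 / (Sm + c + 1))"
  have t0: "t0 > 0" using \<rho>0 d0 Sm0 c by (simp add: t0_def)
  have main: "y + t *\<^sub>R (n y + z) \<in> \<Omega>" if y: "y \<in> closure \<Omega>" and t: "0 < t" "t \<le> t0" and z: "norm z < c" for y t z
  proof (cases "S y \<le> s0")
    case True
    have "t * (Sm + c) < d0"
    proof -
      have "t * (Sm + c) \<le> d0 / (Sm + c + 1) * (Sm + c)" using t Sm0 c by (intro mult_right_mono) (auto simp: t0_def)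
      also have "\<dots> < d0" using d0 Sm0 c by (simp add: pos_divide_less_eq)
      finally show ?thesis .
    qed
    moreover have "norm (t *\<^sub>R (n y + z)) \<le> t * (Sm + c)"
      using t norm_triangle_ineq[of "n y" z] n_le[of y] z by simp
    ultimately have "y + t *\<^sub>R (n y + z) \<in> ball y d0" by (simp add: dist_norm)
    moreover have "y \<in> K" using True y by (simp add: K_def)
    ultimately show ?thesis using d0(2) by blast
  next
    case False
    then have Sy: "S y > s0" "S y > 0" using s0 by auto
    define \<zeta> where "\<zeta> = z /\<^sub>R S y"
    have "s0 * \<kappa>0 \<le> S y * \<kappa>0" using Sy \<kappa>0 by (intro mult_right_mono) auto
    then have "norm z < S y * \<kappa>0" using z by (simp add: c_def)
    then have \<zeta>: "norm \<zeta> \<le> \<kappa>0" using Sy by (simp add: \<zeta>_def field_simps)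
    have tS: "2 * (t * Sm) < \<rho>0"
    proof -
      have "t * Sm \<le> \<rho>0 / (4 * (Sm + 1)) * Sm" using t Sm0 by (intro mult_right_mono) (auto simp: t0_def)
      also have "\<dots> \<le> \<rho>0 / 4" using \<rho>0 Sm0 by (simp add: field_simps)
      finally show ?thesis using \<rho>0 by linarith
    qed
    define C' where "C' = {x \<in> C. \<psi> x y > 0}"
    have fC': "finite C'" using C(2) by (simp add: C'_def)
    have wn: "norm (e x + \<zeta>) \<le> 2" if "x \<in> C" for x
      using norm_triangle_ineq[of "e x" \<zeta>] e[OF Cc[OF that]] \<zeta> \<kappa>0 by simp
    have move: "norm (\<Sum>x\<in>A. (t * \<psi> x y) *\<^sub>R (e x + \<zeta>)) \<le> 2 * (t * Sm)" if "A \<subseteq> C" for A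
    proof -
      have "norm (\<Sum>x\<in>A. (t * \<psi> x y) *\<^sub>R (e x + \<zeta>)) \<le> (\<Sum>x\<in>A. norm ((t * \<psi> x y) *\<^sub>R (e x + \<zeta>)))" by (rule norm_sum)
      also have "\<dots> \<le> (\<Sum>x\<in>A. (t * \<psi> x y) * 2)"
      proof (rule sum_mono)
        fix x assume "x \<in> A"
        then show "norm ((t * \<psi> x y) *\<^sub>R (e x + \<zeta>)) \<le> (t * \<psi> x y) * 2"
          using wn[of x] \<open>A \<subseteq> C\<close> \<psi>0[of x y] t by (auto intro!: mult_left_mono)
      qed
      also have "\<dots> \<le> (\<Sum>x\<in>C. (t * \<psi> x y) * 2)"
        using C(2) \<open>A \<subseteq> C\<close> \<psi>0 t by (intro sum_mono2) auto
      also have "\<dots> = 2 * (t * S y)" by (simp add: S_def sum_distrib_left ac_simps)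
      also have "\<dots> \<le> 2 * (t * Sm)" using S_le[of y] t by simp
      finally show ?thesis .
    qed
    \<comment> \<open>The claim has two parts because \<open>y\<close> itself may be a boundary
      point: only after a first move is membership in \<Omega> secured.\<close>
    have ind: "y + (\<Sum>x\<in>A. (t * \<psi> x y) *\<^sub>R (e x + \<zeta>)) \<in> closure \<Omega> \<and>
        (A \<noteq> {} \<longrightarrow> y + (\<Sum>x\<in>A. (t * \<psi> x y) *\<^sub>R (e x + \<zeta>)) \<in> \<Omega>)" if "finite A" "A \<subseteq> C'" for A
      using that
    proof (induction A rule: finite_subset_induct')
      case empty
      show ?case using y by simp
    next
      case (insert a A)
      let ?y = "y + (\<Sum>x\<in>A. (t * \<psi> x y) *\<^sub>R (e x + \<zeta>))"
      have a: "a \<in> C" "\<psi> a y > 0" using insert by (auto simp: C'_def)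
      have AC: "A \<subseteq> C" using insert by (auto simp: C'_def)
      have "norm (?y - y) \<le> 2 * (t * Sm)" using move[OF AC] by simp
      moreover have "norm (y - a) < \<rho> a" using \<psi>_pos[OF a(1), of y] a(2) by (simp add: dist_norm norm_minus_commute)
      ultimately have "norm (?y - a) < r a"
        using dist_triangle[of ?y a y, unfolded dist_norm] tS \<rho>0(2)[OF a(1)] unfolding \<rho>_def by linarith
      then have yb: "?y \<in> ball a (r a)" by (simp add: dist_norm norm_minus_commute)
      have "t * \<psi> a y * norm (e a + \<zeta>) < r a"
      proof -
        have "norm (\<Sum>x\<in>{a}. (t * \<psi> x y) *\<^sub>R (e x + \<zeta>)) \<le> 2 * (t * Sm)" using a by (intro move) auto
        then have "t * \<psi> a y * norm (e a + \<zeta>) \<le> 2 * (t * Sm)" using t a by (simp add: abs_mult)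
        then show ?thesis using tS \<rho>0(2)[OF a(1)] \<rho>[OF Cc[OF a(1)]] by (simp add: \<rho>_def)
      qed
      then have "?y + (t * \<psi> a y) *\<^sub>R (e a + \<zeta>) \<in> \<Omega>"
        using insert.IH yb \<zeta> \<kappa>0(3)[OF a(1)] t a by (intro cone[OF Cc[OF a(1)]]) auto
      then have "y + (\<Sum>x\<in>insert a A. (t * \<psi> x y) *\<^sub>R (e x + \<zeta>)) \<in> \<Omega>"
        using insert.hyps by (simp add: add_ac)
      then show ?case using closure_subset by blast
    qed
    have "C' \<noteq> {}"
    proof
      assume "C' = {}"
      then have "S y \<le> 0" unfolding S_def C'_def by (intro sum_nonpos) (auto simp: not_less)
      then show False using Sy by simp
    qed
    then have "y + (\<Sum>x\<in>C'. (t * \<psi> x y) *\<^sub>R (e x + \<zeta>)) \<in> \<Omega>" using ind[OF fC'] by blast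
    moreover have "(\<Sum>x\<in>C'. (t * \<psi> x y) *\<^sub>R (e x + \<zeta>)) = t *\<^sub>R (n y + z)"
    proof -
      have "(\<Sum>x\<in>C'. (t * \<psi> x y) *\<^sub>R (e x + \<zeta>)) = (\<Sum>x\<in>C. (t * \<psi> x y) *\<^sub>R (e x + \<zeta>))"
        using C(2) \<psi>0 by (intro sum.mono_neutral_left) (auto simp: C'_def less_le)
      also have "\<dots> = t *\<^sub>R (n y + S y *\<^sub>R \<zeta>)"
        by (simp add: n_def S_def scaleR_add_right sum.distrib scaleR_sum_right scaleR_sum_left)
      also have "S y *\<^sub>R \<zeta> = z" using Sy by (simp add: \<zeta>_def)
      finally show ?thesis .
    qed
    ultimately show ?thesis by simp
  qed
  \<comment> \<open>\<open>36 * D\<^sup>2\<close> is the square of the constant in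
    \<open>\<bar>s\<bar> \<le> 6 * D * norm k\<close>, where \<open>s\<close> is the increment of
    \<open>T x\<close>; the other term comes from the part of \<open>s\<close> that is quadratic in
    \<open>k\<close>.\<close>
  define B0 where "B0 = (\<Sum>x\<in>C. 36 * D\<^sup>2 + 2 * (\<rho> x)\<^sup>2)"
  define B1 where "B1 = (\<Sum>x\<in>C. 8 * D * (\<rho> x)\<^sup>2)"
  have B01: "B0 \<ge> 0" "B1 \<ge> 0" unfolding B0_def B1_def using D by (auto intro!: sum_nonneg)
  have N_lin: "linear (N y)" for y
    unfolding N_def by (intro linear_compose_sum ballI linearI) (auto simp: inner_add_right algebra_simps)
  have diam: "norm (x - y) \<le> 2 * D" if "x \<in> closure \<Omega>" "y \<in> closure \<Omega>" for x y
    using D(2)[OF that(1)] D(2)[OF that(2)] norm_triangle_ineq4[of x y] by linarith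
  have N_le: "norm (N y k) \<le> B1 * norm k" if y: "y \<in> closure \<Omega>" for y k
  proof -
    have "norm (N y k) \<le> (\<Sum>x\<in>C. norm ((2 * max 0 (T x y) * (- 2 * ((y - x) \<bullet> k))) *\<^sub>R e x))"
      unfolding N_def by (rule norm_sum)
    also have "\<dots> \<le> (\<Sum>x\<in>C. 8 * D * (\<rho> x)\<^sup>2 * norm k)"
    proof (rule sum_mono)
      fix x assume x: "x \<in> C"
      have "\<bar>(y - x) \<bullet> k\<bar> \<le> norm (y - x) * norm k" by (rule Cauchy_Schwarz_ineq2)
      also have "\<dots> \<le> 2 * D * norm k" using diam[OF y] fc Cc[OF x] by (intro mult_right_mono) auto
      finally have "max 0 (T x y) * \<bar>(y - x) \<bullet> k\<bar> \<le> (\<rho> x)\<^sup>2 * (2 * D * norm k)"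
        using T_le by (intro mult_mono) auto
      then show "norm ((2 * max 0 (T x y) * (- 2 * ((y - x) \<bullet> k))) *\<^sub>R e x) \<le> 8 * D * (\<rho> x)\<^sup>2 * norm k"
        using e[OF Cc[OF x]] by (simp add: abs_mult ac_simps)
    qed
    finally show ?thesis by (simp add: B1_def sum_distrib_right)
  qed
  have N_exp: "norm (n (y + k) - n y - N y k) \<le> B0 * (norm k)\<^sup>2" if y: "y \<in> closure \<Omega>" "y + k \<in> closure \<Omega>" for y k
  proof -
    have eq: "n (y + k) - n y - N y k = (\<Sum>x\<in>C. (\<psi> x (y + k) - \<psi> x y - 2 * max 0 (T x y) * (- 2 * ((y - x) \<bullet> k))) *\<^sub>R e x)"
      by (simp only: n_def N_def sum_subtractf scaleR_diff_left)
    have "norm (n (y + k) - n y - N y k) \<le> (\<Sum>x\<in>C. norm ((\<psi> x (y + k) - \<psi> x y - 2 * max 0 (T x y) * (- 2 * ((y - x) \<bullet> k))) *\<^sub>R e x))"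
      unfolding eq by (rule norm_sum)
    also have "\<dots> \<le> (\<Sum>x\<in>C. (36 * D\<^sup>2 + 2 * (\<rho> x)\<^sup>2) * (norm k)\<^sup>2)"
    proof (rule sum_mono)
      fix x assume x: "x \<in> C"
      define s where "s = - 2 * ((y - x) \<bullet> k) - (norm k)\<^sup>2"
      have Tk: "T x (y + k) = T x y + s"
      proof -
        have "y + k - x = (y - x) + k" by simp
        then show ?thesis unfolding T_def s_def by (simp only: norm_add_square)
      qed
      have k2: "norm k \<le> 2 * D" using diam[OF y(2) y(1)] by simp
      have "\<bar>(y - x) \<bullet> k\<bar> \<le> norm (y - x) * norm k" by (rule Cauchy_Schwarz_ineq2)
      also have "\<dots> \<le> 2 * D * norm k" using diam[OF y(1)] fc Cc[OF x] by (intro mult_right_mono) auto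
      finally have "\<bar>s\<bar> \<le> 2 * (2 * D * norm k) + norm k * norm k"
        using mult_nonneg_nonneg[OF norm_ge_zero norm_ge_zero, of k k] unfolding s_def power2_eq_square by linarith
      also have "\<dots> \<le> 2 * (2 * D * norm k) + 2 * D * norm k" using k2 by (intro add_left_mono mult_right_mono) auto
      finally have "\<bar>s\<bar> \<le> 6 * D * norm k" by simp
      then have "\<bar>s\<bar>\<^sup>2 \<le> (6 * D * norm k)\<^sup>2" by (intro power_mono) auto
      then have s2: "s\<^sup>2 \<le> 36 * D\<^sup>2 * (norm k)\<^sup>2" by (simp add: power_mult_distrib)
      have "\<bar>\<psi> x (y + k) - \<psi> x y - 2 * max 0 (T x y) * s\<bar> \<le> s\<^sup>2"
        unfolding \<psi>_def Tk by (rule pos_part_square_expansion)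
      moreover have "2 * max 0 (T x y) * s = 2 * max 0 (T x y) * (- 2 * ((y - x) \<bullet> k)) - 2 * max 0 (T x y) * (norm k)\<^sup>2"
        by (simp add: s_def algebra_simps)
      moreover have "2 * max 0 (T x y) * (norm k)\<^sup>2 \<le> 2 * (\<rho> x)\<^sup>2 * (norm k)\<^sup>2"
        using T_le by (intro mult_right_mono) auto
      moreover have "0 \<le> 2 * max 0 (T x y) * (norm k)\<^sup>2" by simp
      ultimately have "\<bar>\<psi> x (y + k) - \<psi> x y - 2 * max 0 (T x y) * (- 2 * ((y - x) \<bullet> k))\<bar> \<le> (36 * D\<^sup>2 + 2 * (\<rho> x)\<^sup>2) * (norm k)\<^sup>2"
        using s2 unfolding distrib_right by linarith
      then show "norm ((\<psi> x (y + k) - \<psi> x y - 2 * max 0 (T x y) * (- 2 * ((y - x) \<bullet> k))) *\<^sub>R e x) \<le> (36 * D\<^sup>2 + 2 * (\<rho> x)\<^sup>2) * (norm k)\<^sup>2"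
        using e[OF Cc[OF x]] by simp
    qed
    finally show ?thesis by (simp add: B0_def sum_distrib_right)
  qed
  \<comment> \<open>\<open>2 * D\<close> bounds the diameter, so \<open>B1 + B0 * (2 * D)\<close> is
    a Lipschitz constant: the quadratic remainder is absorbed into a linear one.\<close>
  define B where "B = 1 + Sm + B1 + B0 * (1 + 2 * D)"
  have BB: "B \<ge> 1" "Sm \<le> B" "B1 \<le> B" "B0 \<le> B" "B1 + B0 * (2 * D) \<le> B"
    using Sm0 B01 D by (auto simp: B_def distrib_left)
  have n_B: "norm (n y) \<le> B" for y using n_le[of y] BB(2) by linarith
  show ?thesis
  proof (rule that[of c t0 B n N])
    fix y t assume y: "y \<in> closure \<Omega>" "0 < t" "t \<le> t0"
    show "ball (y + t *\<^sub>R n y) (c * t) \<subseteq> \<Omega>"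
    proof
      fix w assume "w \<in> ball (y + t *\<^sub>R n y) (c * t)"
      then have w: "norm (w - (y + t *\<^sub>R n y)) < c * t" by (simp add: dist_norm norm_minus_commute)
      define z where "z = (w - (y + t *\<^sub>R n y)) /\<^sub>R t"
      have "norm z = norm (w - (y + t *\<^sub>R n y)) / t" unfolding z_def norm_scaleR using y by (simp add: divide_inverse_commute)
      also have "\<dots> < c" using w y(2) by (simp only: pos_divide_less_eq)
      finally have "norm z < c" .
      moreover have "y + t *\<^sub>R (n y + z) = w" using y by (simp add: z_def scaleR_add_right)
      ultimately show "w \<in> \<Omega>" using main[OF y, of z] by simp
    qed
  next
    fix x y assume xy: "x \<in> closure \<Omega>" "y \<in> closure \<Omega>"
    define k where "k = x - y"
    have x: "x = y + k" by (simp add: k_def)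
    have "norm (n x - n y) \<le> norm (n (y + k) - n y - N y k) + norm (N y k)"
      using norm_triangle_ineq[of "n (y + k) - n y - N y k" "N y k"] by (simp add: x)
    also have "\<dots> \<le> B0 * (norm k)\<^sup>2 + B1 * norm k"
      using xy by (intro add_mono N_exp N_le) (simp_all add: x)
    also have "B0 * (norm k)\<^sup>2 \<le> B0 * (2 * D * norm k)"
      using diam[OF xy] B01 unfolding k_def[symmetric] power2_eq_square by (intro mult_left_mono mult_right_mono) auto
    finally have "norm (n x - n y) \<le> (B1 + B0 * (2 * D)) * norm k" by (simp add: algebra_simps)
    also have "\<dots> \<le> B * norm k" using BB by (intro mult_right_mono) auto
    finally show "norm (n x - n y) \<le> B * norm (x - y)" by (simp add: k_def)
  next
    fix y k :: "real^'n" assume y: "y \<in> closure \<Omega>"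
    have "B1 * norm k \<le> B * norm k" using BB by (intro mult_right_mono) auto
    then show "norm (N y k) \<le> B * norm k" using N_le[OF y, of k] by linarith
    assume "y + k \<in> closure \<Omega>"
    have "B0 * (norm k)\<^sup>2 \<le> B * (norm k)\<^sup>2" using BB by (intro mult_right_mono) auto
    then show "norm (n (y + k) - n y - N y k) \<le> B * (norm k)\<^sup>2" using N_exp[OF y \<open>y + k \<in> closure \<Omega>\<close>] by linarith
  qed (use c t0 BB(1) n_B N_lin in auto)
qed

section \<open>Regularity and values at the boundary\<close>

text \<open>The interior estimate compares \<open>y + s n(y)\<close> with \<open>y + \<tau> s n(y)\<close> for a fixed \<open>\<tau> < 1\<close>. The resulting
  geometric series reaches \<open>y\<close> from a point at a distance from the boundary comparable to \<open>|x - y|\<close>.\<close>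

lemma holder_from_interior_estimate:
  fixes u :: "'a::real_normed_vector \<Rightarrow> real" and n :: "'a \<Rightarrow> 'a"
  assumes \<Omega>: "open \<Omega>" and c: "0 < c" and t0: "0 < t0" and B: "1 \<le> B"
    and field: "\<And>y t. y \<in> \<Omega> \<Longrightarrow> 0 < t \<Longrightarrow> t \<le> t0 \<Longrightarrow> ball (y + t *\<^sub>R n y) (c * t) \<subseteq> \<Omega>"
    and n_le: "\<And>y. y \<in> \<Omega> \<Longrightarrow> norm (n y) \<le> B"
    and n_lip: "\<And>x y. x \<in> \<Omega> \<Longrightarrow> y \<in> \<Omega> \<Longrightarrow> norm (n x - n y) \<le> B * norm (x - y)"
    and bdd: "\<And>x. x \<in> \<Omega> \<Longrightarrow> \<bar>u x\<bar> \<le> M" and \<alpha>: "0 < \<alpha>" and C: "C > 0"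
    and int: "\<And>x r y. \<lbrakk>0 < r; r \<le> 1; ball x r \<subseteq> \<Omega>; norm (y - x) \<le> r / 2\<rbrakk> \<Longrightarrow> u y \<le> u x + C * norm (y - x) powr \<alpha>"
  shows "\<exists>L>0. \<forall>x\<in>\<Omega>. \<forall>y\<in>\<Omega>. \<bar>u x - u y\<bar> \<le> L * norm (x - y) powr \<alpha>"
proof -
  \<comment> \<open>The interior estimate is one-sided. A point within \<open>r / 4\<close> of the
    centre is itself the centre of a ball of radius \<open>r / 2\<close>, so the roles can be
    exchanged.\<close>
  have int2: "\<bar>u y - u x\<bar> \<le> C * norm (y - x) powr \<alpha>"
    if r: "0 < r" "r \<le> 1" "ball x r \<subseteq> \<Omega>" "norm (y - x) \<le> r / 4" for x r y
  proof -
    have "ball y (r / 2) \<subseteq> ball x r"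
    proof
      fix w assume "w \<in> ball y (r / 2)"
      then show "w \<in> ball x r"
        using r norm_triangle_ineq[of "w - y" "y - x"] by (simp add: dist_norm norm_minus_commute)
    qed
    then have "u x \<le> u y + C * norm (x - y) powr \<alpha>" using r by (intro int[of "r / 2"]) (auto simp: norm_minus_commute)
    moreover have "u y \<le> u x + C * norm (y - x) powr \<alpha>" using r by (intro int[of r]) auto
    ultimately show ?thesis by (simp add: norm_minus_commute abs_le_iff)
  qed
  define t1 where "t1 = min t0 (1 / c)"
  have t1: "t1 > 0" "t1 \<le> t0" "\<And>t. t \<le> t1 \<Longrightarrow> c * t \<le> 1"
    using t0 c by (auto simp: t1_def pos_le_divide_eq mult.commute)
  \<comment> \<open>The step from \<open>w s\<close> to \<open>w (\<tau> * s)\<close> has length at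
    most \<open>\<theta> * B * s\<close>, a quarter of the radius \<open>c * s\<close> available
    around \<open>w s\<close>.\<close>
  define \<theta> where "\<theta> = min (1/2) (c / (4 * B))"
  define \<tau> where "\<tau> = 1 - \<theta>"
  have \<theta>: "0 < \<theta>" "\<theta> \<le> 1/2" "\<theta> * B \<le> c / 4"
  proof -
    show "0 < \<theta>" "\<theta> \<le> 1/2" using c B by (auto simp: \<theta>_def)
    have "\<theta> * B \<le> c / (4 * B) * B" using B by (intro mult_right_mono) (auto simp: \<theta>_def)
    then show "\<theta> * B \<le> c / 4" using B by simp
  qed
  have \<tau>: "0 < \<tau>" "\<tau> < 1" using \<theta> by (auto simp: \<tau>_def)
  have \<tau>\<alpha>: "\<tau> powr \<alpha> < 1" using powr_less_mono2[of \<alpha> \<tau> 1] \<tau> \<alpha> by simp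
  \<comment> \<open>The sum of the geometric series with ratio \<open>\<tau> powr \<alpha>\<close>;
    with it the bound for one step becomes a telescoping difference.\<close>
  define C' where "C' = C * (\<theta> * B) powr \<alpha> / (1 - \<tau> powr \<alpha>)"
  have C': "C' > 0" using C \<theta> B \<tau>\<alpha> by (simp add: C'_def)
  have step1: "\<bar>u (y + t *\<^sub>R n y) - u y\<bar> \<le> C' * t powr \<alpha>" if y: "y \<in> \<Omega>" and t: "0 < t" "t \<le> t1" for y t
  proof -
    define w where "w s = y + s *\<^sub>R n y" for s
    have one: "\<bar>u (w (\<tau> * s)) - u (w s)\<bar> \<le> C' * (s powr \<alpha> - (\<tau> * s) powr \<alpha>)" if s: "0 < s" "s \<le> t1" for s
    proof -
      have "w (\<tau> * s) - w s = (- (\<theta> * s)) *\<^sub>R n y" by (simp add: w_def \<tau>_def algebra_simps)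
      then have "norm (w (\<tau> * s) - w s) = (\<theta> * s) * norm (n y)" using \<theta> s by simp
      also have "\<dots> \<le> (\<theta> * s) * B" using n_le[OF y] \<theta> s by (intro mult_left_mono) auto
      finally have d: "norm (w (\<tau> * s) - w s) \<le> (\<theta> * B) * s" by (simp add: ac_simps)
      also have "\<dots> \<le> c / 4 * s" using \<theta> s by (intro mult_right_mono) auto
      finally have d4: "norm (w (\<tau> * s) - w s) \<le> c * s / 4" by simp
      have "ball (w s) (c * s) \<subseteq> \<Omega>" unfolding w_def using s t1 by (intro field[OF y]) auto
      then have "\<bar>u (w (\<tau> * s)) - u (w s)\<bar> \<le> C * norm (w (\<tau> * s) - w s) powr \<alpha>"
        using s t1(3)[OF s(2)] c d4 by (intro int2[of "c * s"]) auto
      also have "\<dots> \<le> C * ((\<theta> * B) * s) powr \<alpha>" using d C \<alpha> by (intro mult_left_mono powr_mono2) auto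
      also have "\<dots> = C * (\<theta> * B) powr \<alpha> * s powr \<alpha>" by (simp add: powr_mult ac_simps)
      also have "C * (\<theta> * B) powr \<alpha> = C' * (1 - \<tau> powr \<alpha>)" using \<tau>\<alpha> by (simp add: C'_def)
      also have "C' * (1 - \<tau> powr \<alpha>) * s powr \<alpha> = C' * (s powr \<alpha> - (\<tau> * s) powr \<alpha>)"
        by (simp add: powr_mult algebra_simps)
      finally show ?thesis .
    qed
    have tele: "\<bar>u (w (\<tau>^j * t)) - u (w t)\<bar> \<le> C' * (t powr \<alpha> - (\<tau>^j * t) powr \<alpha>)" for j
    proof (induction j)
      case (Suc j)
      have "\<tau>^j * t \<le> 1 * t" using \<tau> t by (intro mult_right_mono) (auto simp: power_le_one)
      then have "\<tau>^j * t \<le> t1" using t by linarith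
      then have "\<bar>u (w (\<tau> * (\<tau>^j * t))) - u (w (\<tau>^j * t))\<bar> \<le> C' * ((\<tau>^j * t) powr \<alpha> - (\<tau> * (\<tau>^j * t)) powr \<alpha>)"
        using \<tau> t by (intro one) auto
      then show ?case using Suc by (simp add: algebra_simps)
    qed simp
    \<comment> \<open>This radius depends on \<open>y\<close>, but it only closes the remaining gap
      between \<open>y\<close> and the last point of the chain. The gap vanishes as \<open>j\<close>
      grows, so the final constant is free of \<open>r\<close>.\<close>
    obtain r where r: "r > 0" "r \<le> 1" "ball y r \<subseteq> \<Omega>"
    proof -
      obtain r0 where "r0 > 0" "ball y r0 \<subseteq> \<Omega>" using \<Omega> y open_contains_ball by blast
      then show thesis using that[of "min r0 1"] by (auto simp: subset_iff)
    qed
    have tau0: "(\<lambda>j. \<tau>^j * (t * B)) \<longlonglongrightarrow> 0 * (t * B)" using \<tau> by (intro tendsto_intros LIMSEQ_power_zero) auto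
    then have "\<forall>\<^sub>F j in sequentially. \<tau>^j * (t * B) < r / 4" using r by (intro order_tendstoD(2)[OF tau0]) auto
    then have ev: "\<forall>\<^sub>F j in sequentially. \<bar>u (w t) - u y\<bar> \<le> C' * t powr \<alpha> + C * (\<tau>^j * (t * B)) powr \<alpha>"
    proof eventually_elim
      case (elim j)
      have "norm (w (\<tau>^j * t) - y) = \<tau>^j * t * norm (n y)" using \<tau> t by (simp add: w_def)
      also have "\<dots> \<le> \<tau>^j * t * B" using n_le[OF y] \<tau> t by (intro mult_left_mono) auto
      finally have d: "norm (w (\<tau>^j * t) - y) \<le> \<tau>^j * (t * B)" by simp
      then have "\<bar>u (w (\<tau>^j * t)) - u y\<bar> \<le> C * norm (w (\<tau>^j * t) - y) powr \<alpha>"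
        using elim by (intro int2[OF r]) auto
      also have "\<dots> \<le> C * (\<tau>^j * (t * B)) powr \<alpha>" using d C \<alpha> by (intro mult_left_mono powr_mono2) auto
      finally have "\<bar>u (w (\<tau>^j * t)) - u y\<bar> \<le> C * (\<tau>^j * (t * B)) powr \<alpha>" .
      moreover have "C' * (t powr \<alpha> - (\<tau>^j * t) powr \<alpha>) \<le> C' * t powr \<alpha>" using C' by simp
      ultimately show ?case using tele[of j] by linarith
    qed
    have "(\<lambda>j. (\<tau>^j * (t * B)) powr \<alpha>) \<longlonglongrightarrow> 0 powr \<alpha>"
      using \<tau> t B \<alpha> tau0 by (intro tendsto_powr' tendsto_const) auto
    then have "(\<lambda>j. C' * t powr \<alpha> + C * (\<tau>^j * (t * B)) powr \<alpha>) \<longlonglongrightarrow> C' * t powr \<alpha> + C * 0 powr \<alpha>"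
      by (intro tendsto_add tendsto_mult tendsto_const)
    then have "(\<lambda>j. C' * t powr \<alpha> + C * (\<tau>^j * (t * B)) powr \<alpha>) \<longlonglongrightarrow> C' * t powr \<alpha>" by simp
    from tendsto_lowerbound[OF this ev] show ?thesis by (simp add: w_def)
  qed
  \<comment> \<open>For \<open>d = norm (x - y) \<le> d0\<close> the height
    \<open>t = 8 / c * d\<close> is admissible, and the lifted points are at most
    \<open>2 * d = c * t / 4\<close> apart, within a quarter of the available ball.
    \<open>L2\<close> covers the remaining pairs by boundedness.\<close>
  define d0 where "d0 = c / 8 * min t1 (1 / B)"
  have d0: "d0 > 0" using c t1 B by (simp add: d0_def)
  define L1 where "L1 = 2 * C' * (8 / c) powr \<alpha> + C * 2 powr \<alpha>"
  define L2 where "L2 = 2 * \<bar>M\<bar> / d0 powr \<alpha>"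
  have L12: "L1 > 0" "L2 \<ge> 0" using C' C c by (auto simp: L1_def L2_def intro!: add_pos_pos)
  have "\<bar>u x - u y\<bar> \<le> (L1 + L2) * norm (x - y) powr \<alpha>" if x: "x \<in> \<Omega>" and y: "y \<in> \<Omega>" for x y
  proof (cases "norm (x - y) \<le> d0")
    case True
    show ?thesis
    proof (cases "x = y")
      case False
      define d where "d = norm (x - y)"
      have d: "d > 0" "d \<le> d0" using False True by (auto simp: d_def)
      define t where "t = 8 / c * d"
      have "8 / c * d \<le> 8 / c * d0" using d c by (intro mult_left_mono) auto
      also have "\<dots> = min t1 (1 / B)" using c by (simp add: d0_def)
      finally have t: "0 < t" "t \<le> t1" "t * B \<le> 1"
        using d c B by (auto simp: t_def pos_le_divide_eq)
      let ?x = "x + t *\<^sub>R n x" and ?y = "y + t *\<^sub>R n y"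
      have "norm (?y - ?x) \<le> norm (y - x) + norm (t *\<^sub>R (n y - n x))"
        using norm_triangle_ineq[of "y - x" "t *\<^sub>R (n y - n x)"] by (simp add: algebra_simps)
      also have "\<dots> \<le> d + t * (B * d)"
        using n_lip[OF y x] t by (simp add: d_def norm_minus_commute)
      also have "\<dots> \<le> d + 1 * d" using t d mult_right_mono[OF t(3), of d] by (simp add: mult.assoc)
      finally have xy: "norm (?y - ?x) \<le> 2 * d" by simp
      also have "2 * d = c * t / 4" using c by (simp add: t_def)
      finally have "norm (?y - ?x) \<le> c * t / 4" .
      then have "\<bar>u ?y - u ?x\<bar> \<le> C * norm (?y - ?x) powr \<alpha>"
        using t c t1 field[OF x t(1)] by (intro int2[of "c * t"]) auto
      also have "\<dots> \<le> C * (2 * d) powr \<alpha>" using xy C \<alpha> by (intro mult_left_mono powr_mono2) auto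
      finally have "\<bar>u x - u y\<bar> \<le> 2 * (C' * t powr \<alpha>) + C * (2 * d) powr \<alpha>"
        using step1[OF x t(1,2)] step1[OF y t(1,2)] by linarith
      also have "\<dots> = L1 * d powr \<alpha>" by (simp add: t_def L1_def powr_mult powr_divide algebra_simps)
      also have "\<dots> \<le> (L1 + L2) * d powr \<alpha>" using L12 by (intro mult_right_mono) auto
      finally show ?thesis by (simp add: d_def)
    qed simp
  next
    case False
    have "\<bar>u x - u y\<bar> \<le> 2 * \<bar>M\<bar>" using bdd[OF x] bdd[OF y] by linarith
    also have "\<dots> = L2 * d0 powr \<alpha>" using d0 by (simp add: L2_def)
    also have "\<dots> \<le> (L1 + L2) * norm (x - y) powr \<alpha>"
      using False d0 L12 \<alpha> by (intro mult_mono powr_mono2) auto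
    finally show ?thesis .
  qed
  then show ?thesis using L12 by (intro exI[of _ "L1 + L2"]) auto
qed

text \<open>The two-sided bound inside \<Omega> passes to the upper limit, both from above and from
  below, so boundary values given as upper limits inherit it. Between two boundary points an
  interior point is interposed that tends to one of them.\<close>

lemma holder_on_closure:
  fixes u :: "'a::real_normed_vector \<Rightarrow> real"
  assumes \<Omega>: "open \<Omega>" and \<alpha>: "\<alpha> > 0" and L: "L > 0"
    and hol: "\<And>x y. x \<in> \<Omega> \<Longrightarrow> y \<in> \<Omega> \<Longrightarrow> \<bar>u x - u y\<bar> \<le> L * norm (x - y) powr \<alpha>"
    and lim: "\<And>x. x \<in> frontier \<Omega> \<Longrightarrow> ereal (u x) = Limsup (at x within \<Omega>) (\<lambda>y. ereal (u y))"
    and xy: "x \<in> closure \<Omega>" "y \<in> closure \<Omega>"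
  shows "\<bar>u x - u y\<bar> \<le> L * norm (x - y) powr \<alpha>"
proof -
  have cont: "((\<lambda>z. L * norm (z - y) powr \<alpha>) \<longlongrightarrow> L * norm (x - y) powr \<alpha>) (at x within \<Omega>)" for x y
    using \<alpha> by (intro tendsto_intros tendsto_powr') auto
  have half: "\<bar>u x - u y\<bar> \<le> L * norm (x - y) powr \<alpha>" if x: "x \<in> closure \<Omega>" and y: "y \<in> \<Omega>" for x y
  proof (cases "x \<in> \<Omega>")
    case False
    then have xf: "x \<in> frontier \<Omega>" using x \<Omega> by (simp add: frontier_def interior_open)
    have nt: "at x within \<Omega> \<noteq> bot"
      using x False by (simp add: closure_def trivial_limit_within)
    let ?c = "L * norm (x - y) powr \<alpha>"
    have "u x \<le> u y + ?c"
    proof (rule field_le_epsilon)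
      fix \<epsilon> :: real assume "\<epsilon> > 0"
      have "\<forall>\<^sub>F z in at x within \<Omega>. L * norm (z - y) powr \<alpha> < ?c + \<epsilon>"
        using order_tendstoD(2)[OF cont] \<open>\<epsilon> > 0\<close> by simp
      moreover have "\<forall>\<^sub>F z in at x within \<Omega>. z \<in> \<Omega>" by (simp add: eventually_at_filter)
      ultimately have "\<forall>\<^sub>F z in at x within \<Omega>. ereal (u z) \<le> ereal (u y + ?c + \<epsilon>)"
      proof eventually_elim
        case (elim z) then show ?case using hol[OF elim(2) y] by simp
      qed
      then have "ereal (u x) \<le> ereal (u y + ?c + \<epsilon>)" unfolding lim[OF xf] by (rule Limsup_bounded)
      then show "u x \<le> u y + ?c + \<epsilon>" by simp
    qed
    moreover have "u y \<le> u x + ?c"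
    proof (rule field_le_epsilon)
      fix \<epsilon> :: real assume "\<epsilon> > 0"
      have "\<forall>\<^sub>F z in at x within \<Omega>. L * norm (z - y) powr \<alpha> < ?c + \<epsilon>"
        using order_tendstoD(2)[OF cont] \<open>\<epsilon> > 0\<close> by simp
      moreover have "\<forall>\<^sub>F z in at x within \<Omega>. z \<in> \<Omega>" by (simp add: eventually_at_filter)
      ultimately have "\<forall>\<^sub>F z in at x within \<Omega>. ereal (u y - ?c - \<epsilon>) \<le> ereal (u z)"
      proof eventually_elim
        case (elim z) then show ?case using hol[OF elim(2) y] by simp
      qed
      then have "ereal (u y - ?c - \<epsilon>) \<le> ereal (u x)" unfolding lim[OF xf] by (rule le_Limsup[OF nt])
      then show "u y \<le> u x + ?c + \<epsilon>" by simp
    qed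
    ultimately show ?thesis by (simp add: abs_le_iff)
  qed (rule hol[OF _ y])
  show ?thesis
  proof (cases "y \<in> \<Omega>")
    case False
    have nt: "at y within \<Omega> \<noteq> bot"
      using xy(2) False by (simp add: closure_def trivial_limit_within)
    have "((\<lambda>z. L * norm (z - x) powr \<alpha> + L * norm (z - y) powr \<alpha>) \<longlongrightarrow> L * norm (y - x) powr \<alpha> + L * norm (y - y) powr \<alpha>) (at y within \<Omega>)"
      by (intro tendsto_add cont)
    moreover have "\<forall>\<^sub>F z in at y within \<Omega>. \<bar>u x - u y\<bar> \<le> L * norm (z - x) powr \<alpha> + L * norm (z - y) powr \<alpha>"
    proof -
      have "\<forall>\<^sub>F z in at y within \<Omega>. z \<in> \<Omega>" by (simp add: eventually_at_filter)
      then show ?thesis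
      proof eventually_elim
        case (elim z)
        then show ?case using half[OF xy(1) elim] half[OF xy(2) elim] by (simp add: norm_minus_commute)
      qed
    qed
    ultimately have "\<bar>u x - u y\<bar> \<le> L * norm (y - x) powr \<alpha> + L * norm (y - y) powr \<alpha>"
      using tendsto_lowerbound nt by blast
    then show ?thesis by (simp add: norm_minus_commute)
  qed (rule half[OF xy(1)])
qed

text \<open>The test function can be made arbitrarily steep in the inward direction, where the gradient term
  dominates.\<close>

lemma subsolution_le_boundary_data:
  fixes u g :: "'a::euclidean_space \<Rightarrow> real"
  assumes K: "K1 > 0" "K2 > 0" "\<Gamma> \<ge> 0" and m: "m > 2"
    and usc: "usc_on (closure \<Omega>) u" and bdd: "\<And>x. x \<in> closure \<Omega> \<Longrightarrow> \<bar>u x\<bar> \<le> M"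
    and \<Omega>: "open \<Omega>"
    and sub: "\<And>x p H \<rho>. \<lbrakk>x \<in> closure \<Omega>; x \<in> frontier \<Omega> \<Longrightarrow> g x < u x; 0 < H; 0 < \<rho>;
      \<And>y. y \<in> closure \<Omega> \<Longrightarrow> norm (y - x) < \<rho> \<Longrightarrow> u y \<le> u x + p \<bullet> (y - x) + H / 2 * (norm (y - x))\<^sup>2\<rbrakk> \<Longrightarrow>
      K1 * norm p powr m \<le> K2 + \<Gamma> * H"
    and g: "continuous_on (frontier \<Omega>) g" and x0: "x0 \<in> frontier \<Omega>"
    and ext: "r > 0" "norm \<nu> \<ge> 1" "c \<ge> 0" "\<And>x. x \<in> closure \<Omega> \<Longrightarrow> x \<in> ball x0 r \<Longrightarrow> (x - x0) \<bullet> \<nu> \<ge> - c * (norm (x - x0))\<^sup>2"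
  shows "u x0 \<le> g x0"
proof (rule ccontr)
  assume "\<not> u x0 \<le> g x0"
  then have neg: "g x0 < u x0" by simp
  have x0c: "x0 \<in> closure \<Omega>" using x0 by (simp add: frontier_def)
  have "(g \<longlongrightarrow> g x0) (at x0 within frontier \<Omega>)" using g x0 by (simp add: continuous_on_def)
  then have "\<forall>\<^sub>F x in at x0 within frontier \<Omega>. g x < u x0" using neg by (rule order_tendstoD)
  then obtain r1 where r1: "r1 > 0" "\<And>x. x \<in> frontier \<Omega> \<Longrightarrow> dist x x0 < r1 \<Longrightarrow> g x < u x0"
    unfolding eventually_at using neg by (metis)
  \<comment> \<open>Small enough for the one-sided bound \<open>ext\<close>, for
    \<open>g < u x0\<close> on the nearby boundary, and for the quadratic part to change the slope
    by at most \<open>A / 2\<close>.\<close>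
  define r2 where "r2 = min (min r r1 / 2) (1 / (4 * (c + 1)))"
  have r2: "r2 > 0" "r2 < r" "r2 < r1" "r2 \<le> 1 / (4 * (c + 1))" using ext r1 by (auto simp: r2_def)
  \<comment> \<open>\<open>A \<ge> 2\<close> makes \<open>(A / 2) powr m\<close> at least
    \<open>(A / 2)\<^sup>2\<close>. The second summand pushes the maximum off the sphere of radius
    \<open>r2\<close>; the third lets the square of \<open>A\<close> beat the Hessian term, which is
    linear in \<open>A\<close>.\<close>
  define A where "A = 2 + 2 * \<bar>M\<bar> / r2\<^sup>2 + 4 * (K2 + 2 * \<Gamma> * (c + 1)) / K1"
  have p1: "2 * \<bar>M\<bar> / r2\<^sup>2 \<ge> 0" and p2: "4 * (K2 + 2 * \<Gamma> * (c + 1)) / K1 \<ge> 0" using K ext by auto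
  have A: "A \<ge> 2" "A > 2 * \<bar>M\<bar> / r2\<^sup>2" "A > 4 * (K2 + 2 * \<Gamma> * (c + 1)) / K1"
    unfolding A_def using p1 p2 by linarith+
  \<comment> \<open>The linear part may fall to \<open>- A * c * (norm (x - x0))\<^sup>2\<close>;
    the surplus 1 in \<open>c + 1\<close> keeps \<psi> positive away from \<open>x0\<close>.\<close>
  define \<psi> where "\<psi> x = A * ((x - x0) \<bullet> \<nu>) + A * (c + 1) * (norm (x - x0))\<^sup>2" for x
  have \<psi>_ge: "\<psi> x \<ge> A * (norm (x - x0))\<^sup>2" if "x \<in> closure \<Omega>" "x \<in> ball x0 r" for x
  proof -
    have "A * (- c * (norm (x - x0))\<^sup>2) \<le> A * ((x - x0) \<bullet> \<nu>)" using ext(4)[OF that] A by (intro mult_left_mono) auto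
    then show ?thesis by (simp add: \<psi>_def algebra_simps)
  qed
  define Z where "Z = closure \<Omega> \<inter> cball x0 r2"
  have "\<exists>x\<in>Z. \<forall>y\<in>Z. u y + - \<psi> y \<le> u x + - \<psi> x"
  proof (intro usc_on_attains_max usc_on_add_continuous usc_on_subset[OF usc])
    show "compact Z" unfolding Z_def by (intro closed_Int_compact) auto
    show "Z \<noteq> {}" using x0c r2 by (auto simp: Z_def)
    show "continuous_on Z (\<lambda>x. - \<psi> x)" unfolding \<psi>_def by (intro continuous_intros)
  qed (auto simp: Z_def)
  then obtain x where x: "x \<in> closure \<Omega>" "norm (x - x0) \<le> r2"
    and max: "\<And>y. y \<in> closure \<Omega> \<Longrightarrow> norm (y - x0) \<le> r2 \<Longrightarrow> u y - \<psi> y \<le> u x - \<psi> x"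
    by (auto simp: Z_def dist_norm norm_minus_commute)
  have big: "u x0 + \<psi> x \<le> u x" using max[OF x0c] r2 by (simp add: \<psi>_def)
  have xr: "x \<in> ball x0 r" using x r2 by (simp add: dist_norm norm_minus_commute)
  have \<psi>x: "A * (norm (x - x0))\<^sup>2 \<le> \<psi> x" by (rule \<psi>_ge[OF x(1) xr])
  have near: "norm (x - x0) < r2"
  proof (rule ccontr)
    assume "\<not> norm (x - x0) < r2"
    then have "norm (x - x0) = r2" using x(2) by simp
    then have "A * r2\<^sup>2 \<le> 2 * \<bar>M\<bar>" using \<psi>x big bdd[OF x(1)] bdd[OF x0c] by auto
    moreover have "2 * \<bar>M\<bar> < A * r2\<^sup>2" using A(2) r2 by (simp add: pos_divide_less_eq)
    ultimately show False by simp
  qed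
  have "0 \<le> A * (norm (x - x0))\<^sup>2" using A by simp
  then have ux: "u x0 \<le> u x" using \<psi>x big by linarith
  define p where "p = A *\<^sub>R (\<nu> + (2 * (c + 1)) *\<^sub>R (x - x0))"
  define H where "H = 2 * A * (c + 1)"
  have "K1 * norm p powr m \<le> K2 + \<Gamma> * H"
  proof (rule sub[OF x(1)])
    show "g x < u x" if "x \<in> frontier \<Omega>" using r1(2)[OF that] near r2 ux by (simp add: dist_norm)
    show "0 < H" using A ext by (simp add: H_def)
    show "0 < r2 - norm (x - x0)" using near by simp
    fix y assume y: "y \<in> closure \<Omega>" "norm (y - x) < r2 - norm (x - x0)"
    have "norm (y - x0) \<le> r2" using norm_triangle_ineq[of "y - x" "x - x0"] y(2) by simp
    then have "u y \<le> u x + (\<psi> y - \<psi> x)" using max[OF y(1)] by simp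
    also have "\<psi> y - \<psi> x = p \<bullet> (y - x) + H / 2 * (norm (y - x))\<^sup>2"
    proof -
      have yx: "y - x0 = (x - x0) + (y - x)" by simp
      have "(norm (y - x0))\<^sup>2 = (norm (x - x0))\<^sup>2 + 2 * ((x - x0) \<bullet> (y - x)) + (norm (y - x))\<^sup>2"
        unfolding yx norm_add_square by simp
      moreover have "(y - x0) \<bullet> \<nu> = (x - x0) \<bullet> \<nu> + \<nu> \<bullet> (y - x)"
        unfolding yx inner_add_left by (simp add: inner_commute)
      ultimately show ?thesis by (simp add: \<psi>_def p_def H_def inner_add_left distrib_left distrib_right)
    qed
    finally show "u y \<le> u x + p \<bullet> (y - x) + H / 2 * (norm (y - x))\<^sup>2" by simp
  qed
  moreover have "K2 + \<Gamma> * H < K1 * norm p powr m"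
  proof -
    have "2 * (c + 1) * norm (x - x0) \<le> 2 * (c + 1) * (1 / (4 * (c + 1)))"
      using x(2) r2 ext by (intro mult_left_mono) auto
    also have "\<dots> = 1/2" using ext by (simp add: field_simps)
    finally have "norm ((2 * (c + 1)) *\<^sub>R (x - x0)) \<le> 1/2" using ext by simp
    then have "1/2 \<le> norm (\<nu> + (2 * (c + 1)) *\<^sub>R (x - x0))"
      using ext norm_diff_ineq[of \<nu> "(2 * (c + 1)) *\<^sub>R (x - x0)"] by linarith
    then have "A * (1/2) \<le> A * norm (\<nu> + (2 * (c + 1)) *\<^sub>R (x - x0))" using A by (intro mult_left_mono) auto
    then have pA: "A / 2 \<le> norm p" using A by (simp add: p_def)
    have "(A / 2)\<^sup>2 = (A / 2) powr 2" using A by (simp add: powr_numeral)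
    also have "\<dots> \<le> (A / 2) powr m" using A m by (intro powr_mono) auto
    also have "\<dots> \<le> norm p powr m" using pA A m by (intro powr_mono2) auto
    finally have 1: "K1 * (A / 2)\<^sup>2 \<le> K1 * norm p powr m" using K by (intro mult_left_mono) auto
    have "K2 + \<Gamma> * H \<le> (K2 + 2 * \<Gamma> * (c + 1)) * A"
      using A K mult_left_mono[of 1 A K2] by (simp add: H_def algebra_simps)
    also have "\<dots> < K1 / 4 * A * A"
      using A K by (intro mult_strict_right_mono) (auto simp: pos_divide_less_eq algebra_simps)
    also have "\<dots> = K1 * (A / 2)\<^sup>2" by (simp add: power2_eq_square)
    finally show ?thesis using 1 by linarith
  qed
  ultimately show False by simp
qed

section \<open>Doubling of variables and comparison\<close>

lemma usc_on_compose:
  fixes f :: "'a::topological_space \<Rightarrow> 'b::topological_space"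
  assumes "usc_on S w" "continuous_on UNIV f"
  shows "usc_on (f -` S) (\<lambda>x. w (f x))"
  unfolding usc_on_def
proof (intro ballI allI impI)
  fix x a assume x: "x \<in> f -` S" "w (f x) < a"
  then have "\<forall>\<^sub>F z in at (f x) within S. w z < a" using assms(1) by (simp add: usc_on_def)
  then obtain V where V: "open V" "f x \<in> V" "\<And>z. z \<in> V \<Longrightarrow> z \<noteq> f x \<Longrightarrow> z \<in> S \<Longrightarrow> w z < a"
    unfolding eventually_at_topological by blast
  have "open (f -` V)" using assms(2) V(1) by (simp add: open_vimage continuous_on_eq_continuous_at)
  then show "\<forall>\<^sub>F y in at x within f -` S. w (f y) < a"
    unfolding eventually_at_topological using V(2) by (intro exI[of _ "f -` V"]) (auto, metis V(3) x(2))
qed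

lemma linear_symmetric_matrix:
  fixes X :: "real^'n \<Rightarrow> real^'n"
  assumes "linear X" "\<And>h k. h \<bullet> X k = X h \<bullet> k"
  shows "matrix X \<in> sym_mats" "matrix X *v h = X h"
proof -
  show A: "matrix X *v h = X h" for h using matrix_vector_mul(2)[OF assms(1)] by metis
  have "transpose (matrix X) *v x = matrix X *v x" for x
  proof (rule vector_eq_rdot[THEN iffD1, rule_format])
    fix y
    show "(transpose (matrix X) *v x) \<bullet> y = (matrix X *v x) \<bullet> y"
      by (simp add: transpose_matrix_vector dot_lmul_matrix A assms(2))
  qed
  then show "matrix X \<in> sym_mats" by (simp add: sym_mats_def matrix_eq)
qed

lemma sym_mats_scaleR: "A \<in> sym_mats \<Longrightarrow> t *\<^sub>R A \<in> sym_mats"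
  by (simp add: sym_mats_def transpose_def vec_eq_iff)

lemma sum_UNIV_sum: "(\<Sum>i\<in>(UNIV :: ('a::finite + 'b::finite) set). f i) = (\<Sum>i\<in>UNIV. f (Inl i)) + (\<Sum>i\<in>UNIV. f (Inr i))"
  using sum.Plus[of "UNIV::'a set" "UNIV::'b set" f] by (simp add: UNIV_Plus_UNIV)

lemma block_mat_form:
  fixes \<xi> :: "real^('n::finite + 'n)" and A B C D :: "real^'n^'n"
  defines "h \<equiv> (\<chi> i. \<xi> $ Inl i)" and "k \<equiv> (\<chi> i. \<xi> $ Inr i)"
  shows "\<xi> \<bullet> (block_mat A B C D *v \<xi>) = h \<bullet> (A *v h) + h \<bullet> (B *v k) + k \<bullet> (C *v h) + k \<bullet> (D *v k)"
    and "\<xi> \<bullet> \<xi> = (norm h)\<^sup>2 + (norm k)\<^sup>2"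
proof -
  have *: "\<xi> $ Inl i = h $ i" "\<xi> $ Inr i = k $ i" for i by (simp_all add: h_def k_def)
  show "\<xi> \<bullet> (block_mat A B C D *v \<xi>) = h \<bullet> (A *v h) + h \<bullet> (B *v k) + k \<bullet> (C *v h) + k \<bullet> (D *v k)"
    by (simp add: inner_vec_def matrix_vector_mult_def sum_UNIV_sum block_mat_def * distrib_left sum.distrib)
  show "\<xi> \<bullet> \<xi> = (norm h)\<^sup>2 + (norm k)\<^sup>2"
    unfolding power2_norm_eq_inner by (simp add: inner_vec_def sum_UNIV_sum *)
qed

text \<open>Splitting a vector into its two halves turns the matrix inequalities of H6 into the
  inequalities between quadratic forms that \<open>ishii_sums\<close> delivers.\<close>

lemma block_mat_bounds:
  fixes X Y :: "real^'n^'n"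
  assumes up: "\<And>h k. h \<bullet> (X *v h) - k \<bullet> (Y *v k) \<le> a * (norm (h - k))\<^sup>2 + b * ((norm h)\<^sup>2 + (norm k)\<^sup>2)"
    and low: "\<And>h k. - c * ((norm h)\<^sup>2 + (norm k)\<^sup>2) \<le> h \<bullet> (X *v h) - k \<bullet> (Y *v k)"
  shows "block_mat X 0 0 (- Y) \<preceq> a *\<^sub>R block_mat (mat 1) (- mat 1) (- mat 1) (mat 1) + b *\<^sub>R mat 1"
    and "(- c) *\<^sub>R mat 1 \<preceq> block_mat X 0 0 (- Y)"
proof -
  have neg: "(- A) *v x = - (A *v x)" for A :: "real^'n^'n" and x
    by (simp add: matrix_vector_mult_def vec_eq_iff sum_negf)
  have add: "(P + Q) *v \<xi> = P *v \<xi> + Q *v \<xi>" and scl: "(t *\<^sub>R P) *v \<xi> = t *\<^sub>R (P *v \<xi>)"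
    for P Q :: "real^('n+'n)^('n+'n)" and \<xi> t
    by (simp_all add: matrix_vector_mult_add_rdistrib scaleR_matrix_vector_assoc)
  have J: "h \<bullet> h + h \<bullet> (- k) + k \<bullet> (- h) + k \<bullet> k = (norm (h - k))\<^sup>2" for h k :: "real^'n"
    unfolding power2_norm_eq_inner by (simp add: inner_diff_left inner_diff_right)
  show "block_mat X 0 0 (- Y) \<preceq> a *\<^sub>R block_mat (mat 1) (- mat 1) (- mat 1) (mat 1) + b *\<^sub>R mat 1"
    unfolding loewner_le_def add scl inner_add_right inner_scaleR_right block_mat_form neg matrix_vector_mul_lid J
    using up by simp
  show "(- c) *\<^sub>R mat 1 \<preceq> block_mat X 0 0 (- Y)"
    unfolding loewner_le_def scl inner_scaleR_right block_mat_form neg matrix_vector_mul_lid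
    using low by simp
qed

text \<open>After translation to the maximum point and subtraction of affine parts, the maximum
  property bounds the sum of the two functions by a quadratic form, as \<open>ishii_sums\<close>
  requires. Since \<open>n\<close> has a quadratic remainder only, the penalty needs no second
  derivative of the field.\<close>

lemma doubling_jets:
  fixes S :: "(real^'n) set" and w v :: "real^'n \<Rightarrow> real" and n N :: "real^'n \<Rightarrow> real^'n" and a \<epsilon> B \<delta> :: real
  defines "Z \<equiv> \<lambda>x y. (1 / \<epsilon>) *\<^sub>R (x - y) - n y"
  assumes S: "closed S" and w: "usc_on S w" and v: "lsc_on S v" and xy: "xh \<in> S" "yh \<in> S"
    and pos: "a > 0" "\<epsilon> > 0" "B \<ge> 1" "\<delta> > 0" "\<delta> \<le> 1/2"
    and max: "\<And>x y. x \<in> S \<Longrightarrow> y \<in> S \<Longrightarrow> w x - v y - a * (norm (Z x y))\<^sup>2 \<le> w xh - v yh - a * (norm (Z xh yh))\<^sup>2"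
    and Z1: "norm (Z xh yh) \<le> 1"
    and N: "linear N" "\<And>k. norm (N k) \<le> B * norm k"
    and n_lip: "\<And>k. yh + k \<in> S \<Longrightarrow> norm (n (yh + k) - n yh) \<le> B * norm k"
    and n_exp: "\<And>k. yh + k \<in> S \<Longrightarrow> norm (n (yh + k) - n yh - N k) \<le> B * (norm k)\<^sup>2"
  obtains x y p q P Q X Y \<rho> where "x \<in> S" "y \<in> S" "norm (x - xh) < \<delta>" "norm (y - yh) < \<delta>"
    "P = (2 * a / \<epsilon>) *\<^sub>R Z xh yh" "norm (Q - P) \<le> B * \<epsilon> * norm P" "norm (p - P) < \<delta>" "norm (q - Q) < \<delta>"
    "w x \<ge> w xh - \<delta> * (1 + norm P)" "v y \<le> v yh + \<delta> * (1 + norm Q)" "X \<in> sym_mats" "Y \<in> sym_mats" "\<rho> > 0"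
    "\<And>\<eta>. \<eta> \<in> S \<Longrightarrow> norm (\<eta> - x) < \<rho> \<Longrightarrow> w \<eta> \<le> w x + p \<bullet> (\<eta> - x) + ((\<eta> - x) \<bullet> (X *v (\<eta> - x))) / 2"
    "\<And>\<eta>. \<eta> \<in> S \<Longrightarrow> norm (\<eta> - y) < \<rho> \<Longrightarrow> v y + q \<bullet> (\<eta> - y) + ((\<eta> - y) \<bullet> (Y *v (\<eta> - y))) / 2 \<le> v \<eta>"
    "\<And>h k. h \<bullet> (X *v h) - k \<bullet> (Y *v k) \<le> 8 * a / \<epsilon>\<^sup>2 * (norm (h - k))\<^sup>2 + (8 * a * (B\<^sup>2 + B) + \<delta>) * ((norm h)\<^sup>2 + (norm k)\<^sup>2)"
    "\<And>h k. - (32 * a / \<epsilon>\<^sup>2 + 16 * a * (B\<^sup>2 + B)) * ((norm h)\<^sup>2 + (norm k)\<^sup>2) \<le> h \<bullet> (X *v h) - k \<bullet> (Y *v k)"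
proof -
  define zh where "zh = Z xh yh"
  \<comment> \<open>\<open>P\<close> is the gradient of the penalty in \<open>x\<close> and
    \<open>Q\<close> is minus its gradient in \<open>y\<close>, with \<open>N\<close> as the
    derivative of \<open>n\<close>; the adjoint term stems from the dependence of the shift on
    \<open>y\<close>.\<close>
  define P where "P = (2 * a / \<epsilon>) *\<^sub>R zh"
  define Q where "Q = P + (2 * a) *\<^sub>R adjoint N zh"
  define K1 where "K1 = (\<lambda>h. xh + h) -` S \<inter> cball 0 1"
  define K2 where "K2 = (\<lambda>k. yh + k) -` S \<inter> cball 0 1"
  define u1 where "u1 h = w (xh + h) + (- w xh - P \<bullet> h)" for h
  define u2 where "u2 k = - v (yh + k) + (v yh + Q \<bullet> k)" for k
  \<comment> \<open>\<open>b1\<close> stems from \<open>\<Delta>1\<close> in the bound of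
    \<open>(norm (\<Delta>1 - \<Delta>2))\<^sup>2\<close> by twice the sum of the squares. In
    \<open>b2\<close> the term \<open>B\<^sup>2\<close> stems from \<open>\<Delta>2\<close> and
    \<open>B\<close> from the remainder of \<open>n\<close>, weighted by
    \<open>norm zh \<le> 1\<close>. Both carry the factor 2 of \<open>ishii_sums\<close>.\<close>
  define b1 where "b1 = 4 * a / \<epsilon>\<^sup>2"
  define b2 where "b2 = 4 * a * (B\<^sup>2 + B)"
  have b12: "b1 \<ge> 0" "b2 > 0" using pos by (auto simp: b1_def b2_def add_pos_pos)
  have K: "compact K1" "compact K2" "0 \<in> K1" "0 \<in> K2"
    unfolding K1_def K2_def using xy
    by (auto intro!: closed_Int_compact closed_vimage S continuous_intros)
  have usc: "usc_on K1 u1" "usc_on K2 u2"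
  proof -
    have "usc_on ((\<lambda>h. xh + h) -` S) (\<lambda>h. w (xh + h))" by (rule usc_on_compose[OF w]) (intro continuous_intros)
    then show "usc_on K1 u1" unfolding u1_def K1_def
      by (intro usc_on_add_continuous continuous_intros) (rule usc_on_subset, auto)
    have "usc_on S (\<lambda>y. - v y)" using v by (simp add: usc_on_minus)
    then have "usc_on ((\<lambda>k. yh + k) -` S) (\<lambda>k. - v (yh + k))" by (rule usc_on_compose) (intro continuous_intros)
    then show "usc_on K2 u2" unfolding u2_def K2_def
      by (intro usc_on_add_continuous continuous_intros) (rule usc_on_subset, auto)
  qed
  have u0: "u1 0 = 0" "u2 0 = 0" by (simp_all add: u1_def u2_def)
  have adj: "adjoint N zh \<bullet> k = zh \<bullet> N k" for k using adjoint_works[OF N(1), of k zh] by (simp add: inner_commute)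
  have sum: "2 * (u1 h + u2 k) \<le> b1 * (norm (h - k))\<^sup>2 + b2 * ((norm h)\<^sup>2 + (norm k)\<^sup>2)" if h: "h \<in> K1" and k: "k \<in> K2" for h k
  proof -
    have hS: "xh + h \<in> S" and kS: "yh + k \<in> S" using h k by (auto simp: K1_def K2_def)
    define \<Delta>1 where "\<Delta>1 = (1 / \<epsilon>) *\<^sub>R (h - k)"
    define \<Delta>2 where "\<Delta>2 = n (yh + k) - n yh"
    have Zd: "Z (xh + h) (yh + k) = zh + (\<Delta>1 - \<Delta>2)"
      by (simp add: Z_def zh_def \<Delta>1_def \<Delta>2_def algebra_simps)
    have "u1 h + u2 k \<le> a * (norm (zh + (\<Delta>1 - \<Delta>2)))\<^sup>2 - a * (norm zh)\<^sup>2 - P \<bullet> h + Q \<bullet> k"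
      using max[OF hS kS] unfolding Zd zh_def[symmetric] by (simp add: u1_def u2_def)
    also have "\<dots> = a * (norm (\<Delta>1 - \<Delta>2))\<^sup>2 + 2 * a * (zh \<bullet> (\<Delta>1 - \<Delta>2)) - P \<bullet> h + Q \<bullet> k"
      unfolding norm_add_square by (simp add: algebra_simps)
    finally have 0: "u1 h + u2 k \<le> a * (norm (\<Delta>1 - \<Delta>2))\<^sup>2 + 2 * a * (zh \<bullet> (\<Delta>1 - \<Delta>2)) - P \<bullet> h + Q \<bullet> k" .
    have "- (P \<bullet> h) + Q \<bullet> k = - (2 * a * (zh \<bullet> \<Delta>1)) + 2 * a * (zh \<bullet> N k)"
      by (simp add: P_def Q_def \<Delta>1_def inner_add_left adj inner_diff_right algebra_simps)
    moreover have "2 * a * (zh \<bullet> (\<Delta>1 - \<Delta>2)) = 2 * a * (zh \<bullet> \<Delta>1) - 2 * a * (zh \<bullet> (\<Delta>2 - N k)) - 2 * a * (zh \<bullet> N k)"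
      by (simp add: inner_diff_right algebra_simps)
    ultimately have 1: "u1 h + u2 k \<le> a * (norm (\<Delta>1 - \<Delta>2))\<^sup>2 - 2 * a * (zh \<bullet> (\<Delta>2 - N k))"
      using 0 by linarith
    have "(norm (\<Delta>1 - \<Delta>2))\<^sup>2 + (norm (\<Delta>1 + \<Delta>2))\<^sup>2 = 2 * (norm \<Delta>1)\<^sup>2 + 2 * (norm \<Delta>2)\<^sup>2"
      unfolding power2_norm_eq_inner by (simp add: inner_simps inner_commute)
    then have "(norm (\<Delta>1 - \<Delta>2))\<^sup>2 \<le> 2 * (norm \<Delta>1)\<^sup>2 + 2 * (norm \<Delta>2)\<^sup>2"
      using zero_le_power2[of "norm (\<Delta>1 + \<Delta>2)"] by linarith
    moreover have "(norm \<Delta>2)\<^sup>2 \<le> (B * norm k)\<^sup>2" unfolding \<Delta>2_def using n_lip[OF kS] by (intro power_mono) auto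
    moreover have "(norm \<Delta>1)\<^sup>2 = (norm (h - k))\<^sup>2 / \<epsilon>\<^sup>2" by (simp add: \<Delta>1_def power_divide)
    ultimately have "(norm (\<Delta>1 - \<Delta>2))\<^sup>2 \<le> 2 * ((norm (h - k))\<^sup>2 / \<epsilon>\<^sup>2) + 2 * (B\<^sup>2 * (norm k)\<^sup>2)"
      by (simp add: power_mult_distrib)
    then have 2: "a * (norm (\<Delta>1 - \<Delta>2))\<^sup>2 \<le> a * (2 * ((norm (h - k))\<^sup>2 / \<epsilon>\<^sup>2) + 2 * (B\<^sup>2 * (norm k)\<^sup>2))"
      using pos by (intro mult_left_mono) auto
    have "- (zh \<bullet> (\<Delta>2 - N k)) \<le> norm zh * norm (\<Delta>2 - N k)"
      using Cauchy_Schwarz_ineq2[of zh "\<Delta>2 - N k"] by linarith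
    also have "\<dots> \<le> 1 * (B * (norm k)\<^sup>2)"
      using Z1 n_exp[OF kS] unfolding \<Delta>2_def zh_def by (intro mult_mono) auto
    finally have "2 * a * (- (zh \<bullet> (\<Delta>2 - N k))) \<le> 2 * a * (B * (norm k)\<^sup>2)" using pos by (intro mult_left_mono) auto
    then have "u1 h + u2 k \<le> a * (2 * ((norm (h - k))\<^sup>2 / \<epsilon>\<^sup>2) + 2 * (B\<^sup>2 * (norm k)\<^sup>2)) + 2 * a * (B * (norm k)\<^sup>2)"
      using 1 2 by linarith
    also have "\<dots> = (b1 * (norm (h - k))\<^sup>2 + b2 * (norm k)\<^sup>2) / 2" by (simp add: b1_def b2_def algebra_simps)
    also have "\<dots> \<le> (b1 * (norm (h - k))\<^sup>2 + b2 * ((norm h)\<^sup>2 + (norm k)\<^sup>2)) / 2"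
      using b12 by (intro divide_right_mono add_left_mono mult_left_mono) auto
    finally show ?thesis by simp
  qed
  obtain h k p1 p2 X0 Y0 \<rho> where hk: "h \<in> K1" "k \<in> K2" "norm h < \<delta>" "norm k < \<delta>"
    and p12: "norm p1 < \<delta>" "norm p2 < \<delta>" and u12: "\<bar>u1 h\<bar> < \<delta>" "\<bar>u2 k\<bar> < \<delta>"
    and X0: "linear X0" "\<And>h k. h \<bullet> X0 k = X0 h \<bullet> k" and Y0: "linear Y0" "\<And>h k. h \<bullet> Y0 k = Y0 h \<bullet> k" and \<rho>: "\<rho> > 0"
    and t1: "\<And>\<eta>. \<eta> \<in> K1 \<Longrightarrow> norm (\<eta> - h) < \<rho> \<Longrightarrow> u1 \<eta> \<le> u1 h + p1 \<bullet> (\<eta> - h) + ((\<eta> - h) \<bullet> X0 (\<eta> - h)) / 2"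
    and t2: "\<And>\<eta>. \<eta> \<in> K2 \<Longrightarrow> norm (\<eta> - k) < \<rho> \<Longrightarrow> u2 \<eta> \<le> u2 k + p2 \<bullet> (\<eta> - k) + ((\<eta> - k) \<bullet> Y0 (\<eta> - k)) / 2"
    and up: "\<And>h k. h \<bullet> X0 h + k \<bullet> Y0 k \<le> 2 * b1 * (norm (h - k))\<^sup>2 + (2 * b2 + \<delta>) * ((norm h)\<^sup>2 + (norm k)\<^sup>2)"
    and low: "\<And>h k. - (8 * b1 + 4 * b2) * ((norm h)\<^sup>2 + (norm k)\<^sup>2) \<le> h \<bullet> X0 h + k \<bullet> Y0 k"
    using ishii_sums[OF K usc u0 b12 sum pos(4)] by blast
  define X where "X = matrix X0"
  define Y where "Y = - matrix Y0"
  note mX = linear_symmetric_matrix[OF X0, folded X_def] and mY = linear_symmetric_matrix[OF Y0]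
  have Yv: "Y *v z = - Y0 z" for z
    using mY(2)[of z] by (simp add: Y_def matrix_vector_mult_def vec_eq_iff sum_negf)
  have Ysym: "Y \<in> sym_mats" using sym_mats_scaleR[OF mY(1), of "- 1"] by (simp add: Y_def)
  have nQP: "norm (Q - P) \<le> B * \<epsilon> * norm P"
  proof -
    have "norm (adjoint N zh) * norm (adjoint N zh) = zh \<bullet> N (adjoint N zh)"
      using adj[of "adjoint N zh"] by (simp add: dot_square_norm power2_eq_square)
    also have "\<dots> \<le> norm zh * (B * norm (adjoint N zh))"
      using norm_cauchy_schwarz[of zh "N (adjoint N zh)"] mult_left_mono[OF N(2)[of "adjoint N zh"], of "norm zh"] by simp
    finally have "norm (adjoint N zh) \<le> B * norm zh"
      by (cases "norm (adjoint N zh) = 0") (use pos in \<open>auto simp: mult.assoc[symmetric] mult.commute\<close>)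
    then have "2 * a * norm (adjoint N zh) \<le> 2 * a * (B * norm zh)" using pos by (intro mult_left_mono) auto
    moreover have "norm (Q - P) = 2 * a * norm (adjoint N zh)" using pos by (simp add: Q_def)
    moreover have "norm P = 2 * a / \<epsilon> * norm zh" using pos by (simp add: P_def)
    ultimately show ?thesis using pos by simp
  qed
  show ?thesis
  \<comment> \<open>Together with \<open>\<delta> \<le> 1/2\<close> the radius \<open>1/2\<close>
    keeps the compared points in the unit balls that make \<open>K1\<close> and \<open>K2\<close>
    compact.\<close>
  proof (rule that[of "xh + h" "yh + k" P Q "P + p1" "Q - p2" X Y "min \<rho> (1/2)"])
    show "w (xh + h) \<ge> w xh - \<delta> * (1 + norm P)"
    proof -
      have "\<bar>P \<bullet> h\<bar> \<le> norm P * norm h" by (rule Cauchy_Schwarz_ineq2)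
      also have "\<dots> \<le> norm P * \<delta>" using hk by (intro mult_left_mono) auto
      finally show ?thesis using u12(1) by (simp add: u1_def algebra_simps)
    qed
    show "v (yh + k) \<le> v yh + \<delta> * (1 + norm Q)"
    proof -
      have "\<bar>Q \<bullet> k\<bar> \<le> norm Q * norm k" by (rule Cauchy_Schwarz_ineq2)
      also have "\<dots> \<le> norm Q * \<delta>" using hk by (intro mult_left_mono) auto
      finally show ?thesis using u12(2) by (simp add: u2_def algebra_simps)
    qed
    show "P = (2 * a / \<epsilon>) *\<^sub>R Z xh yh" by (simp add: P_def zh_def)
  next
    fix \<eta> assume \<eta>: "\<eta> \<in> S" "norm (\<eta> - (xh + h)) < min \<rho> (1/2)"
    have eq: "\<eta> - xh - h = \<eta> - (xh + h)" by simp
    have "norm (\<eta> - xh) \<le> 1"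
      using norm_triangle_ineq[of "\<eta> - (xh + h)" h] \<eta>(2) hk pos by simp
    then have "\<eta> - xh \<in> K1" using \<eta>(1) by (simp add: K1_def)
    from t1[OF this] \<eta>(2) have "u1 (\<eta> - xh) \<le> u1 h + p1 \<bullet> (\<eta> - (xh + h)) + ((\<eta> - (xh + h)) \<bullet> X0 (\<eta> - (xh + h))) / 2"
      unfolding eq by simp
    then show "w \<eta> \<le> w (xh + h) + (P + p1) \<bullet> (\<eta> - (xh + h)) + ((\<eta> - (xh + h)) \<bullet> (X *v (\<eta> - (xh + h)))) / 2"
      unfolding mX(2) by (simp add: u1_def inner_add_left inner_diff_right inner_add_right)
  next
    fix \<eta> assume \<eta>: "\<eta> \<in> S" "norm (\<eta> - (yh + k)) < min \<rho> (1/2)"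
    have eq: "\<eta> - yh - k = \<eta> - (yh + k)" by simp
    have "norm (\<eta> - yh) \<le> 1"
      using norm_triangle_ineq[of "\<eta> - (yh + k)" k] \<eta>(2) hk pos by simp
    then have "\<eta> - yh \<in> K2" using \<eta>(1) by (simp add: K2_def)
    from t2[OF this] \<eta>(2) have "u2 (\<eta> - yh) \<le> u2 k + p2 \<bullet> (\<eta> - (yh + k)) + ((\<eta> - (yh + k)) \<bullet> Y0 (\<eta> - (yh + k))) / 2"
      unfolding eq by simp
    then show "v (yh + k) + (Q - p2) \<bullet> (\<eta> - (yh + k)) + ((\<eta> - (yh + k)) \<bullet> (Y *v (\<eta> - (yh + k)))) / 2 \<le> v \<eta>"
    proof -
      define d where "d = \<eta> - (yh + k)"
      have "Q \<bullet> (\<eta> - yh) = Q \<bullet> d + Q \<bullet> k" by (simp add: d_def inner_diff_right inner_add_right)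
      moreover have "u2 (\<eta> - yh) \<le> u2 k + p2 \<bullet> d + (d \<bullet> Y0 d) / 2"
        using \<open>u2 (\<eta> - yh) \<le> _\<close> by (simp only: d_def)
      ultimately show ?thesis unfolding d_def[symmetric] Yv by (simp add: u2_def inner_diff_left)
    qed
  next
    fix h k
    show "h \<bullet> (X *v h) - k \<bullet> (Y *v k) \<le> 8 * a / \<epsilon>\<^sup>2 * (norm (h - k))\<^sup>2 + (8 * a * (B\<^sup>2 + B) + \<delta>) * ((norm h)\<^sup>2 + (norm k)\<^sup>2)"
      using up[of h k] unfolding mX(2) Yv by (simp add: b1_def b2_def mult.assoc)
    show "- (32 * a / \<epsilon>\<^sup>2 + 16 * a * (B\<^sup>2 + B)) * ((norm h)\<^sup>2 + (norm k)\<^sup>2) \<le> h \<bullet> (X *v h) - k \<bullet> (Y *v k)"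
      using low[of h k] unfolding mX(2) Yv by (simp add: b1_def b2_def mult.assoc)
  qed (use hk p12 nQP mX Ysym \<rho> in \<open>auto simp: K1_def K2_def\<close>)
qed

text \<open>The body of H6 once its constants are fixed. The name keeps the order of choices
  visible: \<beta> and \<open>C\<close> precede \<open>K\<close>, \<omega> comes after
  \<open>K\<close>, and \<mu> is quantified inside because \<omega> must not depend on it.\<close>

definition structure_modulus ::
  "real \<Rightarrow> real \<Rightarrow> (real \<Rightarrow> real) \<Rightarrow> real \<Rightarrow> real \<Rightarrow> (real \<Rightarrow> real) \<Rightarrow> (real^'n) set \<Rightarrow> 'n nonlinearity \<Rightarrow> bool" where
  "structure_modulus \<alpha> \<beta> C R K \<omega> \<Omega> F \<longleftrightarrow>
    (\<forall>\<mu>. 0 < \<mu> \<and> \<mu> < 1 \<longrightarrow>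
      (\<forall>\<epsilon>>0. \<forall>x\<in>closure \<Omega>. \<forall>y\<in>closure \<Omega>. \<forall>s p q. \<forall>X\<in>sym_mats. \<forall>Y\<in>sym_mats.
         \<bar>s\<bar> \<le> R \<and>
         (- (K * \<epsilon> powr (- 2 + \<alpha> - 2 * \<beta>))) *\<^sub>R mat 1 \<preceq> block_mat X 0 0 (- Y) \<and>
         block_mat X 0 0 (- Y) \<preceq>
           (K * \<epsilon> powr (- 2 + \<alpha> - 2 * \<beta>)) *\<^sub>R
              block_mat (mat 1) (- mat 1) (- mat 1) (mat 1)
           + (K * \<epsilon> powr (\<alpha> - 2 * \<beta>)) *\<^sub>R mat 1 \<and>
         norm (p - q) \<le> K * \<epsilon> * (1 + norm p + norm q) \<and>
         norm p + norm q \<le> K * \<epsilon> powr (\<alpha> - 1 - \<beta>) \<and>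
         norm (x - y) \<le> K * \<epsilon>
         \<longrightarrow>
         F Y q s y - \<mu> * F (inverse \<mu> *\<^sub>R X) (inverse \<mu> *\<^sub>R p) (inverse \<mu> * s) x
           \<le> \<omega> ((1 - \<mu>) + C \<mu> * \<epsilon>)))"

lemma H6_imp_structure_modulus:
  assumes "H6 \<alpha> \<Omega> F" "R > 0"
  shows "\<exists>\<beta> C. 0 < \<beta> \<and> \<beta> < \<alpha> \<and> (\<forall>\<mu>. 0 < \<mu> \<and> \<mu> < 1 \<longrightarrow> 0 \<le> C \<mu>) \<and>
    (\<forall>K>0. \<exists>\<omega>. (\<omega> \<longlongrightarrow> 0) (at_right 0) \<and> structure_modulus \<alpha> \<beta> C R K \<omega> \<Omega> F)"
proof -
  obtain \<beta> C where "0 < \<beta> \<and> \<beta> < \<alpha> \<and> (\<forall>\<mu>. 0 < \<mu> \<and> \<mu> < 1 \<longrightarrow> 0 \<le> C \<mu>) \<and>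
    (\<forall>R>0. \<forall>K>0. \<exists>\<omega>. (\<omega> \<longlongrightarrow> 0) (at_right 0) \<and> structure_modulus \<alpha> \<beta> C R K \<omega> \<Omega> F)"
    using assms(1) unfolding H6_def structure_modulus_def[symmetric] by (elim exE) (rule that)
  then show ?thesis using assms(2) by (intro exI[of _ \<beta>] exI[of _ C]) simp
qed

lemma structure_modulusD:
  assumes "structure_modulus \<alpha> \<beta> C R K \<omega> \<Omega> F"
    and "0 < \<mu>" "\<mu> < 1" "\<epsilon> > 0" "x \<in> closure \<Omega>" "y \<in> closure \<Omega>" "X \<in> sym_mats" "Y \<in> sym_mats" "\<bar>s\<bar> \<le> R"
    and "(- (K * \<epsilon> powr (- 2 + \<alpha> - 2 * \<beta>))) *\<^sub>R mat 1 \<preceq> block_mat X 0 0 (- Y)"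
    and "block_mat X 0 0 (- Y) \<preceq>
      (K * \<epsilon> powr (- 2 + \<alpha> - 2 * \<beta>)) *\<^sub>R block_mat (mat 1) (- mat 1) (- mat 1) (mat 1)
      + (K * \<epsilon> powr (\<alpha> - 2 * \<beta>)) *\<^sub>R mat 1"
    and "norm (p - q) \<le> K * \<epsilon> * (1 + norm p + norm q)" "norm p + norm q \<le> K * \<epsilon> powr (\<alpha> - 1 - \<beta>)"
    and "norm (x - y) \<le> K * \<epsilon>"
  shows "F Y q s y - \<mu> * F (inverse \<mu> *\<^sub>R X) (inverse \<mu> *\<^sub>R p) (inverse \<mu> * s) x \<le> \<omega> ((1 - \<mu>) + C \<mu> * \<epsilon>)"
  by (rule assms(1)[unfolded structure_modulus_def, rule_format]) (intro conjI assms(2-))+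

theorem theorem3p1:
  fixes \<Omega> :: "(real^'n) set"
    and F :: "real^'n^'n \<Rightarrow> real^'n \<Rightarrow> real \<Rightarrow> real^'n \<Rightarrow> real"
    and g u v :: "real^'n \<Rightarrow> real"
    and m :: real
  assumes domain: "open \<Omega>" "connected \<Omega>" "\<Omega> \<noteq> {}" "bounded \<Omega>" "C3_boundary \<Omega>"
    and g_cont: "continuous_on (frontier \<Omega>) g"
    and F_cont: "continuous_nonlinearity \<Omega> F"
    and F_elliptic: "elliptic \<Omega> F"
    and F_H4': "H4' m \<Omega> F"
    and F_H5: "H5 \<Omega> F"
    and F_H6: "H6 ((m - 2) / (m - 1)) \<Omega> F"
    and u_bdd: "bounded (u ` closure \<Omega>)"
    and u_usc: "usc_on (closure \<Omega>) u"
    and u_sub: "dirichlet_subsolution \<Omega> F g u"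
    and v_bdd: "bounded (v ` closure \<Omega>)"
    and v_lsc: "lsc_on (closure \<Omega>) v"
    and v_super: "dirichlet_supersolution \<Omega> F g v"
    and u_bdry: "\<And>x. x \<in> frontier \<Omega> \<Longrightarrow>
                   ereal (u x) = Limsup (at x within \<Omega>) (\<lambda>y. ereal (u y))"
  shows "\<forall>x\<in>closure \<Omega>. u x \<le> v x"
proof (rule ccontr)
  assume "\<not> ?thesis"
  then obtain xb where xb: "xb \<in> closure \<Omega>" "v xb < u xb" by (auto simp: not_le)

  \<comment> \<open>Exponent and bounds\<close>
  define \<alpha> where "\<alpha> = (m - 2) / (m - 1)"
  have m: "m > 2" using F_H4' by (simp add: H4'_def)
  have \<alpha>: "0 < \<alpha>" "\<alpha> < 1" "m * (1 - \<alpha>) = 2 - \<alpha>" using m by (auto simp: \<alpha>_def field_simps)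
  obtain Mu where Mu: "\<And>x. x \<in> closure \<Omega> \<Longrightarrow> \<bar>u x\<bar> \<le> Mu" using u_bdd by (force simp: bounded_iff)
  obtain Mv where Mv: "\<And>x. x \<in> closure \<Omega> \<Longrightarrow> \<bar>v x\<bar> \<le> Mv" using v_bdd by (force simp: bounded_iff)
  define M where "M = max 1 (max Mu Mv)"
  have M: "M \<ge> 1" "\<And>x. x \<in> closure \<Omega> \<Longrightarrow> \<bar>u x\<bar> \<le> M" "\<And>x. x \<in> closure \<Omega> \<Longrightarrow> \<bar>v x\<bar> \<le> M"
    using Mu Mv unfolding M_def by (auto intro: order_trans[OF _ max.cobounded2] order_trans[OF _ max.cobounded1] simp: le_max_iff_disj)
  \<comment> \<open>Twice the bound, so that it also covers \<open>inverse \<mu> * v y\<close> for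
    \<open>\<mu> \<ge> 1/2\<close>.\<close>
  define R where "R = 2 * M"
  have R: "R > 0" using M by (simp add: R_def)
  have sub_cl: "\<Omega> \<subseteq> closure \<Omega>" by (rule closure_subset)

  \<comment> \<open>Hoelder continuity and boundary values of the subsolution\<close>
  obtain K1 K2 \<Gamma> where K12: "K1 > 0" "K2 > 0" "\<Gamma> \<ge> 0"
    and scalar: "\<And>p s H x. x \<in> closure \<Omega> \<Longrightarrow> \<bar>s\<bar> \<le> R \<Longrightarrow> 0 < H \<Longrightarrow> F (H *\<^sub>R mat 1) p s x \<le> 0 \<Longrightarrow>
      K1 * norm p powr m \<le> K2 + \<Gamma> * H"
    using H4'_scalar_hessian[OF F_H4' R] by blast
  have sub_est: "K1 * norm p powr m \<le> K2 + \<Gamma> * H"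
    if x: "x \<in> closure \<Omega>" "x \<in> frontier \<Omega> \<Longrightarrow> g x < u x" and H: "0 < H" and \<rho>: "0 < \<rho>"
      and t: "\<And>y. y \<in> closure \<Omega> \<Longrightarrow> norm (y - x) < \<rho> \<Longrightarrow> u y \<le> u x + p \<bullet> (y - x) + H / 2 * (norm (y - x))\<^sup>2"
    for x p H \<rho>
  proof -
    have touch: "u y \<le> u x + p \<bullet> (y - x) + ((y - x) \<bullet> ((H *\<^sub>R mat 1) *v (y - x))) / 2"
      if "y \<in> closure \<Omega>" "norm (y - x) < \<rho>" for y
      using t[OF that] unfolding scalar_matrix_vector by (simp add: power2_norm_eq_inner)
    have "x \<in> \<Omega> \<or> x \<in> frontier \<Omega>" using x(1) domain(1) by (simp add: frontier_def interior_open)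
    then have "F (H *\<^sub>R mat 1) p (u x) x \<le> 0"
      using subsolution_quadratic[OF u_sub x(1) scalar_sym_mats \<rho> touch] x(2) by blast
    moreover have "\<bar>u x\<bar> \<le> R" using M(1) M(2)[OF x(1)] by (simp add: R_def)
    ultimately show ?thesis using scalar[OF x(1) _ H] by blast
  qed
  obtain C where C: "C > 0" "\<And>x r y. \<lbrakk>0 < r; r \<le> 1; ball x r \<subseteq> \<Omega>; norm (y - x) \<le> r / 2\<rbrakk> \<Longrightarrow>
    u y \<le> u x + C * norm (y - x) powr \<alpha>"
  proof (rule interior_holder_estimate[OF K12 \<alpha>(1,2) m \<alpha>(3) usc_on_subset[OF u_usc sub_cl] _ domain(1)])
    show "\<bar>u x\<bar> \<le> M" if "x \<in> \<Omega>" for x using M(2) that sub_cl by blast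
    fix x p H \<rho>
    assume x: "x \<in> \<Omega>" and H: "0 < H" "0 < \<rho>"
      and t: "\<And>h. norm h < \<rho> \<Longrightarrow> u (x + h) \<le> u x + p \<bullet> h + H / 2 * (norm h)\<^sup>2"
    show "K1 * norm p powr m \<le> K2 + \<Gamma> * H"
    proof (rule sub_est[OF _ _ H])
      show "x \<in> closure \<Omega>" using x sub_cl by blast
      show "g x < u x" if "x \<in> frontier \<Omega>" using that x domain(1) by (simp add: frontier_def interior_open)
      show "u y \<le> u x + p \<bullet> (y - x) + H / 2 * (norm (y - x))\<^sup>2" if "norm (y - x) < \<rho>" for y
        using t[OF that] by simp
    qed
  qed blast
  obtain n N c t0 B where n: "0 < c" "0 < t0" "1 \<le> B"
    and field: "\<And>y t. y \<in> closure \<Omega> \<Longrightarrow> 0 < t \<Longrightarrow> t \<le> t0 \<Longrightarrow> ball (y + t *\<^sub>R n y) (c * t) \<subseteq> \<Omega>"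
    and n_le: "\<And>y. y \<in> closure \<Omega> \<Longrightarrow> norm (n y) \<le> B"
    and n_lip: "\<And>x y. x \<in> closure \<Omega> \<Longrightarrow> y \<in> closure \<Omega> \<Longrightarrow> norm (n x - n y) \<le> B * norm (x - y)"
    and N: "\<And>y. linear (N y)" "\<And>y k. y \<in> closure \<Omega> \<Longrightarrow> norm (N y k) \<le> B * norm k"
    and n_exp: "\<And>y k. y \<in> closure \<Omega> \<Longrightarrow> y + k \<in> closure \<Omega> \<Longrightarrow> norm (n (y + k) - n y - N y k) \<le> B * (norm k)\<^sup>2"
    by (rule transversal_field[OF domain(1,4,5)]) (rule that)
  have "\<exists>L>0. \<forall>x\<in>\<Omega>. \<forall>y\<in>\<Omega>. \<bar>u x - u y\<bar> \<le> L * norm (x - y) powr \<alpha>"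
  proof (rule holder_from_interior_estimate[OF domain(1) n _ _ _ _ \<alpha>(1) C])
    show "ball (y + t *\<^sub>R n y) (c * t) \<subseteq> \<Omega>" if "y \<in> \<Omega>" "0 < t" "t \<le> t0" for y t
      using field that sub_cl by blast
    show "norm (n y) \<le> B" if "y \<in> \<Omega>" for y using n_le that sub_cl by blast
    show "norm (n x - n y) \<le> B * norm (x - y)" if "x \<in> \<Omega>" "y \<in> \<Omega>" for x y using n_lip that sub_cl by blast
    show "\<bar>u x\<bar> \<le> M" if "x \<in> \<Omega>" for x using M(2) that sub_cl by blast
  qed
  then obtain L where L: "L > 0" and hol0: "\<And>x y. x \<in> \<Omega> \<Longrightarrow> y \<in> \<Omega> \<Longrightarrow> \<bar>u x - u y\<bar> \<le> L * norm (x - y) powr \<alpha>"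
    by blast
  have hol: "\<bar>u x - u y\<bar> \<le> L * norm (x - y) powr \<alpha>" if "x \<in> closure \<Omega>" "y \<in> closure \<Omega>" for x y
    by (rule holder_on_closure[OF domain(1) \<alpha>(1) L hol0 u_bdry that])
  have u_le_g: "u x \<le> g x" if x: "x \<in> frontier \<Omega>" for x
  proof -
    obtain r \<nu> c where *: "r > 0" "norm \<nu> \<ge> 1" "c \<ge> 0" "\<And>y. y \<in> closure \<Omega> \<Longrightarrow> y \<in> ball x r \<Longrightarrow> (y - x) \<bullet> \<nu> \<ge> - c * (norm (y - x))\<^sup>2"
      using exterior_ball_function[OF domain(5) x] by blast
    show ?thesis
      by (rule subsolution_le_boundary_data[OF K12 m u_usc M(2) domain(1) sub_est g_cont x *])
  qed
  have u_cont: "continuous_on (closure \<Omega>) u"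
    unfolding continuous_on_def
  proof
    fix x assume x: "x \<in> closure \<Omega>"
    have "((\<lambda>y. L * norm (y - x) powr \<alpha>) \<longlongrightarrow> L * norm (x - x) powr \<alpha>) (at x within closure \<Omega>)"
      using \<alpha> by (intro tendsto_intros tendsto_powr') auto
    then have "((\<lambda>y. L * norm (y - x) powr \<alpha>) \<longlongrightarrow> 0) (at x within closure \<Omega>)" by simp
    moreover have "\<forall>\<^sub>F y in at x within closure \<Omega>. norm (u y - u x) \<le> L * norm (y - x) powr \<alpha>"
      unfolding eventually_at_filter using hol x by (intro always_eventually) auto
    ultimately have "((\<lambda>y. u y - u x) \<longlongrightarrow> 0) (at x within closure \<Omega>)" by (rule Lim_null_comparison[rotated])
    then show "(u \<longlongrightarrow> u x) (at x within closure \<Omega>)" by (rule LIM_zero_cancel)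
  qed
  have n_cont: "continuous_on (closure \<Omega>) n"
  proof (rule lipschitz_on_continuous_on)
    show "B-lipschitz_on (closure \<Omega>) n" using n_lip n(3) by (auto simp: lipschitz_on_def dist_norm)
  qed

  \<comment> \<open>Choice of the constants\<close>
  obtain \<gamma> where \<gamma>: "\<gamma> > 0" "\<And>x s s' p X. x \<in> closure \<Omega> \<Longrightarrow> X \<in> sym_mats \<Longrightarrow> - R \<le> s' \<Longrightarrow> s' \<le> s \<Longrightarrow> s \<le> R \<Longrightarrow>
      F X p s x - F X p s' x \<ge> \<gamma> * (s - s')"
    using F_H5 unfolding H5_def by blast
  obtain \<beta> C\<mu> where \<beta>: "0 < \<beta>" "\<beta> < \<alpha>" and C\<mu>: "\<And>\<mu>. 0 < \<mu> \<Longrightarrow> \<mu> < 1 \<Longrightarrow> 0 \<le> C\<mu> \<mu>"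
    and H6: "\<And>K. K > 0 \<Longrightarrow> \<exists>\<omega>. (\<omega> \<longlongrightarrow> 0) (at_right 0) \<and> structure_modulus \<alpha> \<beta> C\<mu> R K \<omega> \<Omega> F"
    using H6_imp_structure_modulus[OF F_H6 R] unfolding \<alpha>_def by blast
  have sL: "sqrt L > 0" using L by simp
  define B2 where "B2 = B\<^sup>2 + B"
  define T where "T = (2 + B) * (2 * sqrt L)"
  \<comment> \<open>One constant for all the conditions of H6, listed in \<open>K0\<close>: three
    for the matrices, \<open>B + 3\<close> for the distance and the difference of the slopes,
    \<open>T + 2\<close> for the size of the slopes.\<close>
  define K where "K = 40 + 16 * B2 + T + B"
  have "B2 \<ge> 0" "T \<ge> 0" using n(3) sL by (auto simp: B2_def T_def)
  then have K0: "K > 0" "K \<ge> 32 + 16 * B2" "K \<ge> 8" "K \<ge> 8 * B2 + 1" "K \<ge> B + 3" "K \<ge> T + 2"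
    using n(3) by (simp_all add: K_def)
  note K = K0[unfolded B2_def T_def]
  obtain \<omega> where \<omega>: "(\<omega> \<longlongrightarrow> 0) (at_right (0::real))" and struct: "structure_modulus \<alpha> \<beta> C\<mu> R K \<omega> \<Omega> F"
    using H6[OF K(1)] by blast
  define D where "D = u xb - v xb"
  have D: "D > 0" using xb by (simp add: D_def)
  have "\<forall>\<^sub>F t in at_right 0. \<omega> t < \<gamma> * D / 2" using order_tendstoD(2)[OF \<omega>, of "\<gamma> * D / 2"] \<gamma> D by simp
  then obtain t1 where t1: "t1 > 0" "\<And>t. 0 < t \<Longrightarrow> t < t1 \<Longrightarrow> \<omega> t < \<gamma> * D / 2"
    unfolding eventually_at_right_field by auto
  \<comment> \<open>\<mu> comes after \<open>K\<close>, \<omega> and \<open>t1\<close>, and before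
    \<epsilon>, because \<open>C\<mu> \<mu>\<close> may be unbounded as \<mu> tends to 1. One half
    of \<open>t1\<close> is for \<open>1 - \<mu>\<close>, the other for
    \<open>C\<mu> \<mu> * \<epsilon>\<close>.\<close>
  define \<mu> where "\<mu> = 1 - min (1/2) (min (t1 / 2) (D / (8 * M)))"
  have \<mu>: "1/2 \<le> \<mu>" "\<mu> < 1" "1 - \<mu> \<le> t1 / 2" "(1 - \<mu>) * M \<le> D / 8"
  proof -
    show "1/2 \<le> \<mu>" "\<mu> < 1" "1 - \<mu> \<le> t1 / 2" using t1 D M(1) by (auto simp: \<mu>_def)
    have "(1 - \<mu>) * M \<le> D / (8 * M) * M" using M(1) by (intro mult_right_mono) (auto simp: \<mu>_def)
    then show "(1 - \<mu>) * M \<le> D / 8" using M(1) by simp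
  qed
  have pw0: "((\<lambda>\<epsilon>. b * (a * \<epsilon>) powr e) \<longlongrightarrow> 0) (at_right (0::real))" if "e > 0" "a > 0" for a b e :: real
  proof -
    have "((\<lambda>\<epsilon>. a * \<epsilon>) \<longlongrightarrow> a * 0) (at_right (0::real))" by (intro tendsto_intros)
    then have "((\<lambda>\<epsilon>. (a * \<epsilon>) powr e) \<longlongrightarrow> 0 powr e) (at_right (0::real))"
      using that by (intro tendsto_powr' tendsto_const) (auto simp: eventually_at_right_field intro!: exI[of _ 1])
    then have "((\<lambda>\<epsilon>. b * (a * \<epsilon>) powr e) \<longlongrightarrow> b * 0 powr e) (at_right (0::real))" by (intro tendsto_mult tendsto_const)
    then show ?thesis by simp
  qed
  have "((\<lambda>\<epsilon>. C\<mu> \<mu> * \<epsilon>) \<longlongrightarrow> C\<mu> \<mu> * 0) (at_right (0::real))" by (intro tendsto_intros)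
  then have evC: "((\<lambda>\<epsilon>. C\<mu> \<mu> * \<epsilon>) \<longlongrightarrow> 0) (at_right (0::real))" by simp
  have ev_small: "\<forall>\<^sub>F \<epsilon> in at_right 0. \<epsilon> > 0 \<and> \<epsilon> < min 1 t0" if "t0 > 0" for t0 :: real
    using that by (auto simp: eventually_at_right_field intro!: exI[of _ "min 1 t0"])
  have "\<forall>\<^sub>F \<epsilon> in at_right 0. (\<epsilon> > 0 \<and> \<epsilon> < min 1 t0) \<and> sqrt L * (1 * \<epsilon>) powr \<beta> < min 1 c \<and>
      L * (B * \<epsilon>) powr \<alpha> < D / 8 \<and> L * (K * \<epsilon>) powr \<alpha> < D / 8 \<and> C\<mu> \<mu> * \<epsilon> < t1 / 2"
    using n K D \<alpha> \<beta> t1 by (intro eventually_conj ev_small order_tendstoD(2)[OF pw0] order_tendstoD(2)[OF evC]) auto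
  from eventually_happens'[OF trivial_limit_at_right_real this] obtain \<epsilon> where "(\<epsilon> > 0 \<and> \<epsilon> < min 1 t0) \<and>
      sqrt L * (1 * \<epsilon>) powr \<beta> < min 1 c \<and> L * (B * \<epsilon>) powr \<alpha> < D / 8 \<and> L * (K * \<epsilon>) powr \<alpha> < D / 8 \<and> C\<mu> \<mu> * \<epsilon> < t1 / 2" ..
  then have \<epsilon>: "\<epsilon> > 0" "\<epsilon> < 1" "\<epsilon> < t0" "sqrt L * \<epsilon> powr \<beta> < 1" "sqrt L * \<epsilon> powr \<beta> < c"
    "L * (B * \<epsilon>) powr \<alpha> < D / 8" "L * (K * \<epsilon>) powr \<alpha> < D / 8" "C\<mu> \<mu> * \<epsilon> < t1 / 2"
    by auto

  \<comment> \<open>The maximum of the doubled functional\<close>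
  define a where "a = \<epsilon> powr (\<alpha> - 2 * \<beta>)"
  have a: "a > 0" using \<epsilon> by (simp add: a_def)
  define Z where "Z x y = (1 / \<epsilon>) *\<^sub>R (x - y) - n y" for x y
  define \<Phi> where "\<Phi> x y = \<mu> * u x - v y - a * (norm (Z x y))\<^sup>2" for x y
  have cc: "compact (closure \<Omega>)" using domain(4) by (simp add: compact_closure)
  have "\<exists>z\<in>closure \<Omega> \<times> closure \<Omega>. \<forall>w\<in>closure \<Omega> \<times> closure \<Omega>.
      - v (snd w) + (\<mu> * u (fst w) - a * (norm (Z (fst w) (snd w)))\<^sup>2) \<le> - v (snd z) + (\<mu> * u (fst z) - a * (norm (Z (fst z) (snd z)))\<^sup>2)"
  proof (intro usc_on_attains_max usc_on_add_continuous)
    show "compact (closure \<Omega> \<times> closure \<Omega>)" by (intro compact_Times cc)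
    show "closure \<Omega> \<times> closure \<Omega> \<noteq> {}" using xb by auto
    have "usc_on (snd -` closure \<Omega>) (\<lambda>w::(real^'n)\<times>(real^'n). - v (snd w))"
      by (rule usc_on_compose) (use v_lsc in \<open>auto simp: usc_on_minus intro!: continuous_intros\<close>)
    then show "usc_on (closure \<Omega> \<times> closure \<Omega>) (\<lambda>w. - v (snd w))" by (rule usc_on_subset) auto
    show "continuous_on (closure \<Omega> \<times> closure \<Omega>) (\<lambda>w. \<mu> * u (fst w) - a * (norm (Z (fst w) (snd w)))\<^sup>2)"
      unfolding Z_def
      by (intro continuous_intros continuous_on_compose2[OF u_cont] continuous_on_compose2[OF n_cont]) auto
  qed
  then obtain z where z: "z \<in> closure \<Omega> \<times> closure \<Omega>" and z_max: "\<And>w. w \<in> closure \<Omega> \<times> closure \<Omega> \<Longrightarrow>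
      - v (snd w) + (\<mu> * u (fst w) - a * (norm (Z (fst w) (snd w)))\<^sup>2) \<le> - v (snd z) + (\<mu> * u (fst z) - a * (norm (Z (fst z) (snd z)))\<^sup>2)"
    by blast
  define xh yh where "xh = fst z" and "yh = snd z"
  have xyh: "xh \<in> closure \<Omega>" "yh \<in> closure \<Omega>" using z by (auto simp: xh_def yh_def)
  have max: "\<Phi> x y \<le> \<Phi> xh yh" if "x \<in> closure \<Omega>" "y \<in> closure \<Omega>" for x y
    using z_max[of "(x, y)"] that by (simp add: \<Phi>_def xh_def yh_def)
  have shift: "y + \<epsilon> *\<^sub>R n y \<in> closure \<Omega>" "Z (y + \<epsilon> *\<^sub>R n y) y = 0" if "y \<in> closure \<Omega>" for y
  proof -
    have "y + \<epsilon> *\<^sub>R n y \<in> ball (y + \<epsilon> *\<^sub>R n y) (c * \<epsilon>)" using n \<epsilon> by simp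
    then show "y + \<epsilon> *\<^sub>R n y \<in> closure \<Omega>" using field[OF that \<epsilon>(1)] \<epsilon>(3) sub_cl by (meson less_imp_le subsetD)
    show "Z (y + \<epsilon> *\<^sub>R n y) y = 0" using \<epsilon> by (simp add: Z_def)
  qed
  define zh where "zh = Z xh yh"
  have xh_eq: "xh = (yh + \<epsilon> *\<^sub>R n yh) + \<epsilon> *\<^sub>R zh" using \<epsilon> by (simp add: zh_def Z_def algebra_simps)
  have zh2: "a * (norm zh)\<^sup>2 \<le> L * (\<epsilon> * norm zh) powr \<alpha>"
  proof -
    have "a * (norm zh)\<^sup>2 \<le> \<mu> * (u xh - u (yh + \<epsilon> *\<^sub>R n yh))"
      using max[OF shift(1)[OF xyh(2)] xyh(2)] shift(2)[OF xyh(2)] unfolding \<Phi>_def zh_def by (simp add: algebra_simps)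
    also have "\<dots> \<le> \<mu> * \<bar>u xh - u (yh + \<epsilon> *\<^sub>R n yh)\<bar>" using \<mu> by (intro mult_left_mono) auto
    also have "\<dots> \<le> 1 * \<bar>u xh - u (yh + \<epsilon> *\<^sub>R n yh)\<bar>" using \<mu> by (intro mult_right_mono) auto
    also have "\<dots> \<le> L * norm (xh - (yh + \<epsilon> *\<^sub>R n yh)) powr \<alpha>" using hol[OF xyh(1) shift(1)[OF xyh(2)]] by simp
    also have "xh - (yh + \<epsilon> *\<^sub>R n yh) = \<epsilon> *\<^sub>R zh" using xh_eq by (metis add_diff_cancel_left')
    finally show ?thesis using \<epsilon> by simp
  qed
  have zh3: "(norm zh)\<^sup>2 \<le> (sqrt L * \<epsilon> powr \<beta>)\<^sup>2 * norm zh powr \<alpha>"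
  proof -
    have "\<epsilon> powr \<alpha> = a * (\<epsilon> powr \<beta>)\<^sup>2"
      unfolding a_def power2_eq_square by (simp flip: powr_add)
    then have "a * (norm zh)\<^sup>2 \<le> a * (L * (\<epsilon> powr \<beta>)\<^sup>2 * norm zh powr \<alpha>)"
      using zh2 by (simp add: powr_mult ac_simps)
    then have "(norm zh)\<^sup>2 \<le> L * (\<epsilon> powr \<beta>)\<^sup>2 * norm zh powr \<alpha>" using a by (simp only: mult_le_cancel_left_pos)
    then show ?thesis using L by (simp add: power_mult_distrib)
  qed
  \<comment> \<open>A norm above 1 would give
    \<open>norm zh powr \<alpha> \<le> (norm zh)\<^sup>2\<close>, impossible with a factor below 1
    in \<open>zh3\<close>. After that the crude bound \<open>norm zh powr \<alpha> \<le> 1\<close>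
    is enough for \<open>zh_le\<close>.\<close>
  have zh1: "norm zh \<le> 1"
  proof (rule ccontr)
    assume "\<not> norm zh \<le> 1"
    then have g1: "norm zh > 1" by simp
    have "norm zh powr \<alpha> \<le> norm zh powr 2" using g1 \<alpha> by (intro powr_mono) auto
    then have "norm zh powr \<alpha> \<le> (norm zh)\<^sup>2" using g1 by (simp add: powr_numeral)
    then have "(sqrt L * \<epsilon> powr \<beta>)\<^sup>2 * norm zh powr \<alpha> \<le> (sqrt L * \<epsilon> powr \<beta>)\<^sup>2 * (norm zh)\<^sup>2" by (intro mult_left_mono) auto
    then have "(norm zh)\<^sup>2 \<le> (sqrt L * \<epsilon> powr \<beta>)\<^sup>2 * (norm zh)\<^sup>2" using zh3 by linarith
    moreover have "(sqrt L * \<epsilon> powr \<beta>)\<^sup>2 < 1" using \<epsilon>(1,4) sL by (simp add: power_less_one_iff)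
    then have "(sqrt L * \<epsilon> powr \<beta>)\<^sup>2 * (norm zh)\<^sup>2 < 1 * (norm zh)\<^sup>2" using g1 by (intro mult_strict_right_mono) auto
    ultimately show False by simp
  qed
  have zh_le: "norm zh \<le> sqrt L * \<epsilon> powr \<beta>"
  proof -
    have "norm zh powr \<alpha> \<le> 1 powr \<alpha>" using zh1 \<alpha> by (intro powr_mono2) auto
    then have "(sqrt L * \<epsilon> powr \<beta>)\<^sup>2 * norm zh powr \<alpha> \<le> (sqrt L * \<epsilon> powr \<beta>)\<^sup>2 * 1" by (intro mult_left_mono) auto
    then have "(norm zh)\<^sup>2 \<le> (sqrt L * \<epsilon> powr \<beta>)\<^sup>2" using zh3 by linarith
    then show ?thesis by (rule power2_le_imp_le) (use sL in simp)
  qed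
  have xh_in: "xh \<in> \<Omega>"
  proof -
    have "norm (\<epsilon> *\<^sub>R zh) < c * \<epsilon>" using zh_le \<epsilon>(1,5) by simp
    then have "xh \<in> ball (yh + \<epsilon> *\<^sub>R n yh) (c * \<epsilon>)" unfolding xh_eq by (simp add: dist_norm)
    then show ?thesis using field[OF xyh(2) \<epsilon>(1)] \<epsilon>(3) by auto
  qed
  then obtain \<delta>1 where \<delta>1: "\<delta>1 > 0" "ball xh \<delta>1 \<subseteq> \<Omega>" using domain(1) open_contains_ball by blast
  \<comment> \<open>Two losses of \<open>D / 8\<close>: one from moving \<open>xb\<close> inwards
    along the field, one from the factor \<mu>.\<close>
  have low: "\<mu> * u xh - v yh \<ge> 3 / 4 * D"
  proof -
    have "\<Phi> (xb + \<epsilon> *\<^sub>R n xb) xb \<le> \<Phi> xh yh" by (rule max[OF shift(1)[OF xb(1)] xb(1)])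
    then have "\<mu> * u (xb + \<epsilon> *\<^sub>R n xb) - v xb \<le> \<mu> * u xh - v yh"
      using shift(2)[OF xb(1)] mult_nonneg_nonneg[OF less_imp_le[OF a] zero_le_power2[of "norm (Z xh yh)"]] by (simp add: \<Phi>_def)
    moreover have "\<bar>u (xb + \<epsilon> *\<^sub>R n xb) - u xb\<bar> \<le> D / 8"
    proof -
      have "\<bar>u (xb + \<epsilon> *\<^sub>R n xb) - u xb\<bar> \<le> L * norm (\<epsilon> *\<^sub>R n xb) powr \<alpha>"
        using hol[OF shift(1)[OF xb(1)] xb(1)] by simp
      also have "\<dots> \<le> L * (B * \<epsilon>) powr \<alpha>"
        using n_le[OF xb(1)] L \<alpha> \<epsilon>(1) by (intro mult_left_mono powr_mono2) (auto simp: mult.commute)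
      finally show ?thesis using \<epsilon>(6) by linarith
    qed
    then have "u xb - u (xb + \<epsilon> *\<^sub>R n xb) \<le> D / 8" by linarith
    then have "\<mu> * (u xb - u (xb + \<epsilon> *\<^sub>R n xb)) \<le> \<mu> * (D / 8)" using \<mu> by (intro mult_left_mono) auto
    moreover have "\<mu> * (D / 8) \<le> 1 * (D / 8)" using \<mu> D by (intro mult_right_mono) auto
    moreover have "(1 - \<mu>) * u xb \<le> (1 - \<mu>) * M" using M(2)[OF xb(1)] \<mu> by (intro mult_left_mono) (auto simp: abs_le_iff)
    moreover have "(1 - \<mu>) * u xb = u xb - \<mu> * u xb" by (simp add: left_diff_distrib)
    moreover have "u xb - v xb = D" by (simp add: D_def)
    ultimately show ?thesis using \<mu>(4) unfolding right_diff_distrib[of \<mu> "u xb"] by linarith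
  qed

  \<comment> \<open>Jets near the maximum point\<close>
  define P0 where "P0 = (2 * a / \<epsilon>) *\<^sub>R zh"
  define G where "G = 1 + (1 + B * \<epsilon>) * norm P0"
  have G: "G \<ge> 1" using n(3) \<epsilon>(1) by (simp add: G_def)
  \<comment> \<open>\<delta> has to be chosen before the jets exist; the slope \<open>P0\<close> at
    the maximum is already known, and \<open>G\<close> bounds what it contributes. The entries serve
    in turn the radius in \<open>doubling_jets\<close>, distances and slopes, the matrices,
    \<open>x \<in> \<Omega>\<close>, and a loss of at most \<open>D / 16\<close> at each of the two
    points.\<close>
  define \<delta> where "\<delta> = min (min (1/2) (min \<epsilon> a)) (min \<delta>1 (D / (16 * G)))"
  have \<delta>: "\<delta> > 0" "\<delta> \<le> 1/2" "\<delta> \<le> \<epsilon>" "\<delta> \<le> a" "\<delta> \<le> \<delta>1" "\<delta> * G \<le> D / 16"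
  proof -
    show "\<delta> > 0" "\<delta> \<le> 1/2" "\<delta> \<le> \<epsilon>" "\<delta> \<le> a" "\<delta> \<le> \<delta>1" using \<epsilon>(1) a \<delta>1 D G by (auto simp: \<delta>_def)
    have "\<delta> * G \<le> D / (16 * G) * G" using G by (intro mult_right_mono) (auto simp: \<delta>_def)
    then show "\<delta> * G \<le> D / 16" using G by simp
  qed
  obtain x y p q P Q X Y \<rho> where xy: "x \<in> closure \<Omega>" "y \<in> closure \<Omega>" "norm (x - xh) < \<delta>" "norm (y - yh) < \<delta>"
    and P: "P = (2 * a / \<epsilon>) *\<^sub>R ((1 / \<epsilon>) *\<^sub>R (xh - yh) - n yh)" and QP: "norm (Q - P) \<le> B * \<epsilon> * norm P"
    and pq: "norm (p - P) < \<delta>" "norm (q - Q) < \<delta>"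
    and ux: "\<mu> * u x \<ge> \<mu> * u xh - \<delta> * (1 + norm P)" and vy: "v y \<le> v yh + \<delta> * (1 + norm Q)"
    and XY: "X \<in> sym_mats" "Y \<in> sym_mats" and \<rho>: "\<rho> > 0"
    and tu: "\<And>\<eta>. \<eta> \<in> closure \<Omega> \<Longrightarrow> norm (\<eta> - x) < \<rho> \<Longrightarrow> \<mu> * u \<eta> \<le> \<mu> * u x + p \<bullet> (\<eta> - x) + ((\<eta> - x) \<bullet> (X *v (\<eta> - x))) / 2"
    and tv: "\<And>\<eta>. \<eta> \<in> closure \<Omega> \<Longrightarrow> norm (\<eta> - y) < \<rho> \<Longrightarrow> v y + q \<bullet> (\<eta> - y) + ((\<eta> - y) \<bullet> (Y *v (\<eta> - y))) / 2 \<le> v \<eta>"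
    and up: "\<And>h k. h \<bullet> (X *v h) - k \<bullet> (Y *v k) \<le> 8 * a / \<epsilon>\<^sup>2 * (norm (h - k))\<^sup>2 + (8 * a * (B\<^sup>2 + B) + \<delta>) * ((norm h)\<^sup>2 + (norm k)\<^sup>2)"
    and lo: "\<And>h k. - (32 * a / \<epsilon>\<^sup>2 + 16 * a * (B\<^sup>2 + B)) * ((norm h)\<^sup>2 + (norm k)\<^sup>2) \<le> h \<bullet> (X *v h) - k \<bullet> (Y *v k)"
  proof (rule doubling_jets[OF closed_closure usc_on_cmult[OF u_usc, of \<mu>] v_lsc xyh a \<epsilon>(1) n(3) \<delta>(1,2) _ _ N(1)[of yh] N(2)[OF xyh(2)]])
    show "0 < \<mu>" using \<mu> by simp
    show "\<mu> * u x - v y - a * (norm ((1 / \<epsilon>) *\<^sub>R (x - y) - n y))\<^sup>2 \<le> \<mu> * u xh - v yh - a * (norm ((1 / \<epsilon>) *\<^sub>R (xh - yh) - n yh))\<^sup>2"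
      if "x \<in> closure \<Omega>" "y \<in> closure \<Omega>" for x y using max[OF that] by (simp add: \<Phi>_def Z_def)
    show "norm ((1 / \<epsilon>) *\<^sub>R (xh - yh) - n yh) \<le> 1" using zh1 by (simp add: zh_def Z_def)
    show "norm (n (yh + k) - n yh) \<le> B * norm k" if "yh + k \<in> closure \<Omega>" for k
      using n_lip[OF that xyh(2)] by simp
    show "norm (n (yh + k) - n yh - N yh k) \<le> B * (norm k)\<^sup>2" if "yh + k \<in> closure \<Omega>" for k
      by (rule n_exp[OF xyh(2) that])
  qed (rule that)
  have PP0: "P = P0" by (simp add: P P0_def zh_def Z_def)
  have nQ: "norm Q \<le> (1 + B * \<epsilon>) * norm P" using QP norm_triangle_ineq2[of Q P] by (simp add: distrib_right)
  have PG: "1 + norm P \<le> G" "1 + norm Q \<le> G"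
  proof -
    have "1 * norm P \<le> (1 + B * \<epsilon>) * norm P" using n(3) \<epsilon>(1) by (intro mult_right_mono) auto
    then show "1 + norm P \<le> G" by (simp add: G_def PP0)
    show "1 + norm Q \<le> G" using nQ by (simp add: G_def PP0)
  qed
  have gap: "\<mu> * u x - v y \<ge> D / 2"
  proof -
    have "\<delta> * (1 + norm P) \<le> \<delta> * G" "\<delta> * (1 + norm Q) \<le> \<delta> * G" using PG \<delta>(1) by auto
    then show ?thesis using ux vy low \<delta>(6) D by linarith
  qed
  have x_in: "x \<in> \<Omega>" using xy(3) \<delta>(5) \<delta>1(2) by (auto simp: dist_norm norm_minus_commute)
  have dist_xy: "norm (x - y) \<le> K * \<epsilon>"
  proof -
    have "norm (xh - yh) \<le> \<epsilon> * B + \<epsilon> * 1"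
    proof -
      have "xh - yh = \<epsilon> *\<^sub>R n yh + \<epsilon> *\<^sub>R zh" using xh_eq by (metis add.assoc add_diff_cancel_left')
      then have "norm (xh - yh) \<le> \<epsilon> * norm (n yh) + \<epsilon> * norm zh"
        using norm_triangle_ineq[of "\<epsilon> *\<^sub>R n yh" "\<epsilon> *\<^sub>R zh"] \<epsilon>(1) by simp
      also have "\<dots> \<le> \<epsilon> * B + \<epsilon> * 1" using n_le[OF xyh(2)] zh1 \<epsilon>(1) by (intro add_mono mult_left_mono) auto
      finally show ?thesis .
    qed
    moreover have "norm (x - y) \<le> norm (x - xh) + norm (xh - yh) + norm (y - yh)"
      using dist_triangle[of x y xh] dist_triangle[of xh y yh] unfolding dist_norm
      by (simp add: norm_minus_commute[of yh y])
    ultimately have "norm (x - y) \<le> (B + 3) * \<epsilon>" using xy(3,4) \<delta>(3) by (simp add: algebra_simps)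
    also have "\<dots> \<le> K * \<epsilon>" using K \<epsilon>(1) by (intro mult_right_mono) auto
    finally show ?thesis .
  qed
  \<comment> \<open>Here the boundary inequality for \<open>u\<close> enters: the gap
    \<open>D / 2\<close> exceeds the two errors of \<open>D / 8\<close> from the Hoelder bound and
    from \<mu>, so \<open>v y < u y \<le> g y\<close>.\<close>
  have v_lt_g: "v y < g y" if "y \<in> frontier \<Omega>"
  proof -
    have "u x - u y \<le> L * (K * \<epsilon>) powr \<alpha>"
    proof -
      have "u x - u y \<le> L * norm (x - y) powr \<alpha>" using hol[OF xy(1,2)] by linarith
      also have "\<dots> \<le> L * (K * \<epsilon>) powr \<alpha>" using dist_xy L \<alpha> by (intro mult_left_mono powr_mono2) auto
      finally show ?thesis .
    qed
    moreover have "- ((1 - \<mu>) * M) \<le> (1 - \<mu>) * u x"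
      using mult_left_mono[of "- M" "u x" "1 - \<mu>"] M(2)[OF xy(1)] \<mu> by simp
    moreover have "(1 - \<mu>) * u x = u x - \<mu> * u x" by (simp add: left_diff_distrib)
    ultimately have "v y < u y" using gap \<mu>(4) \<epsilon>(7) D by linarith
    then show ?thesis using u_le_g[OF that] by linarith
  qed

  \<comment> \<open>Contradiction with the structure condition\<close>
  have \<mu>0: "\<mu> > 0" using \<mu> by simp
  have Fv: "F Y q (v y) y \<ge> 0"
  proof -
    have "y \<in> \<Omega> \<or> y \<in> frontier \<Omega>" using xy(2) domain(1) by (simp add: frontier_def interior_open)
    then show ?thesis using supersolution_quadratic[OF v_super xy(2) XY(2) \<rho> tv] v_lt_g by blast
  qed
  have cancel: "inverse \<mu> * (\<mu> * t) = t" for t using \<mu>0 by (simp flip: mult.assoc)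
  have Fu: "F (inverse \<mu> *\<^sub>R X) (inverse \<mu> *\<^sub>R p) (u x) x \<le> 0"
  proof (rule subsolution_quadratic(1)[OF u_sub xy(1) sym_mats_scaleR[OF XY(1)] \<rho> _ x_in])
    fix \<eta> assume "\<eta> \<in> closure \<Omega>" "norm (\<eta> - x) < \<rho>"
    then have "inverse \<mu> * (\<mu> * u \<eta>) \<le> inverse \<mu> * (\<mu> * u x + p \<bullet> (\<eta> - x) + ((\<eta> - x) \<bullet> (X *v (\<eta> - x))) / 2)"
      using \<mu>0 by (intro mult_left_mono tu) auto
    moreover have "(inverse \<mu> *\<^sub>R X) *v (\<eta> - x) = inverse \<mu> *\<^sub>R (X *v (\<eta> - x))" by (simp add: scaleR_matrix_vector_assoc)
    ultimately show "u \<eta> \<le> u x + (inverse \<mu> *\<^sub>R p) \<bullet> (\<eta> - x) + ((\<eta> - x) \<bullet> ((inverse \<mu> *\<^sub>R X) *v (\<eta> - x))) / 2"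
      by (simp add: distrib_left cancel)
  qed
  \<comment> \<open>H6 takes the same \<open>s = v y\<close> in both terms, so in the equation at
    \<open>x\<close> the value \<open>u x\<close> has to be lowered to
    \<open>inverse \<mu> * v y\<close>. H5 turns the gap into a strictly negative term.\<close>
  have mono: "\<mu> * F (inverse \<mu> *\<^sub>R X) (inverse \<mu> *\<^sub>R p) (inverse \<mu> * v y) x \<le> - (\<gamma> * (D / 2))"
  proof -
    have "\<mu> * u x \<ge> v y" using gap D by linarith
    then have s: "inverse \<mu> * v y \<le> u x" using \<mu>0 by (simp add: field_simps)
    have i2: "inverse \<mu> \<le> 2" using \<mu> by (simp add: inverse_eq_divide pos_divide_le_eq)
    have "\<bar>inverse \<mu> * v y\<bar> \<le> 2 * M"
      unfolding abs_mult using i2 \<mu>0 M(3)[OF xy(2)] by (intro mult_mono) auto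
    then have "- R \<le> inverse \<mu> * v y" "u x \<le> R" using M(1) M(2)[OF xy(1)] by (auto simp: R_def abs_le_iff)
    then have "F (inverse \<mu> *\<^sub>R X) (inverse \<mu> *\<^sub>R p) (u x) x - F (inverse \<mu> *\<^sub>R X) (inverse \<mu> *\<^sub>R p) (inverse \<mu> * v y) x
        \<ge> \<gamma> * (u x - inverse \<mu> * v y)"
      using s by (intro \<gamma>(2) xy(1) sym_mats_scaleR XY(1)) auto
    then have "F (inverse \<mu> *\<^sub>R X) (inverse \<mu> *\<^sub>R p) (inverse \<mu> * v y) x \<le> - (\<gamma> * (u x - inverse \<mu> * v y))" using Fu by linarith
    then have "\<mu> * F (inverse \<mu> *\<^sub>R X) (inverse \<mu> *\<^sub>R p) (inverse \<mu> * v y) x \<le> \<mu> * (- (\<gamma> * (u x - inverse \<mu> * v y)))"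
      using \<mu>0 by (intro mult_left_mono) auto
    also have "\<dots> = - (\<gamma> * (\<mu> * u x - v y))" using \<mu>0 by (simp add: algebra_simps)
    also have "\<dots> \<le> - (\<gamma> * (D / 2))" using gap \<gamma>(1) by simp
    finally show ?thesis .
  qed
  have a2: "a / \<epsilon>\<^sup>2 = \<epsilon> powr (- 2 + \<alpha> - 2 * \<beta>)"
  proof -
    have "\<epsilon>\<^sup>2 = \<epsilon> powr 2" using \<epsilon>(1) by (simp add: powr_numeral)
    then show ?thesis unfolding a_def by (simp add: powr_diff[symmetric] algebra_simps)
  qed
  have form_bounds: "h \<bullet> (X *v h) - k \<bullet> (Y *v k) \<le> K * \<epsilon> powr (- 2 + \<alpha> - 2 * \<beta>) * (norm (h - k))\<^sup>2
        + K * \<epsilon> powr (\<alpha> - 2 * \<beta>) * ((norm h)\<^sup>2 + (norm k)\<^sup>2)"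
    "- (K * \<epsilon> powr (- 2 + \<alpha> - 2 * \<beta>)) * ((norm h)\<^sup>2 + (norm k)\<^sup>2) \<le> h \<bullet> (X *v h) - k \<bullet> (Y *v k)" for h k
  proof -
    have "8 * a / \<epsilon>\<^sup>2 \<le> K * (a / \<epsilon>\<^sup>2)" using K(3) a mult_right_mono[of 8 K "a / \<epsilon>\<^sup>2"] by simp
    then have 1: "8 * a / \<epsilon>\<^sup>2 * (norm (h - k))\<^sup>2 \<le> K * (a / \<epsilon>\<^sup>2) * (norm (h - k))\<^sup>2" by (intro mult_right_mono) auto
    have "8 * a * (B\<^sup>2 + B) + \<delta> \<le> (8 * (B\<^sup>2 + B) + 1) * a" using \<delta>(4) by (simp add: algebra_simps)
    also have "\<dots> \<le> K * a" using K(4) a by (intro mult_right_mono) auto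
    finally have 2: "(8 * a * (B\<^sup>2 + B) + \<delta>) * ((norm h)\<^sup>2 + (norm k)\<^sup>2) \<le> K * a * ((norm h)\<^sup>2 + (norm k)\<^sup>2)" by (intro mult_right_mono) auto
    show "h \<bullet> (X *v h) - k \<bullet> (Y *v k) \<le> K * \<epsilon> powr (- 2 + \<alpha> - 2 * \<beta>) * (norm (h - k))\<^sup>2
        + K * \<epsilon> powr (\<alpha> - 2 * \<beta>) * ((norm h)\<^sup>2 + (norm k)\<^sup>2)"
      using up[of h k] 1 2 unfolding a2 a_def[symmetric] by linarith
    have e1: "a \<le> a / \<epsilon>\<^sup>2" using \<epsilon>(1,2) a by (simp add: pos_le_divide_eq power_le_one)
    have "16 * a * (B\<^sup>2 + B) \<le> 16 * (B\<^sup>2 + B) * (a / \<epsilon>\<^sup>2)"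
      using mult_left_mono[OF e1, of "16 * (B\<^sup>2 + B)"] n(3) by (simp add: ac_simps)
    then have "32 * a / \<epsilon>\<^sup>2 + 16 * a * (B\<^sup>2 + B) \<le> 32 * a / \<epsilon>\<^sup>2 + 16 * (B\<^sup>2 + B) * (a / \<epsilon>\<^sup>2)" by simp
    also have "\<dots> = (32 + 16 * (B\<^sup>2 + B)) * (a / \<epsilon>\<^sup>2)" by (simp add: algebra_simps add_divide_distrib)
    also have "\<dots> \<le> K * (a / \<epsilon>\<^sup>2)" using K(2) a by (intro mult_right_mono) auto
    finally have "(32 * a / \<epsilon>\<^sup>2 + 16 * a * (B\<^sup>2 + B)) * ((norm h)\<^sup>2 + (norm k)\<^sup>2) \<le> K * (a / \<epsilon>\<^sup>2) * ((norm h)\<^sup>2 + (norm k)\<^sup>2)"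
      by (intro mult_right_mono) auto
    then show "- (K * \<epsilon> powr (- 2 + \<alpha> - 2 * \<beta>)) * ((norm h)\<^sup>2 + (norm k)\<^sup>2) \<le> h \<bullet> (X *v h) - k \<bullet> (Y *v k)"
      using lo[of h k] unfolding a2 minus_mult_left[symmetric] by linarith
  qed
  have mats: "block_mat X 0 0 (- Y) \<preceq> (K * \<epsilon> powr (- 2 + \<alpha> - 2 * \<beta>)) *\<^sub>R block_mat (mat 1) (- mat 1) (- mat 1) (mat 1)
           + (K * \<epsilon> powr (\<alpha> - 2 * \<beta>)) *\<^sub>R mat 1"
    "(- (K * \<epsilon> powr (- 2 + \<alpha> - 2 * \<beta>))) *\<^sub>R mat 1 \<preceq> block_mat X 0 0 (- Y)"
    by (rule block_mat_bounds[OF form_bounds])+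
  have grad_diff: "norm (p - q) \<le> K * \<epsilon> * (1 + norm p + norm q)"
  proof -
    have "norm (p - q) \<le> norm (p - P) + norm (Q - P) + norm (q - Q)"
      using dist_triangle[of p q P] dist_triangle[of P q Q] unfolding dist_norm by (simp add: norm_minus_commute[of P Q] norm_minus_commute[of Q q])
    also have "\<dots> \<le> \<delta> + B * \<epsilon> * norm P + \<delta>" using QP pq by linarith
    also have "B * \<epsilon> * norm P \<le> B * \<epsilon> * (norm p + \<delta>)"
      using pq(1) norm_triangle_ineq2[of P p] n(3) \<epsilon>(1) by (intro mult_left_mono) (auto simp: norm_minus_commute)
    finally have "norm (p - q) \<le> 2 * \<delta> + B * \<epsilon> * \<delta> + B * \<epsilon> * norm p" by (simp add: algebra_simps)
    also have "\<dots> \<le> 2 * \<epsilon> + B * \<epsilon> * 1 + (B + 2) * \<epsilon> * norm p"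
      using \<delta> n(3) \<epsilon>(1) by (intro add_mono mult_left_mono mult_right_mono) auto
    also have "\<dots> = (B + 2) * \<epsilon> * (1 + norm p)" by (simp add: algebra_simps)
    also have "\<dots> \<le> K * \<epsilon> * (1 + norm p + norm q)" using K(5) n(3) \<epsilon>(1) by (intro mult_mono) auto
    finally show ?thesis .
  qed
  have grad_size: "norm p + norm q \<le> K * \<epsilon> powr (\<alpha> - 1 - \<beta>)"
  proof -
    \<comment> \<open>The exponent is negative and \<open>\<epsilon> < 1\<close>, so
      \<open>E \<ge> 1\<close> absorbs the errors of size \<delta>.\<close>
    define E where "E = \<epsilon> powr (\<alpha> - 1 - \<beta>)"
    have "\<epsilon> powr 0 \<le> E" unfolding E_def using \<epsilon>(1,2) \<alpha> \<beta> by (intro powr_mono') auto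
    then have E1: "E \<ge> 1" using \<epsilon>(1) by simp
    have "norm P = 2 * (a / \<epsilon>) * norm zh" unfolding PP0 P0_def using a \<epsilon>(1) by simp
    also have "\<dots> \<le> 2 * (a / \<epsilon>) * (sqrt L * \<epsilon> powr \<beta>)" using zh_le a \<epsilon>(1) by (intro mult_left_mono) auto
    also have "\<dots> = 2 * sqrt L * (a * \<epsilon> powr \<beta> / \<epsilon>)" by simp
    also have "a * \<epsilon> powr \<beta> / \<epsilon> = E"
    proof -
      have "a * \<epsilon> powr \<beta> / \<epsilon> = \<epsilon> powr (\<alpha> - 2 * \<beta> + \<beta>) / \<epsilon> powr 1" using \<epsilon>(1) by (simp only: a_def powr_add powr_one)
      also have "\<dots> = \<epsilon> powr (\<alpha> - 2 * \<beta> + \<beta> - 1)" by (rule powr_diff[symmetric])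
      finally show ?thesis by (simp add: E_def algebra_simps)
    qed
    finally have nP: "norm P \<le> 2 * sqrt L * E" .
    have "norm Q \<le> (1 + B) * norm P"
    proof -
      have "(1 + B * \<epsilon>) * norm P \<le> (1 + B * 1) * norm P" using n(3) \<epsilon>(2) by (intro mult_right_mono add_left_mono mult_left_mono) auto
      then show ?thesis using nQ by simp
    qed
    then have "norm p + norm q \<le> (2 + B) * norm P + 2 * \<delta>"
      using pq norm_triangle_ineq2[of p P] norm_triangle_ineq2[of q Q] by (simp add: algebra_simps)
    also have "\<dots> \<le> (2 + B) * (2 * sqrt L * E) + 2 * E"
      using nP n(3) \<delta>(2) E1 by (intro add_mono mult_left_mono) auto
    also have "\<dots> = ((2 + B) * (2 * sqrt L) + 2) * E" by (simp add: algebra_simps)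
    also have "\<dots> \<le> K * E" using K(6) E1 by (intro mult_right_mono) auto
    finally show ?thesis by (simp add: E_def)
  qed
  have "\<bar>v y\<bar> \<le> R" using M(1) M(3)[OF xy(2)] by (simp add: R_def)
  then have "F Y q (v y) y - \<mu> * F (inverse \<mu> *\<^sub>R X) (inverse \<mu> *\<^sub>R p) (inverse \<mu> * v y) x \<le> \<omega> ((1 - \<mu>) + C\<mu> \<mu> * \<epsilon>)"
    by (intro structure_modulusD[OF struct] \<mu>0 \<mu>(2) \<epsilon>(1) xy XY mats grad_diff grad_size dist_xy)
  then have "\<gamma> * D / 2 \<le> \<omega> ((1 - \<mu>) + C\<mu> \<mu> * \<epsilon>)" using Fv mono by simp
  moreover have "0 \<le> C\<mu> \<mu> * \<epsilon>" using C\<mu>[OF \<mu>0 \<mu>(2)] \<epsilon>(1) by simp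
  then have "\<omega> ((1 - \<mu>) + C\<mu> \<mu> * \<epsilon>) < \<gamma> * D / 2" using \<mu>(2,3) \<epsilon>(8) by (intro t1(2)) auto
  ultimately show False by simp
qed

end
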